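(* Let $\mathcal{A}$ be a Banach algebra with a (uniformly bounded) $d$-parameter automorphism group $\Psi$, let $\{\hat\varphi_k\}_{k\ge-1}$ be a dyadic partition of unity, and let $1\le p\le\infty$, $r>0$. An element $a\in C(\mathcal{A})$ belongs to $\Lambda^p_r(\mathcal{A})$ if and only if $$\Bigl(\sum_{k=-1}^\infty 2^{rkp}\|\varphi_k*a\|_{\mathcal{A}}^p\Bigr)^{1/p}<\infty$$ (with the supremum $\sup_{k\ge-1}2^{rk}\|\varphi_k*a\|_{\mathcal{A}}$ if $p=\infty$). This expression defines an equivalent norm on $\Lambda^p_r(\mathcal{A})$. Moreover, for $a\in\Lambda^p_r(\mathcal{A})$ the Littlewood-Paley decomposition $\sum_{k=-1}^\infty\varphi_k*a$ converges to $a$ in the norm of $\mathcal{A}$.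
   Context: Banach algebras are complex and unital. A $d$-parameter automorphism group acting on a Banach algebra $\mathcal{A}$ is a family $\Psi=\{\psi_t\}_{t\in\mathbb{R}^d}$ of Banach algebra automorphisms of $\mathcal{A}$ with $\psi_s\psi_t=\psi_{s+t}$ for all $s,t\in\mathbb{R}^d$ (consisting of $*$-automorphisms if $\mathcal{A}$ is a $*$-algebra). It is always assumed uniformly bounded: $M_\Psi=\sup_{t\in\mathbb{R}^d}\|\psi_t\|_{\mathcal{A}\to\mathcal{A}}<\infty$. Let $C(\mathcal{A})=\{a\in\mathcal{A}:\lim_{t\to0}\|\psi_t(a)-a\|_{\mathcal{A}}=0\}$; one has $\Lambda^p_r(\mathcal{A})\subseteq C(\mathcal{A})$. Besov spaces: put $\Delta_t^k=(\psi_t-\mathrm{id})^k$ and $\omega^k_h(a)=\sup_{|t|\le h}\|\Delta_t^k a\|_{\mathcal{A}}$ for $h>0$, where $|t|=\sum_j|t_j|$ (any other norm on $\mathbb{R}^d$ gives the same spaces with equivalent norms). For $1\le p\le\infty$, $r>0$ and $l=\lfloor r\rfloor+1$, $\Lambda^p_r(\mathcal{A})$ consists of all $a\in\mathcal{A}$ for which $\|a\|_{\Lambda^p_r(\mathcal{A})}=\|a\|_{\mathcal{A}}+\bigl(\int_0^\infty (h^{-r}\omega^l_h(a))^p\,\frac{dh}{h}\bigr)^{1/p}$ is finite (for $p=\infty$: $\|a\|_{\mathcal{A}}+\sup_{h>0}h^{-r}\omega^l_h(a)$, up to equivalence of norms). Action: for a finite Borel measure $\mu$ on $\mathbb{R}^d$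 and $a\in C(\mathcal{A})$, $\mu*a=\int_{\mathbb{R}^d}\psi_{-t}(a)\,d\mu(t)$; for $f\in L^1(\mathbb{R}^d)$, $f*a=\int_{\mathbb{R}^d}\psi_{-t}(a)f(t)\,dt$. Dyadic partition of unity: the Fourier transform is $\hat f(\omega)=\int_{\mathbb{R}^d}f(x)e^{-2\pi i\omega\cdot x}dx$. Let $\varphi\in\mathscr{S}(\mathbb{R}^d)$ (Schwartz space) satisfy $\operatorname{supp}\hat\varphi\subseteq\{\omega:2^{-1}\le|\omega|_\infty\le2\}$, $\hat\varphi(\omega)>0$ for $2^{-1}<|\omega|_\infty<2$, and $\sum_{k\in\mathbb{Z}}\hat\varphi(2^{-k}\omega)=1$ for all $\omega\ne0$. Put $\hat\varphi_k(\omega)=\hat\varphi(2^{-k}\omega)$ for $k\ge0$ and $\hat\varphi_{-1}=1-\sum_{k=0}^\infty\hat\varphi_k$. Then $\{\hat\varphi_k\}_{k\ge-1}$ is called a dyadic partition of unity. *)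

theory Defs
  imports "HOL-Analysis.Analysis"
begin

section \<open>Complex unital Banach algebras and automorphism groups\<close>

text \<open>The unit is only required to be nonzero; its norm need not be 1.\<close>

class complex_banach_algebra = real_algebra_1 + real_normed_algebra + banach +
  fixes scaleC :: "complex \<Rightarrow> 'a \<Rightarrow> 'a"  (infixr "*\<^sub>C" 75)
  assumes scaleC_add_right: "c *\<^sub>C (a + b) = c *\<^sub>C a + c *\<^sub>C b"
    and scaleC_add_left: "(c + c') *\<^sub>C a = c *\<^sub>C a + c' *\<^sub>C a"
    and scaleC_scaleC: "c *\<^sub>C (c' *\<^sub>C a) = (c * c') *\<^sub>C a"
    and scaleC_of_real: "complex_of_real x *\<^sub>C a = x *\<^sub>R a"
    and mult_scaleC_left: "(c *\<^sub>C a) * b = c *\<^sub>C (a * b)"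
    and mult_scaleC_right: "a * (c *\<^sub>C b) = c *\<^sub>C (a * b)"
    and norm_scaleC: "norm (c *\<^sub>C a) = cmod c * norm a"

definition banach_algebra_automorphism :: "('a::complex_banach_algebra \<Rightarrow> 'a) \<Rightarrow> bool" where
  "banach_algebra_automorphism f \<longleftrightarrow>
     bounded_linear f \<and> (\<forall>c a. f (c *\<^sub>C a) = c *\<^sub>C f a) \<and> (\<forall>a b. f (a * b) = f a * f b) \<and> bij f"

text \<open>Uniform boundedness is part of the notion; no continuity in \<open>t\<close> is required.\<close>

definition automorphism_group :: "(real^'d \<Rightarrow> 'a::complex_banach_algebra \<Rightarrow> 'a) \<Rightarrow> bool" where
  "automorphism_group \<psi> \<longleftrightarrow>
     (\<forall>t. banach_algebra_automorphism (\<psi> t)) \<and> (\<forall>s t. \<psi> s \<circ> \<psi> t = \<psi> (s + t)) \<and>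
     bdd_above (range (\<lambda>t. onorm (\<psi> t)))"

definition continuous_elements :: "(real^'d \<Rightarrow> 'a::complex_banach_algebra \<Rightarrow> 'a) \<Rightarrow> 'a set" where
  "continuous_elements \<psi> = {a. ((\<lambda>t. norm (\<psi> t a - a)) \<longlongrightarrow> 0) (at 0)}"


section \<open>Norms with values in the extended nonnegative reals\<close>

text \<open>Only used for exponents \<open>q > 0\<close>, so that \<open>\<infinity>\<close> is sent to \<open>\<infinity>\<close>.\<close>

definition enn_powr :: "ennreal \<Rightarrow> real \<Rightarrow> ennreal" where
  "enn_powr x q = (if x = \<infinity> then \<infinity> else ennreal (enn2real x powr q))"

definition norm_on :: "'a::complex_banach_algebra set \<Rightarrow> ('a \<Rightarrow> ennreal) \<Rightarrow> bool" where
  "norm_on V N \<longleftrightarrow>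
     0 \<in> V \<and> (\<forall>a\<in>V. \<forall>b\<in>V. a + b \<in> V) \<and> (\<forall>c. \<forall>a\<in>V. c *\<^sub>C a \<in> V) \<and>
     (\<forall>a\<in>V. N a < \<infinity>) \<and> (\<forall>a\<in>V. N a = 0 \<longleftrightarrow> a = 0) \<and>
     (\<forall>a\<in>V. \<forall>b\<in>V. N (a + b) \<le> N a + N b) \<and>
     (\<forall>c. \<forall>a\<in>V. N (c *\<^sub>C a) = ennreal (cmod c) * N a)"

definition equivalent_on :: "'a set \<Rightarrow> ('a \<Rightarrow> ennreal) \<Rightarrow> ('a \<Rightarrow> ennreal) \<Rightarrow> bool" where
  "equivalent_on V N N' \<longleftrightarrow>
     (\<exists>C::real. C > 0 \<and> (\<forall>a\<in>V. N a \<le> ennreal C * N' a \<and> N' a \<le> ennreal C * N a))"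


section \<open>Besov spaces\<close>

definition l1norm :: "real^'d \<Rightarrow> real" where
  "l1norm t = (\<Sum>j\<in>UNIV. \<bar>t $ j\<bar>)"

definition difference ::
    "(real^'d \<Rightarrow> 'a::complex_banach_algebra \<Rightarrow> 'a) \<Rightarrow> nat \<Rightarrow> real^'d \<Rightarrow> 'a \<Rightarrow> 'a" where
  "difference \<psi> k t = (\<lambda>b. \<psi> t b - b) ^^ k"

text \<open>The real supremum is meaningful because \<open>\<psi>\<close> is uniformly bounded.\<close>

definition modulus ::
    "(real^'d \<Rightarrow> 'a::complex_banach_algebra \<Rightarrow> 'a) \<Rightarrow> nat \<Rightarrow> real \<Rightarrow> 'a \<Rightarrow> real" where
  "modulus \<psi> k h a = (SUP t\<in>{t. l1norm t \<le> h}. norm (difference \<psi> k t a))"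

definition besov_norm ::
    "(real^'d \<Rightarrow> 'a::complex_banach_algebra \<Rightarrow> 'a) \<Rightarrow> ennreal \<Rightarrow> real \<Rightarrow> 'a \<Rightarrow> ennreal" where
  "besov_norm \<psi> p r a =
     (let l = nat \<lfloor>r\<rfloor> + 1; q = enn2real p in
      ennreal (norm a) +
      (if p = \<infinity> then (SUP h\<in>{0<..}. ennreal (h powr (- r) * modulus \<psi> l h a))
       else enn_powr (\<integral>\<^sup>+h\<in>{0<..}. ennreal ((h powr (- r) * modulus \<psi> l h a) powr q / h) \<partial>lborel)
              (1 / q)))"

definition besov_space ::
    "(real^'d \<Rightarrow> 'a::complex_banach_algebra \<Rightarrow> 'a) \<Rightarrow> ennreal \<Rightarrow> real \<Rightarrow> 'a set" where
  "besov_space \<psi> p r = {a. besov_norm \<psi> p r a < \<infinity>}"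


section \<open>Schwartz functions and the Fourier transform\<close>

definition partial_deriv :: "'d \<Rightarrow> (real^'d \<Rightarrow> complex) \<Rightarrow> real^'d \<Rightarrow> complex" where
  "partial_deriv j f x = frechet_derivative f (at x) (axis j 1)"

text \<open>Partial derivatives of all orders are indexed by lists of coordinates; differentiability of
  all of them amounts to smoothness.\<close>

definition schwartz :: "(real^'d \<Rightarrow> complex) \<Rightarrow> bool" where
  "schwartz f \<longleftrightarrow>
     (\<forall>js. (\<forall>x. foldr partial_deriv js f differentiable (at x)) \<and>
       (\<forall>\<alpha> :: 'd \<Rightarrow> nat. bounded (range (\<lambda>x.
          complex_of_real (\<Prod>j\<in>UNIV. x $ j ^ \<alpha> j) * foldr partial_deriv js f x))))"

definition fourier :: "(real^'d \<Rightarrow> complex) \<Rightarrow> real^'d \<Rightarrow> complex" where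
  "fourier f \<omega> = (\<integral>x. f x * cis (- 2 * pi * (\<omega> \<bullet> x)) \<partial>lborel)"

definition inverse_fourier :: "(real^'d \<Rightarrow> complex) \<Rightarrow> real^'d \<Rightarrow> complex" where
  "inverse_fourier g x = (\<integral>\<omega>. g \<omega> * cis (2 * pi * (\<omega> \<bullet> x)) \<partial>lborel)"


section \<open>Littlewood-Paley decomposition\<close>

text \<open>The function \<open>\<phi>\<close> generating a dyadic partition of unity; \<open>infnorm\<close> is the maximum norm.\<close>

definition dyadic_generator :: "(real^'d \<Rightarrow> complex) \<Rightarrow> bool" where
  "dyadic_generator \<phi> \<longleftrightarrow>
     schwartz \<phi> \<and>
     closure {\<omega>. fourier \<phi> \<omega> \<noteq> 0} \<subseteq> {\<omega>. 1/2 \<le> infnorm \<omega> \<and> infnorm \<omega> \<le> 2} \<and>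
     (\<forall>\<omega>. 1/2 < infnorm \<omega> \<and> infnorm \<omega> < 2 \<longrightarrow> fourier \<phi> \<omega> \<in> \<real> \<and> 0 < Re (fourier \<phi> \<omega>)) \<and>
     (\<forall>\<omega>. \<omega> \<noteq> 0 \<longrightarrow> ((\<lambda>k::int. fourier \<phi> (2 powi (- k) *\<^sub>R \<omega>)) has_sum 1) UNIV)"

text \<open>The members of the dyadic partition of unity. Only the indices \<open>k \<ge> -1\<close> are meaningful;
  the second branch is the case \<open>k = -1\<close>.\<close>

definition dyadic_symbol :: "(real^'d \<Rightarrow> complex) \<Rightarrow> int \<Rightarrow> real^'d \<Rightarrow> complex" where
  "dyadic_symbol \<phi> k \<omega> =
     (if k \<ge> 0 then fourier \<phi> (2 powi (- k) *\<^sub>R \<omega>)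
      else 1 - (\<Sum>n. fourier \<phi> (2 powi (- int n) *\<^sub>R \<omega>)))"

definition dyadic_function :: "(real^'d \<Rightarrow> complex) \<Rightarrow> int \<Rightarrow> real^'d \<Rightarrow> complex" where
  "dyadic_function \<phi> k = inverse_fourier (dyadic_symbol \<phi> k)"

text \<open>The Bochner integral of the library needs a second countable codomain, which a Banach algebra
  need not be. The action is therefore written with the Henstock-Kurzweil integral, which agrees
  with the Bochner integral wherever the latter exists, in particular for integrable \<open>f\<close> and
  \<open>a \<in> continuous_elements \<psi>\<close>.\<close>

definition action ::
    "(real^'d \<Rightarrow> 'a::complex_banach_algebra \<Rightarrow> 'a) \<Rightarrow> (real^'d \<Rightarrow> complex) \<Rightarrow> 'a \<Rightarrow> 'a" where
  "action \<psi> f a = integral UNIV (\<lambda>t. f t *\<^sub>C \<psi> (- t) a)"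

text \<open>The sum and the supremum over \<open>k \<ge> -1\<close> are indexed by natural numbers through
  \<open>k = n - 1\<close>.\<close>

definition littlewood_paley_norm ::
    "(real^'d \<Rightarrow> 'a::complex_banach_algebra \<Rightarrow> 'a) \<Rightarrow> (real^'d \<Rightarrow> complex) \<Rightarrow>
     ennreal \<Rightarrow> real \<Rightarrow> 'a \<Rightarrow> ennreal" where
  "littlewood_paley_norm \<psi> \<phi> p r a =
     (let k = (\<lambda>n. int n - 1); q = enn2real p in
      if p = \<infinity> then
        (SUP n. ennreal (2 powr (r * real_of_int (k n)) * norm (action \<psi> (dyadic_function \<phi> (k n)) a)))
      else
        enn_powr
          (\<Sum>n. ennreal (2 powr (r * real_of_int (k n) * q) * norm (action \<psi> (dyadic_function \<phi> (k n)) a) powr q))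
          (1 / q))"

end

theory Submission
  imports Defs "HOL-Probability.Probability"
begin

text \<open>The partial sums of the Littlewood-Paley decomposition are convolutions with dilates of one low-pass
  kernel \<open>\<Phi>\<close>. It decays rapidly because finite differences of its compactly supported Fourier transform are
  small, and Fourier inversion gives \<open>\<Phi>\<^sub>t * \<Phi>\<^sub>s = \<Phi>\<^sub>s\<close> whenever \<open>4 s \<le> t\<close>. Averaging the \<open>l\<close>-th differences of
  \<open>a\<close> against \<open>\<Phi>\<^sub>s\<close> yields \<open>\<plusminus>a\<close> plus terms of frequency below \<open>s\<close>, so the blocks of \<open>a\<close> are bounded by
  its moduli of smoothness. Conversely the reproducing identity yields Bernstein's inequality for the blocks, and
  summing over the blocks bounds the moduli by a discrete convolution, which Jensen's inequality controls in \<open>l\<^sup>p\<close>.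
  Identities between vector-valued integrals are reduced to scalar ones by the Hahn-Banach theorem, and
  Marchaud's inequality shows that the elements of a Besov space are continuous elements.\<close>

section \<open>Integration over Euclidean space\<close>

text \<open>The symbol of index -1 is given only as 1 minus a series, so neither smoothness nor
  Schwartz decay of its kernel comes for free. Three facts about this one kernel carry the proof:
  rapid decay, integral 1, and an L^1 translation error of order |u|. The last is drawn from the
  two-scale relation between the kernel, its dilate by 1/2 and \<open>\<phi>\<close>, without
  differentiating the kernel itself. The factor 4 between scales is safe because the symbol at scale
  s lives on infnorm at most s, while the symbol at scale t equals 1 below t / 2. From blocks to
  moduli, the convolution kernel is min 1 (u^l) * u^(-r) at u = 2^n * h. It decays at both ends
  because 0 < r < l, and is majorised by a weight whose sum over n is bounded uniformly in h and
  whose integral against dh / h does not depend on n. The first bound feeds Jensen's inequality, the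
  second the integration over h.\<close>

lemma
  fixes f :: "'d::finite \<Rightarrow> real \<Rightarrow> 'b::{real_normed_field,banach,second_countable_topology}"
  assumes "\<And>j. integrable lborel (f j)"
  shows integrable_lborel_prod_vec: "integrable lborel (\<lambda>x::real^'d. \<Prod>j\<in>UNIV. f j (x $ j))"
    and integral_lborel_prod_vec:
      "(\<integral>x. (\<Prod>j\<in>UNIV. f j (x $ j)) \<partial>(lborel :: (real^'d) measure)) = (\<Prod>j\<in>UNIV. integral\<^sup>L lborel (f j))"
proof -
  interpret product_sigma_finite "\<lambda>_::real^'d. lborel :: real measure" ..
  \<comment> \<open>Lebesgue measure is a product measure indexed by \<open>Basis\<close>;
    \<open>idx\<close> reads the coordinate back from a basis vector, turning products over
    \<open>Basis\<close> into products over the coordinate type.\<close>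
  define idx :: "real^'d \<Rightarrow> 'd" where "idx = inv (\<lambda>j. axis j (1::real))"
  have inj: "inj (\<lambda>j::'d. axis j (1::real))" by (auto simp: inj_def axis_eq_axis)
  have idx: "idx (axis j 1) = j" for j unfolding idx_def by (rule inv_f_f[OF inj])
  have basis: "(Basis :: (real^'d) set) = range (\<lambda>j. axis j 1)"
    by (auto simp: Basis_vec_def)
  have coord: "(\<Sum>b\<in>Basis. g b * b $ j) = g (axis j 1)" for g :: "real^'d \<Rightarrow> real" and j
  proof -
    have "(\<Sum>b\<in>Basis. g b * b $ j) = (\<Sum>b\<in>Basis. g b *\<^sub>R b) \<bullet> axis j 1"
      by (simp add: inner_axis)
    also have "\<dots> = g (axis j 1)"
      by (simp add: inner_sum_left inner_Basis if_distrib cong: if_cong)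
    finally show ?thesis .
  qed
  have prod_eq: "(\<Prod>j\<in>UNIV. f j (\<Sum>b\<in>Basis. g b * b $ j)) = (\<Prod>b\<in>Basis. f (idx b) (g b))"
    for g :: "real^'d \<Rightarrow> real"
    unfolding basis coord[unfolded basis] by (subst prod.reindex[OF inj]) (simp add: idx)
  have meas[measurable]: "(\<lambda>x::real^'d. \<Prod>j\<in>UNIV. f j (x $ j)) \<in> borel_measurable borel"
  proof (intro borel_measurable_prod)
    fix j :: 'd
    have [measurable]: "f j \<in> borel_measurable borel" using borel_measurable_integrable[OF assms] by simp
    show "(\<lambda>x::real^'d. f j (x $ j)) \<in> borel_measurable borel" by measurable
  qed
  have int: "integrable lborel (f (idx b))" for b by (rule assms)
  show "integrable lborel (\<lambda>x::real^'d. \<Prod>j\<in>UNIV. f j (x $ j))"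
    unfolding lborel_eq[where 'a="real^'d"]
    by (subst integrable_distr_eq)
       (auto simp: prod_eq intro!: product_integrable_prod int)
  show "(\<integral>x. (\<Prod>j\<in>UNIV. f j (x $ j)) \<partial>(lborel :: (real^'d) measure)) = (\<Prod>j\<in>UNIV. integral\<^sup>L lborel (f j))"
    unfolding lborel_eq[where 'a="real^'d"]
    apply (subst integral_distr, simp, simp)
    apply (simp add: prod_eq)
    apply (subst product_integral_prod[OF _ int], simp)
    apply (simp add: basis prod.reindex[OF inj] idx)
    done
qed

lemma
  fixes f :: "'a::euclidean_space \<Rightarrow> 'b::{banach,second_countable_topology}"
  assumes c: "c \<noteq> 0" and f: "integrable lborel f"
  shows integrable_lborel_affine: "integrable lborel (\<lambda>x. f (t + c *\<^sub>R x))"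
    and integral_lborel_affine:
      "(\<integral>x. f (t + c *\<^sub>R x) \<partial>lborel) = (1 / \<bar>c\<bar> ^ DIM('a)) *\<^sub>R integral\<^sup>L lborel f"
proof -
  have [measurable]: "f \<in> borel_measurable borel" using borel_measurable_integrable[OF f] by simp
  have "integrable (density (distr lborel borel (\<lambda>x. t + c *\<^sub>R x)) (\<lambda>_. ennreal (\<bar>c\<bar> ^ DIM('a)))) f"
    using f lborel_affine[OF c, of t] by simp
  then have "integrable lborel (\<lambda>x. \<bar>c\<bar> ^ DIM('a) *\<^sub>R f (t + c *\<^sub>R x))"
    by (subst (asm) integrable_density) (auto simp: integrable_distr_eq)
  from integrable_scaleR_right[OF this, of "1 / \<bar>c\<bar> ^ DIM('a)"]
  show "integrable lborel (\<lambda>x. f (t + c *\<^sub>R x))"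
    using c by (simp only: scaleR_scaleR) simp
  have "integral\<^sup>L lborel f
      = integral\<^sup>L (density (distr lborel borel (\<lambda>x. t + c *\<^sub>R x)) (\<lambda>_. ennreal (\<bar>c\<bar> ^ DIM('a)))) f"
    using lborel_affine[OF c, of t] by simp
  also have "\<dots> = \<bar>c\<bar> ^ DIM('a) *\<^sub>R (\<integral>x. f (t + c *\<^sub>R x) \<partial>lborel)"
    by (subst integral_density) (auto simp: integral_distr)
  finally show "(\<integral>x. f (t + c *\<^sub>R x) \<partial>lborel) = (1 / \<bar>c\<bar> ^ DIM('a)) *\<^sub>R integral\<^sup>L lborel f"
    using c by simp
qed

lemma
  fixes f :: "'a::euclidean_space \<Rightarrow> 'b::{banach,second_countable_topology}"
  assumes f: "integrable lborel f"
  shows integrable_lborel_translate: "integrable lborel (\<lambda>x. f (x + t))"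
    and integral_lborel_translate: "(\<integral>x. f (x + t) \<partial>lborel) = integral\<^sup>L lborel f"
    and integrable_lborel_reflect: "integrable lborel (\<lambda>x. f (t - x))"
    and integral_lborel_reflect: "(\<integral>x. f (t - x) \<partial>lborel) = integral\<^sup>L lborel f"
    and integrable_lborel_scale: "c \<noteq> 0 \<Longrightarrow> integrable lborel (\<lambda>x. f (c *\<^sub>R x))"
    and integral_lborel_scale:
      "c \<noteq> 0 \<Longrightarrow> (\<integral>x. f (c *\<^sub>R x) \<partial>lborel) = (1 / \<bar>c\<bar> ^ DIM('a)) *\<^sub>R integral\<^sup>L lborel f"
  using integrable_lborel_affine[OF _ f, of 1 t] integral_lborel_affine[OF _ f, of 1 t]
    integrable_lborel_affine[OF _ f, of "-1" t] integral_lborel_affine[OF _ f, of "-1" t]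
    integrable_lborel_affine[OF _ f, of c 0] integral_lborel_affine[OF _ f, of c 0]
  by (simp_all add: add.commute)

lemma integrable_inverse_square: "integrable lborel (\<lambda>x::real. 1 / (1 + x\<^sup>2))"
proof -
  have deriv: "(arctan has_real_derivative 1 / (1 + x\<^sup>2)) (at x)" for x :: real
    using DERIV_arctan[of x] by (simp add: divide_inverse)
  have 1: "set_integrable lborel (einterval (-\<infinity>) \<infinity>) (\<lambda>x::real. 1 / (1 + x\<^sup>2))"
  proof (rule interval_integral_FTC_nonneg(1)[where F=arctan and A="-pi/2" and B="pi/2"])
    show "(((arctan \<circ> real_of_ereal)) \<longlongrightarrow> - pi / 2) (at_right (-\<infinity>))"
      using tendsto_arctan_at_bot
      by (subst ereal_tendsto_simps) auto
    show "(((arctan \<circ> real_of_ereal)) \<longlongrightarrow> pi / 2) (at_left \<infinity>)"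
      using tendsto_arctan_at_top
      by (subst ereal_tendsto_simps) auto
    show "isCont (\<lambda>x. 1 / (1 + x\<^sup>2)) x" for x :: real
      by (intro continuous_intros) (simp add: add_nonneg_eq_0_iff)
  qed (auto intro: deriv)
  then show ?thesis by (simp add: set_integrable_def)
qed

text \<open>An exponent of twice the dimension leaves room for a product bound: each
  \<open>1 + (x $ j)\<^sup>2\<close> is at most (1 + norm x)^2, so the integrand is dominated by a
  product of one-dimensional integrable functions.\<close>

lemma integrable_inverse_norm_power:
  assumes "2 * CARD('d) \<le> N"
  shows "integrable lborel (\<lambda>x::real^'d. 1 / (1 + norm x) ^ N)"
proof (rule Bochner_Integration.integrable_bound)
  show "integrable lborel (\<lambda>x::real^'d. \<Prod>j\<in>UNIV. 1 / (1 + (x $ j)\<^sup>2))"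
    by (rule integrable_lborel_prod_vec) (rule integrable_inverse_square)
  show "AE x::real^'d in lborel. norm (1 / (1 + norm x) ^ N) \<le> norm (\<Prod>j\<in>UNIV. 1 / (1 + (x $ j)\<^sup>2))"
  proof (intro AE_I2)
    fix x :: "real^'d"
    have pos: "0 < 1 + (x $ j)\<^sup>2" for j by (simp add: add_pos_nonneg)
    have "(\<Prod>j\<in>UNIV. 1 + (x $ j)\<^sup>2) \<le> (\<Prod>j\<in>(UNIV::'d set). (1 + norm x)\<^sup>2)"
    proof (rule prod_mono)
      fix j :: 'd
      have "(x $ j)\<^sup>2 \<le> (norm x)\<^sup>2"
        using component_le_norm_cart[of x j] by (metis abs_ge_zero power2_abs power_mono)
      then show "0 \<le> 1 + (x $ j)\<^sup>2 \<and> 1 + (x $ j)\<^sup>2 \<le> (1 + norm x)\<^sup>2"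
        using norm_ge_zero[of x] by (simp add: power2_sum del: norm_ge_zero)
    qed
    also have "\<dots> = (1 + norm x) ^ (2 * CARD('d))" by (simp add: power_mult)
    also have "\<dots> \<le> (1 + norm x) ^ N" by (rule power_increasing) (use assms in auto)
    finally have le: "(\<Prod>j\<in>UNIV. 1 + (x $ j)\<^sup>2) \<le> (1 + norm x) ^ N" .
    have "1 / (1 + norm x) ^ N \<le> 1 / (\<Prod>j\<in>UNIV. 1 + (x $ j)\<^sup>2)"
      by (rule divide_left_mono[OF le]) (auto intro!: mult_pos_pos prod_pos pos zero_less_power add_pos_nonneg)
    then show "norm (1 / (1 + norm x) ^ N) \<le> norm (\<Prod>j\<in>UNIV. 1 / (1 + (x $ j)\<^sup>2))"
      using pos by (simp add: prod_dividef prod_nonneg less_imp_le)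
  qed
qed measurable

section \<open>Fourier inversion\<close>

lemma measurable_cis [measurable]: "cis \<in> borel_measurable borel"
  by (intro borel_measurable_continuous_onI continuous_intros)

lemma norm_cis_minus_one_le: "norm (cis x - 1) \<le> \<bar>x\<bar>"
  using iexp_approx1[of x 0] by (simp add: cis_conv_exp)

lemma integrable_mult_cis:
  fixes f :: "real^'d \<Rightarrow> complex"
  assumes "integrable lborel f"
  shows "integrable lborel (\<lambda>x. f x * cis (c * (w \<bullet> x)))"
    and "integrable lborel (\<lambda>x. f x * cis (c * (x \<bullet> w)))"
proof -
  have [measurable]: "f \<in> borel_measurable borel" using borel_measurable_integrable[OF assms] by simp
  show 1: "integrable lborel (\<lambda>x. f x * cis (c * (w \<bullet> x)))"
    by (rule Bochner_Integration.integrable_bound[OF assms]) (simp_all add: norm_mult)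
  then show "integrable lborel (\<lambda>x. f x * cis (c * (x \<bullet> w)))"
    by (simp add: inner_commute)
qed

lemma norm_inverse_fourier_le:
  assumes "integrable lborel f"
  shows "norm (inverse_fourier f x) \<le> (\<integral>w. norm (f w) \<partial>lborel)"
proof -
  have "norm (inverse_fourier f x) \<le> (\<integral>w. norm (f w * cis (2 * pi * (w \<bullet> x))) \<partial>lborel)"
    unfolding inverse_fourier_def by (rule integral_norm_bound)
  then show ?thesis by (simp add: norm_mult)
qed

lemma norm_fourier_le:
  assumes "integrable lborel f"
  shows "norm (fourier f x) \<le> (\<integral>w. norm (f w) \<partial>lborel)"
proof -
  have "norm (fourier f x) \<le> (\<integral>w. norm (f w * cis (- 2 * pi * (x \<bullet> w))) \<partial>lborel)"
    unfolding fourier_def by (rule integral_norm_bound)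
  then show ?thesis by (simp add: norm_mult)
qed

lemma fourier_eq_inverse_fourier: "fourier f w = inverse_fourier f (- w)"
  by (simp add: fourier_def inverse_fourier_def inner_commute)

lemma continuous_inverse_fourier:
  fixes f :: "real^'d \<Rightarrow> complex"
  assumes f: "integrable lborel f"
  shows "continuous_on UNIV (inverse_fourier f)"
  unfolding continuous_on_def
proof (intro ballI)
  fix x :: "real^'d"
  have [measurable]: "f \<in> borel_measurable borel" using borel_measurable_integrable[OF f] by simp
  show "(inverse_fourier f \<longlongrightarrow> inverse_fourier f x) (at x within UNIV)"
    unfolding inverse_fourier_def tendsto_at_iff_sequentially
  proof (intro allI impI, unfold o_def)
    fix X :: "nat \<Rightarrow> real^'d" assume X: "X \<longlonglongrightarrow> x"
    show "(\<lambda>i. \<integral>w. f w * cis (2 * pi * (w \<bullet> X i)) \<partial>lborel) \<longlonglongrightarrow> (\<integral>w. f w * cis (2 * pi * (w \<bullet> x)) \<partial>lborel)"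
    proof (rule integral_dominated_convergence[where w="\<lambda>w. norm (f w)"])
      show "AE w in lborel. (\<lambda>i. f w * cis (2 * pi * (w \<bullet> X i))) \<longlonglongrightarrow> f w * cis (2 * pi * (w \<bullet> x))"
        by (intro AE_I2 tendsto_intros isCont_tendsto_compose[OF _ tendsto_mult] isCont_tendsto_compose[where g=cis] X)
           (auto intro!: continuous_intros continuous_on_interior[of UNIV])
    qed (use f in \<open>auto simp: norm_mult\<close>)
  qed
qed

lemma continuous_fourier:
  assumes "integrable lborel f"
  shows "continuous_on UNIV (fourier f)"
  unfolding fourier_eq_inverse_fourier[abs_def]
  by (rule continuous_on_compose2[OF continuous_inverse_fourier[OF assms]]) (auto intro!: continuous_intros)

section \<open>The Gaussian and its Fourier transform\<close>

definition gauss :: "real^'d \<Rightarrow> real" where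
  "gauss x = (\<Prod>j\<in>UNIV. std_normal_density (x $ j) * sqrt (2 * pi))"

text \<open>The transform of \<open>gauss\<close>, which is exp (- |x|^2 / 2) with value 1 at the
  origin. Both are kept as products over the coordinates so that integrals factor.\<close>

definition gauss_hat :: "real^'d \<Rightarrow> real" where
  "gauss_hat y = (\<Prod>j\<in>UNIV. sqrt (2 * pi) * exp (- (2 * pi * y $ j)\<^sup>2 / 2))"

lemma integrable_gauss: "integrable lborel (gauss :: real^'d \<Rightarrow> real)"
  unfolding gauss_def by (rule integrable_lborel_prod_vec) simp

lemma gauss_0: "gauss 0 = 1"
  by (simp add: gauss_def std_normal_density_def)

lemma gauss_nonneg: "0 \<le> gauss x"
  by (simp add: gauss_def prod_nonneg)

lemma gauss_le_1: "gauss x \<le> 1"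
  unfolding gauss_def by (intro prod_le_1) (simp add: std_normal_density_def)

lemma continuous_gauss: "continuous_on UNIV gauss"
  unfolding gauss_def std_normal_density_def by (intro continuous_intros) auto

lemma cis_sum: "finite A \<Longrightarrow> cis (sum f A) = (\<Prod>a\<in>A. cis (f a))"
  by (induction A rule: finite_induct) (auto simp flip: cis_mult)

text \<open>In each coordinate this is the characteristic function of the standard normal
  distribution, evaluated at \<open>2 * pi * y $ j\<close>.\<close>

lemma inverse_fourier_gauss:
  "inverse_fourier (\<lambda>x. complex_of_real (gauss x)) y = complex_of_real (gauss_hat y)"
proof -
  have char: "(\<integral>s. complex_of_real (std_normal_density s) * cis (t * s) \<partial>lborel) = of_real (exp (- t\<^sup>2 / 2))" for t
    using fun_cong[OF char_std_normal_distribution, of t]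
    unfolding char_def
    by (subst (asm) integral_density) (auto simp: cis_conv_exp scaleR_conv_of_real mult_ac)
  have int: "integrable lborel (\<lambda>s. complex_of_real (std_normal_density s * sqrt (2 * pi)) * cis (2 * pi * y $ j * s))" for j
    by (rule Bochner_Integration.integrable_bound[where f="\<lambda>s. std_normal_density s * sqrt (2 * pi)"])
       (auto simp: norm_mult)
  have "inverse_fourier (\<lambda>x. complex_of_real (gauss x)) y =
      (\<integral>x. (\<Prod>j\<in>UNIV. complex_of_real (std_normal_density (x $ j) * sqrt (2 * pi)) * cis (2 * pi * y $ j * (x $ j))) \<partial>lborel)"
    unfolding inverse_fourier_def gauss_def
    by (rule Bochner_Integration.integral_cong)
       (auto simp: prod.distrib cis_sum inner_vec_def sum_distrib_left mult_ac)
  also have "\<dots> = (\<Prod>j\<in>UNIV. (\<integral>s. complex_of_real (std_normal_density s * sqrt (2 * pi)) * cis (2 * pi * y $ j * s) \<partial>lborel))"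
    by (rule integral_lborel_prod_vec[OF int])
  also have "\<dots> = (\<Prod>j\<in>UNIV. of_real (sqrt (2 * pi)) * (\<integral>s. complex_of_real (std_normal_density s) * cis (2 * pi * y $ j * s) \<partial>lborel))"
    by (intro prod.cong refl, subst integral_mult_right_zero[symmetric], rule Bochner_Integration.integral_cong) simp_all
  also have "\<dots> = complex_of_real (gauss_hat y)"
    unfolding char gauss_hat_def by simp
  finally show ?thesis .
qed

lemma integrable_gauss_hat: "integrable lborel (gauss_hat :: real^'d \<Rightarrow> real)"
  and integral_gauss_hat: "integral\<^sup>L lborel (gauss_hat :: real^'d \<Rightarrow> real) = 1"
proof -
  \<comment> \<open>Each factor is the L^1-normalised dilate by \<open>2 * pi\<close> of the
    standard normal density, hence has integral 1.\<close>
  have eq: "sqrt (2 * pi) * exp (- (2 * pi * s)\<^sup>2 / 2) = 2 * pi * std_normal_density (0 + (2 * pi) *\<^sub>R s)" for s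
  proof -
    have "2 * pi / sqrt (2 * pi) = sqrt (2 * pi)" by (rule real_div_sqrt) simp
    then have "2 * pi * (1 / sqrt (2 * pi) * exp (- (2 * pi * s)\<^sup>2 / 2)) = sqrt (2 * pi) * exp (- (2 * pi * s)\<^sup>2 / 2)"
      by (metis mult.assoc mult_1_right times_divide_eq_right)
    then show ?thesis by (simp add: std_normal_density_def)
  qed
  have int: "integrable lborel (\<lambda>s. sqrt (2 * pi) * exp (- (2 * pi * s)\<^sup>2 / 2))"
    unfolding eq by (intro integrable_mult_right integrable_lborel_affine) auto
  have "(\<integral>s. sqrt (2 * pi) * exp (- (2 * pi * s)\<^sup>2 / 2) \<partial>lborel) = 1"
    unfolding eq by (simp only: integral_mult_right_zero, subst integral_lborel_affine) auto
  then show "integral\<^sup>L lborel (gauss_hat :: real^'d \<Rightarrow> real) = 1"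
    unfolding gauss_hat_def by (subst integral_lborel_prod_vec[OF int]) simp
  show "integrable lborel (gauss_hat :: real^'d \<Rightarrow> real)"
    unfolding gauss_hat_def by (rule integrable_lborel_prod_vec[OF int])
qed

text \<open>The Gaussian factor makes the double integral absolutely convergent, and turns the inner
  integral into an approximate identity.\<close>

lemma fourier_inverse_fourier:
  fixes f :: "real^'d \<Rightarrow> complex"
  assumes f: "integrable lborel f" and cont: "continuous_on UNIV f" and bound: "\<And>x. norm (f x) \<le> B"
    and int: "integrable lborel (inverse_fourier f)"
  shows "fourier (inverse_fourier f) w = f w"
proof (rule LIMSEQ_unique)
  have [measurable]: "f \<in> borel_measurable borel" "inverse_fourier f \<in> borel_measurable borel"
    "gauss \<in> borel_measurable borel" "gauss_hat \<in> borel_measurable borel"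
    using borel_measurable_integrable[OF f] borel_measurable_integrable[OF int]
      borel_measurable_integrable[OF integrable_gauss] borel_measurable_integrable[OF integrable_gauss_hat] by auto
  define e where "e n = 1 / real (Suc n)" for n
  have e0: "e n > 0" for n by (simp add: e_def)
  have e: "e \<longlonglongrightarrow> 0" unfolding e_def using LIMSEQ_inverse_real_of_nat by (simp add: inverse_eq_divide)
  have contf: "isCont f x" for x using cont by (simp add: continuous_on_eq_continuous_at)
  have contg: "isCont gauss x" for x :: "real^'d"
    by (rule continuous_on_interior[OF continuous_gauss]) simp
  \<comment> \<open>The Fourier integral damped by a wide Gaussian. It tends to the left-hand side
    as the damping disappears; rewritten by Fubini it is an average of \<open>f\<close> around
    \<open>w\<close> at scale \<open>e n\<close>, which tends to \<open>f w\<close>.\<close>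
  let ?L = "\<lambda>n. \<integral>x. inverse_fourier f x * cis (- 2 * pi * (w \<bullet> x)) * gauss (e n *\<^sub>R x) \<partial>lborel"
  show "?L \<longlonglongrightarrow> fourier (inverse_fourier f) w"
    unfolding fourier_def
  proof (rule integral_dominated_convergence[where w="\<lambda>x. norm (inverse_fourier f x)"])
    show "AE x in lborel. (\<lambda>n. inverse_fourier f x * cis (- 2 * pi * (w \<bullet> x)) * gauss (e n *\<^sub>R x))
        \<longlonglongrightarrow> inverse_fourier f x * cis (- 2 * pi * (w \<bullet> x))"
    proof (intro AE_I2)
      fix x :: "real^'d"
      have "(\<lambda>n. gauss (e n *\<^sub>R x)) \<longlonglongrightarrow> gauss (0 *\<^sub>R x)"
        by (intro isCont_tendsto_compose[OF contg] tendsto_intros e)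
      then have "(\<lambda>n. inverse_fourier f x * cis (- 2 * pi * (w \<bullet> x)) * gauss (e n *\<^sub>R x))
          \<longlonglongrightarrow> inverse_fourier f x * cis (- 2 * pi * (w \<bullet> x)) * of_real 1"
        by (intro tendsto_intros) (simp add: gauss_0)
      then show "(\<lambda>n. inverse_fourier f x * cis (- 2 * pi * (w \<bullet> x)) * gauss (e n *\<^sub>R x))
          \<longlonglongrightarrow> inverse_fourier f x * cis (- 2 * pi * (w \<bullet> x))" by simp
    qed
    show "AE x in lborel. norm (inverse_fourier f x * cis (- 2 * pi * (w \<bullet> x)) * gauss (e n *\<^sub>R x))
        \<le> norm (inverse_fourier f x)" for n
      by (simp add: norm_mult gauss_nonneg mult_left_le gauss_le_1)
  qed (use int in auto)
  have eq: "?L n = (\<integral>y. f (w + e n *\<^sub>R y) * gauss_hat y \<partial>lborel)" for n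
  proof -
    have ig: "integrable lborel (\<lambda>x::real^'d. gauss (e n *\<^sub>R x))"
      using e0[of n] by (intro integrable_lborel_scale integrable_gauss) auto
    have i2: "integrable (lborel \<Otimes>\<^sub>M lborel) (\<lambda>(x, v). f v * cis (2 * pi * (v \<bullet> x)) * cis (- 2 * pi * (w \<bullet> x)) * gauss (e n *\<^sub>R x))"
    proof (rule Bochner_Integration.integrable_bound)
      show "integrable (lborel \<Otimes>\<^sub>M lborel) (\<lambda>(x::real^'d, v). gauss (e n *\<^sub>R x) * norm (f v))"
        by (intro lborel_pair.integrable_product_swap lborel_pair.Fubini_integrable)
           (use f ig in \<open>auto simp: gauss_nonneg\<close>)
    qed (auto simp: norm_mult gauss_nonneg split: prod.split)
    have "?L n = (\<integral>x. (\<integral>v. f v * cis (2 * pi * (v \<bullet> x)) * cis (- 2 * pi * (w \<bullet> x)) * gauss (e n *\<^sub>R x) \<partial>lborel) \<partial>lborel)"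
      by (simp only: inverse_fourier_def integral_mult_left_zero)
    also have "\<dots> = (\<integral>v. (\<integral>x. f v * cis (2 * pi * (v \<bullet> x)) * cis (- 2 * pi * (w \<bullet> x)) * gauss (e n *\<^sub>R x) \<partial>lborel) \<partial>lborel)"
      by (rule lborel_pair.Fubini_integral[symmetric]) (use i2 in simp)
    also have "\<dots> = (\<integral>v. f v * (1 / e n ^ CARD('d) * gauss_hat ((v - w) /\<^sub>R e n)) \<partial>lborel)"
    proof (rule Bochner_Integration.integral_cong[OF refl])
      fix v :: "real^'d"
      \<comment> \<open>With this point the phase (v - w) . x equals (e n x) . ?y, so the inner
        integral is a rescaled Gaussian transform.\<close>
      let ?y = "(v - w) /\<^sub>R e n"
      have "(\<integral>x. f v * cis (2 * pi * (v \<bullet> x)) * cis (- 2 * pi * (w \<bullet> x)) * gauss (e n *\<^sub>R x) \<partial>lborel)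
          = (\<integral>x. f v * (complex_of_real (gauss (e n *\<^sub>R x)) * cis (2 * pi * ((e n *\<^sub>R x) \<bullet> ?y))) \<partial>lborel)"
      proof (intro Bochner_Integration.integral_cong refl)
        fix x :: "real^'d"
        have "(e n *\<^sub>R x) \<bullet> ?y = v \<bullet> x - w \<bullet> x"
          using e0[of n] by (simp add: inner_diff_right inner_commute)
        then have "cis (2 * pi * ((e n *\<^sub>R x) \<bullet> ?y)) = cis (2 * pi * (v \<bullet> x)) * cis (- 2 * pi * (w \<bullet> x))"
          by (simp add: cis_mult right_diff_distrib)
        then show "f v * cis (2 * pi * (v \<bullet> x)) * cis (- 2 * pi * (w \<bullet> x)) * gauss (e n *\<^sub>R x)
            = f v * (complex_of_real (gauss (e n *\<^sub>R x)) * cis (2 * pi * ((e n *\<^sub>R x) \<bullet> ?y)))"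
          by (simp only: mult_ac)
      qed
      also have "\<dots> = f v * ((1 / e n ^ CARD('d)) *\<^sub>R inverse_fourier (\<lambda>x. complex_of_real (gauss x)) ?y)"
      proof -
        have "integrable lborel (\<lambda>x. complex_of_real (gauss x) * cis (2 * pi * (x \<bullet> ?y)))"
          by (intro integrable_mult_cis integrable_of_real integrable_gauss)
        from integral_lborel_scale[OF this, of "e n"] show ?thesis
          using e0[of n] unfolding inverse_fourier_def integral_mult_right_zero by simp
      qed
      finally show "(\<integral>x. f v * cis (2 * pi * (v \<bullet> x)) * cis (- 2 * pi * (w \<bullet> x)) * gauss (e n *\<^sub>R x) \<partial>lborel)
          = f v * (1 / e n ^ CARD('d) * gauss_hat ?y)"
        unfolding inverse_fourier_gauss by (simp add: scaleR_conv_of_real)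
    qed
    also have "\<dots> = (\<integral>y. f (w + e n *\<^sub>R y) * gauss_hat y \<partial>lborel)"
    proof -
      have gh: "integrable lborel (\<lambda>v. gauss_hat ((- w /\<^sub>R e n) + (1 / e n) *\<^sub>R v))"
        using e0[of n] by (intro integrable_lborel_affine integrable_gauss_hat) auto
      have "integrable lborel (\<lambda>v. f v * (1 / e n ^ CARD('d) * gauss_hat ((v - w) /\<^sub>R e n)))"
      proof (rule Bochner_Integration.integrable_bound)
        show "integrable lborel (\<lambda>v. B * (1 / e n ^ CARD('d) * gauss_hat ((- w /\<^sub>R e n) + (1 / e n) *\<^sub>R v)))"
          by (intro integrable_mult_right gh)
        show "AE v in lborel. norm (f v * (1 / e n ^ CARD('d) * gauss_hat ((v - w) /\<^sub>R e n)))
          \<le> norm (B * (1 / e n ^ CARD('d) * gauss_hat ((- w /\<^sub>R e n) + (1 / e n) *\<^sub>R v)))"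
        proof (intro AE_I2)
          fix v :: "real^'d"
          have "norm (f v) \<le> \<bar>B\<bar>" using bound[of v] by linarith
          moreover have "- w /\<^sub>R e n + (1 / e n) *\<^sub>R v = (v - w) /\<^sub>R e n"
            by (simp add: scaleR_diff_right inverse_eq_divide)
          ultimately show "norm (f v * (1 / e n ^ CARD('d) * gauss_hat ((v - w) /\<^sub>R e n)))
             \<le> norm (B * (1 / e n ^ CARD('d) * gauss_hat ((- w /\<^sub>R e n) + (1 / e n) *\<^sub>R v)))"
            by (auto simp: norm_mult norm_divide norm_power abs_mult power_abs intro!: divide_right_mono mult_right_mono)
        qed
      qed measurable
      note integral_lborel_affine[OF _ this, of "e n" w]
      then have "(\<integral>v. f v * (1 / e n ^ CARD('d) * gauss_hat ((v - w) /\<^sub>R e n)) \<partial>lborel)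
         = (e n ^ CARD('d)) *\<^sub>R (\<integral>x. f (w + e n *\<^sub>R x) * (1 / e n ^ CARD('d) * gauss_hat x) \<partial>lborel)"
        using e0[of n] by simp
      also have "\<dots> = (\<integral>x. f (w + e n *\<^sub>R x) * gauss_hat x \<partial>lborel)"
        using e0[of n]
        by (subst integral_scaleR_right[symmetric], intro Bochner_Integration.integral_cong refl)
           (simp add: scaleR_conv_of_real)
      finally show ?thesis .
    qed
    finally show ?thesis .
  qed
  have "(\<lambda>n. \<integral>y. f (w + e n *\<^sub>R y) * gauss_hat y \<partial>lborel) \<longlonglongrightarrow> (\<integral>y. f w * gauss_hat (y::real^'d) \<partial>lborel)"
  proof (rule integral_dominated_convergence[where w="\<lambda>y::real^'d. \<bar>B * gauss_hat y\<bar>"])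
    show "AE y in lborel. (\<lambda>n. f (w + e n *\<^sub>R y) * gauss_hat y) \<longlonglongrightarrow> f w * gauss_hat y"
    proof (intro AE_I2 tendsto_intros)
      fix y :: "real^'d"
      have "(\<lambda>n. f (w + e n *\<^sub>R y)) \<longlonglongrightarrow> f (w + 0 *\<^sub>R y)"
        by (intro isCont_tendsto_compose[OF contf] tendsto_intros e)
      then show "(\<lambda>n. f (w + e n *\<^sub>R y)) \<longlonglongrightarrow> f w" by simp
    qed
    show "AE y in lborel. norm (f (w + e n *\<^sub>R y) * gauss_hat y) \<le> \<bar>B * gauss_hat y\<bar>" for n
    proof (intro AE_I2)
      fix y :: "real^'d"
      have "norm (f (w + e n *\<^sub>R y)) \<le> \<bar>B\<bar>" using bound[of "w + e n *\<^sub>R y"] by linarith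
      then show "norm (f (w + e n *\<^sub>R y) * gauss_hat y) \<le> \<bar>B * gauss_hat y\<bar>"
        by (auto simp: norm_mult abs_mult intro!: mult_right_mono)
    qed
  qed (use integrable_gauss_hat in auto)
  then show "?L \<longlonglongrightarrow> f w"
    unfolding eq by (simp add: integral_mult_right_zero integral_gauss_hat)
qed

section \<open>Finite differences and rapid decay\<close>

text \<open>Plays the part of a directional derivative: under the Fourier transform it becomes
  multiplication by \<open>cis (...) - 1\<close>, and it applies to symbols whose smoothness has not
  been established.\<close>

definition fdiff :: "real^'d \<Rightarrow> (real^'d \<Rightarrow> complex) \<Rightarrow> real^'d \<Rightarrow> complex" where
  "fdiff v f w = f (w + v) - f w"

lemma funpow_fdiff_Suc: "(fdiff v ^^ Suc N) f w = (fdiff v ^^ N) f (w + v) - (fdiff v ^^ N) f w"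
  by (simp add: fdiff_def)

text \<open>An iterated difference sees only the points of its stencil. This allows the low-pass
  symbol to be replaced locally by a finite sum or by 0.\<close>

lemma funpow_fdiff_cong:
  assumes "\<And>i. i \<le> N \<Longrightarrow> f (w + real i *\<^sub>R v) = g (w + real i *\<^sub>R v)"
  shows "(fdiff v ^^ N) f w = (fdiff v ^^ N) g w"
  using assms
proof (induction N arbitrary: w)
  case 0
  from 0[of 0] show ?case by simp
next
  case (Suc N)
  have "(fdiff v ^^ N) f (w + v) = (fdiff v ^^ N) g (w + v)"
  proof (rule Suc.IH)
    fix i assume "i \<le> N"
    with Suc.prems[of "Suc i"] show "f (w + v + real i *\<^sub>R v) = g (w + v + real i *\<^sub>R v)"
      by (simp add: algebra_simps)
  qed
  moreover have "(fdiff v ^^ N) f w = (fdiff v ^^ N) g w"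
    by (rule Suc.IH) (use Suc.prems in auto)
  ultimately show ?case by (simp only: funpow_fdiff_Suc)
qed

lemma funpow_fdiff_zero [simp]: "(fdiff v ^^ N) (\<lambda>_. 0) w = 0"
  by (induction N arbitrary: w) (simp_all add: fdiff_def)

text \<open>The order is a successor because the constant disappears only once a difference has been
  taken.\<close>

lemma funpow_fdiff_const_minus_sum:
  "(fdiff v ^^ Suc N) (\<lambda>w. c - (\<Sum>n\<in>A. f n w)) w = - (\<Sum>n\<in>A. (fdiff v ^^ Suc N) (f n) w)"
proof (induction N arbitrary: w)
  case 0
  show ?case by (simp add: fdiff_def sum_subtractf)
next
  case (Suc N)
  show ?case
    by (simp only: funpow_fdiff_Suc[where N="Suc N"] Suc.IH) (simp add: sum_subtractf del: funpow.simps)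
qed

lemma funpow_fdiff_scale:
  "(fdiff v ^^ N) (\<lambda>w. f (c *\<^sub>R w)) w = (fdiff (c *\<^sub>R v) ^^ N) f (c *\<^sub>R w)"
  by (induction N arbitrary: w) (simp_all add: fdiff_def scaleR_add_right)

lemma integrable_funpow_fdiff:
  "integrable lborel f \<Longrightarrow> integrable lborel ((fdiff v ^^ N) f)"
  by (induction N) (simp_all add: fdiff_def[abs_def] integrable_lborel_translate)

text \<open>Translating the frequency variable by v modulates the inverse transform by
  \<open>cis (- 2 * pi * (v \<bullet> x))\<close>.\<close>

lemma inverse_fourier_funpow_fdiff:
  assumes f: "integrable lborel f"
  shows "inverse_fourier ((fdiff v ^^ N) f) x = (cis (- 2 * pi * (v \<bullet> x)) - 1) ^ N * inverse_fourier f x"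
proof (induction N)
  case (Suc N)
  let ?g = "(fdiff v ^^ N) f"
  have g: "integrable lborel ?g" by (rule integrable_funpow_fdiff[OF f])
  have fd: "fdiff v ?g = (\<lambda>w. ?g (w + v) - ?g w)" by (simp add: fun_eq_iff fdiff_def)
  have g': "integrable lborel (\<lambda>w. ?g w * cis (2 * pi * (w \<bullet> x)))" by (rule integrable_mult_cis(2)[OF g])
  have eq: "?g (w + v) * cis (2 * pi * (w \<bullet> x)) =
      cis (- 2 * pi * (v \<bullet> x)) * (?g (w + v) * cis (2 * pi * ((w + v) \<bullet> x)))" for w
  proof -
    have "cis (2 * pi * (w \<bullet> x)) = cis (- 2 * pi * (v \<bullet> x)) * cis (2 * pi * ((w + v) \<bullet> x))"
      by (simp add: cis_mult inner_add_left algebra_simps)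
    then show ?thesis by (simp only: mult_ac)
  qed
  have "(\<integral>w. ?g (w + v) * cis (2 * pi * (w \<bullet> x)) \<partial>lborel) = cis (- 2 * pi * (v \<bullet> x)) * inverse_fourier ?g x"
    unfolding eq inverse_fourier_def integral_mult_right_zero
    by (subst integral_lborel_translate[OF g']) simp
  moreover have "integrable lborel (\<lambda>w. ?g (w + v) * cis (2 * pi * (w \<bullet> x)))"
    by (intro integrable_mult_cis(2) integrable_lborel_translate g)
  ultimately have "inverse_fourier (fdiff v ?g) x = cis (- 2 * pi * (v \<bullet> x)) * inverse_fourier ?g x - inverse_fourier ?g x"
    unfolding fd inverse_fourier_def using g' by (simp add: left_diff_distrib)
  then show ?case using Suc.IH by (simp add: algebra_simps)
qed simp

text \<open>The multiplier is at most (2 pi |v| |x|)^N, so the N-th difference of a transform is of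
  order |v|^N as soon as \<open>g\<close> has an N-th moment. Integrability is carried along because
  the induction step merges two integrals.\<close>

lemma funpow_fdiff_fourier:
  assumes g: "integrable lborel g"
  shows "(fdiff v ^^ N) (fourier g) w = fourier (\<lambda>x. (cis (- 2 * pi * (v \<bullet> x)) - 1) ^ N * g x) w
    \<and> integrable lborel (\<lambda>x. (cis (- 2 * pi * (v \<bullet> x)) - 1) ^ N * g x)"
proof (induction N arbitrary: w)
  case (Suc N)
  let ?g = "\<lambda>x. (cis (- 2 * pi * (v \<bullet> x)) - 1) ^ N * g x"
  have g: "integrable lborel ?g" using Suc.IH by blast
  have "integrable lborel (\<lambda>x. ?g x * cis (- 2 * pi * (v \<bullet> x)) - ?g x)"
    by (intro Bochner_Integration.integrable_diff integrable_mult_cis(1) g)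
  moreover have "fourier ?g (w + v) - fourier ?g w
      = (\<integral>x. ?g x * cis (- 2 * pi * ((w + v) \<bullet> x)) - ?g x * cis (- 2 * pi * (w \<bullet> x)) \<partial>lborel)"
    unfolding fourier_def
    by (rule Bochner_Integration.integral_diff[symmetric]) (rule integrable_mult_cis(1)[OF g])+
  moreover have "?g x * cis (- 2 * pi * ((w + v) \<bullet> x)) - ?g x * cis (- 2 * pi * (w \<bullet> x))
      = (cis (- 2 * pi * (v \<bullet> x)) - 1) ^ Suc N * g x * cis (- 2 * pi * (w \<bullet> x))" for x
  proof -
    have "cis (- 2 * pi * ((w + v) \<bullet> x)) = cis (- 2 * pi * (v \<bullet> x)) * cis (- 2 * pi * (w \<bullet> x))"
      by (simp add: cis_mult inner_add_left algebra_simps)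
    then show ?thesis by (simp add: algebra_simps)
  qed
  ultimately show ?case
    using Suc.IH by (simp only: funpow_fdiff_Suc) (simp add: fourier_def algebra_simps)
qed (use g in simp)

text \<open>With m the largest absolute coordinate, 1 + norm x is at most (1 + d) * max 1 m in
  dimension d.\<close>

lemma power_one_plus_norm_le:
  fixes x :: "real^'d"
  shows "(1 + norm x) ^ N \<le> (1 + real CARD('d)) ^ N * (1 + (\<Sum>j\<in>UNIV. \<bar>x $ j\<bar> ^ N))"
proof -
  define m where "m = Max (range (\<lambda>j. \<bar>x $ j\<bar>))"
  have le: "\<bar>x $ j\<bar> \<le> m" for j unfolding m_def by (rule Max_ge) auto
  have "m \<in> range (\<lambda>j. \<bar>x $ j\<bar>)" unfolding m_def by (rule Max_in) auto
  then obtain i where i: "m = \<bar>x $ i\<bar>" by auto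
  have m0: "0 \<le> m" by (simp add: i)
  have "norm x \<le> (\<Sum>j\<in>UNIV. \<bar>x $ j\<bar>)" by (rule norm_le_l1_cart)
  also have "\<dots> \<le> (\<Sum>j\<in>(UNIV::'d set). m)" by (intro sum_mono le)
  finally have "norm x \<le> real CARD('d) * m" by simp
  also have "\<dots> \<le> real CARD('d) * max 1 m" by (intro mult_left_mono) auto
  finally have "1 + norm x \<le> (1 + real CARD('d)) * max 1 m" by (simp add: algebra_simps)
  then have "(1 + norm x) ^ N \<le> ((1 + real CARD('d)) * max 1 m) ^ N" by (intro power_mono) auto
  moreover have "max 1 m ^ N \<le> 1 + (\<Sum>j\<in>UNIV. \<bar>x $ j\<bar> ^ N)"
  proof (cases "m \<le> 1")
    case True
    then show ?thesis by (simp add: max_def sum_nonneg)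
  next
    case False
    have "m ^ N \<le> (\<Sum>j\<in>UNIV. \<bar>x $ j\<bar> ^ N)"
      unfolding i by (rule member_le_sum) auto
    then show ?thesis using False by (simp add: max_def)
  qed
  ultimately show ?thesis
    by (smt (verit) mult_left_mono power_mult_distrib zero_le_power of_nat_0_le_iff)
qed

text \<open>Decay is tested one coordinate at a time, because both the monomials in
  \<open>schwartz\<close> and the differences along coordinate axes give bounds of that
  kind.\<close>

lemma decay_from_coordinates:
  fixes x :: "real^'d" and a B :: real
  assumes a: "0 \<le> a" and "a \<le> B" and "\<And>j. \<bar>x $ j\<bar> ^ N * a \<le> B"
  shows "a * (1 + norm x) ^ N \<le> (1 + real CARD('d)) ^ Suc N * B"
proof -
  have "a * (1 + norm x) ^ N \<le> a * ((1 + real CARD('d)) ^ N * (1 + (\<Sum>j\<in>UNIV. \<bar>x $ j\<bar> ^ N)))"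
    by (intro mult_left_mono power_one_plus_norm_le a)
  also have "\<dots> = (1 + real CARD('d)) ^ N * (a + (\<Sum>j\<in>UNIV. \<bar>x $ j\<bar> ^ N * a))"
    by (simp add: algebra_simps sum_distrib_left)
  also have "\<dots> \<le> (1 + real CARD('d)) ^ N * (B + (\<Sum>j\<in>(UNIV::'d set). B))"
    by (intro mult_left_mono add_mono sum_mono assms) auto
  also have "\<dots> = (1 + real CARD('d)) ^ Suc N * B" by (simp add: algebra_simps)
  finally show ?thesis .
qed

section \<open>Rapid decay and Schwartz functions\<close>

definition rapid_decay :: "(real^'d \<Rightarrow> complex) \<Rightarrow> bool" where
  "rapid_decay f \<longleftrightarrow> (\<forall>N. \<exists>C. \<forall>x. norm (f x) * (1 + norm x) ^ N \<le> C)"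

lemma rapid_decayE:
  assumes "rapid_decay f"
  obtains C where "C > 0" "\<And>x. norm (f x) \<le> C / (1 + norm x) ^ N"
proof -
  from assms obtain C where C: "\<And>x. norm (f x) * (1 + norm x) ^ N \<le> C"
    unfolding rapid_decay_def by blast
  have "norm (f x) \<le> (\<bar>C\<bar> + 1) / (1 + norm x) ^ N" for x
  proof -
    have "0 < (1 + norm x) ^ N" by (intro zero_less_power) (simp add: add_pos_nonneg)
    then show ?thesis using C[of x] by (simp add: field_simps)
  qed
  with that[of "\<bar>C\<bar> + 1"] show ?thesis by simp
qed

lemma integrable_rapid_decay:
  fixes f :: "real^'d \<Rightarrow> complex"
  assumes [measurable]: "f \<in> borel_measurable borel" and f: "rapid_decay f"
  shows "integrable lborel (\<lambda>x. (1 + norm x) ^ m * norm (f x))"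
proof -
  \<comment> \<open>Of this exponent, m absorbs the polynomial factor and the remaining part makes
    the majorant integrable.\<close>
  obtain C where C: "\<And>x. norm (f x) \<le> C / (1 + norm x) ^ (m + 2 * CARD('d))" by (rule rapid_decayE[OF f]) blast
  show ?thesis
  proof (rule Bochner_Integration.integrable_bound)
    show "integrable lborel (\<lambda>x::real^'d. C * (1 / (1 + norm x) ^ (2 * CARD('d))))"
      by (intro integrable_mult_right integrable_inverse_norm_power) simp
    show "AE x in lborel. norm ((1 + norm x) ^ m * norm (f x)) \<le> norm (C * (1 / (1 + norm x) ^ (2 * CARD('d))))"
    proof (intro AE_I2)
      fix x :: "real^'d"
      have pos: "0 < (1 + norm x) ^ k" for k by (intro zero_less_power) (simp add: add_pos_nonneg)
      have "(1 + norm x) ^ m * norm (f x) \<le> (1 + norm x) ^ m * (C / (1 + norm x) ^ (m + 2 * CARD('d)))"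
        by (intro mult_left_mono C) simp
      also have "\<dots> = C * (1 / (1 + norm x) ^ (2 * CARD('d)))"
        using pos[of m] by (simp add: power_add)
      finally have "(1 + norm x) ^ m * norm (f x) \<le> norm (C * (1 / (1 + norm x) ^ (2 * CARD('d))))"
        using abs_ge_self order_trans unfolding real_norm_def by blast
      then show "norm ((1 + norm x) ^ m * norm (f x)) \<le> norm (C * (1 / (1 + norm x) ^ (2 * CARD('d))))"
        by simp
    qed
  qed measurable
qed

lemma schwartz_rapid_decay:
  fixes f :: "real^'d \<Rightarrow> complex"
  assumes "schwartz f"
  shows "rapid_decay (foldr partial_deriv js f)"
  unfolding rapid_decay_def
proof
  fix N
  let ?g = "foldr partial_deriv js f"
  have b: "bounded (range (\<lambda>x. complex_of_real (\<Prod>j\<in>UNIV. x $ j ^ \<alpha> j) * ?g x))" for \<alpha> :: "'d \<Rightarrow> nat"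
    using assms unfolding schwartz_def by blast
  have "\<exists>B. \<forall>x. \<bar>x $ j\<bar> ^ N * norm (?g x) \<le> B" for j :: 'd
  proof -
    obtain B where B: "\<And>x. norm (complex_of_real (\<Prod>i\<in>UNIV. x $ i ^ (if i = j then N else 0)) * ?g x) \<le> B"
      using b[of "\<lambda>i. if i = j then N else 0"] unfolding bounded_iff by auto
    have "(\<Prod>i\<in>UNIV. x $ i ^ (if i = j then N else 0)) = x $ j ^ N" for x :: "real^'d"
      by (subst prod.remove[of _ j]) auto
    with B show ?thesis by (auto simp: norm_mult norm_power power_abs)
  qed
  then obtain B where B: "\<And>j x. \<bar>x $ j\<bar> ^ N * norm (?g x) \<le> B j" by metis
  obtain B0 where B0: "\<And>x. norm (?g x) \<le> B0"
    using b[of "\<lambda>i. 0"] unfolding bounded_iff by auto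
  have B0': "0 \<le> B0" using B0[of 0] norm_ge_zero order_trans by blast
  have Bj: "0 \<le> B j" for j using B[of 0 j] by (meson abs_ge_zero mult_nonneg_nonneg norm_ge_zero order_trans zero_le_power)
  show "\<exists>C. \<forall>x. norm (?g x) * (1 + norm x) ^ N \<le> C"
  proof (intro exI allI, rule decay_from_coordinates)
    fix x :: "real^'d" and j :: 'd
    show "norm (?g x) \<le> B0 + (\<Sum>j\<in>UNIV. B j)"
      using B0[of x] sum_nonneg[of UNIV B] Bj by force
    have "B j \<le> (\<Sum>j\<in>UNIV. B j)" by (rule member_le_sum) (use Bj in auto)
    then show "\<bar>x $ j\<bar> ^ N * norm (?g x) \<le> B0 + (\<Sum>j\<in>UNIV. B j)" using B[of x j] B0' by linarith
  qed simp
qed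

lemma schwartz_differentiable: "schwartz f \<Longrightarrow> f differentiable (at x)"
  unfolding schwartz_def by (metis foldr_Nil id_apply)

lemma schwartz_continuous:
  assumes "schwartz f"
  shows "continuous_on UNIV f"
proof (rule continuous_at_imp_continuous_on, rule ballI)
  show "isCont f x" for x
    by (rule differentiable_imp_continuous_within[OF schwartz_differentiable[OF assms]])
qed

lemma schwartz_integrable:
  assumes "schwartz f"
  shows "integrable lborel f"
proof -
  have [measurable]: "f \<in> borel_measurable borel"
    by (rule borel_measurable_continuous_onI[OF schwartz_continuous[OF assms]])
  show ?thesis
    using integrable_rapid_decay[OF _ schwartz_rapid_decay[OF assms, of "[]"], of 0]
    by (simp add: integrable_norm_iff)
qed

section \<open>The low-pass kernel of a dyadic partition\<close>

lemma infnorm_axis: "infnorm (t *\<^sub>R axis j (1::real) :: real^'d) \<le> \<bar>t\<bar>"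
  using infnorm_le_norm[of "t *\<^sub>R axis j (1::real) :: real^'d"] by simp

text \<open>The square root of the dimension appears because the cube of half-side R lies in the
  Euclidean ball of that radius. The L^1 bound depends on B and R alone, so it is uniform over
  families of differences with a common support.\<close>

lemma integrable_bounded_support:
  fixes f :: "real^'d \<Rightarrow> complex"
  assumes [measurable]: "f \<in> borel_measurable borel" and B: "\<And>w. norm (f w) \<le> B"
    and supp: "\<And>w. R < infnorm w \<Longrightarrow> f w = 0"
  shows "integrable lborel f"
    and "(\<integral>w. norm (f w) \<partial>lborel) \<le> B * measure lborel (cball (0::real^'d) (sqrt (real CARD('d)) * R))"
proof -
  let ?S = "cball (0::real^'d) (sqrt (real CARD('d)) * R)"
  have le: "norm (f w) \<le> B * indicator ?S w" for w
  proof (cases "f w = 0")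
    case True
    then show ?thesis using B[of w] by (auto simp: indicator_def)
  next
    case False
    with supp[of w] have "infnorm w \<le> R" by force
    have "norm w \<le> sqrt (real CARD('d)) * infnorm w" using norm_le_infnorm[of w] by simp
    also have "\<dots> \<le> sqrt (real CARD('d)) * R" using \<open>infnorm w \<le> R\<close> by (intro mult_left_mono) auto
    finally have "w \<in> ?S" by simp
    with B[of w] show ?thesis by simp
  qed
  have int: "integrable lborel (\<lambda>w. B * indicator ?S w :: real)"
    using emeasure_lborel_cball_finite[of "0::real^'d" "sqrt (real CARD('d)) * R"]
    by (intro integrable_mult_right integrable_real_indicator) simp_all
  show *: "integrable lborel f"
    by (rule Bochner_Integration.integrable_bound[OF int]) (use le in \<open>auto intro: order_trans[OF le abs_ge_self]\<close>)
  have "(\<integral>w. norm (f w) \<partial>lborel) \<le> (\<integral>w. B * indicator ?S w \<partial>lborel)"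
    by (rule integral_mono) (use * int le in auto)
  then show "(\<integral>w. norm (f w) \<partial>lborel) \<le> B * measure lborel ?S" by simp
qed

text \<open>L^1-normalised dilation: it preserves the integral and turns a symbol at w into the
  symbol at w / s, so a larger s admits higher frequencies.\<close>

definition dilate :: "real \<Rightarrow> (real^'d \<Rightarrow> complex) \<Rightarrow> real^'d \<Rightarrow> complex" where
  "dilate s f x = of_real (s ^ CARD('d)) * f (s *\<^sub>R x)"

lemma inverse_fourier_scale:
  fixes f :: "real^'d \<Rightarrow> complex"
  assumes s: "0 < s" and f: "integrable lborel f"
  shows "inverse_fourier (\<lambda>w. f ((1 / s) *\<^sub>R w)) = dilate s (inverse_fourier f)"
proof
  fix x :: "real^'d"
  let ?g = "\<lambda>w. f w * cis (2 * pi * (w \<bullet> (s *\<^sub>R x)))"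
  have "inverse_fourier (\<lambda>w. f ((1 / s) *\<^sub>R w)) x = (\<integral>w. ?g ((1 / s) *\<^sub>R w) \<partial>lborel)"
    unfolding inverse_fourier_def using s by simp
  also have "\<dots> = (1 / \<bar>1 / s\<bar> ^ DIM(real^'d)) *\<^sub>R integral\<^sup>L lborel ?g"
    using s by (intro integral_lborel_scale integrable_mult_cis(2) f) auto
  also have "\<dots> = dilate s (inverse_fourier f) x"
    using s by (simp add: dilate_def inverse_fourier_def scaleR_conv_of_real power_one_over)
  finally show "inverse_fourier (\<lambda>w. f ((1 / s) *\<^sub>R w)) x = dilate s (inverse_fourier f) x" .
qed

lemma
  assumes s: "0 < s" and f: "integrable lborel f"
  shows integrable_dilate: "integrable lborel (dilate s f)"
    and integral_dilate: "integral\<^sup>L lborel (dilate s f) = integral\<^sup>L lborel f"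
  unfolding dilate_def
  using s integrable_lborel_scale[OF f, of s] integral_lborel_scale[OF f, of s]
  by (auto simp: scaleR_conv_of_real)

lemma integral_norm_dilate:
  assumes s: "0 < s" and f: "integrable lborel f"
  shows "(\<integral>x. norm (dilate s f x) \<partial>lborel) = (\<integral>x. norm (f x) \<partial>lborel)"
  unfolding dilate_def norm_mult
  using s integral_lborel_scale[of "\<lambda>x. norm (f x)" s] f
  by (simp add: norm_power)

text \<open>After Fubini the inner integral is the Fourier transform of
  \<open>inverse_fourier g\<close>, which inversion returns to \<open>g\<close>. Hence the stronger
  hypotheses fall on \<open>g\<close>, while \<open>f\<close> need only be integrable.\<close>

lemma convolution_inverse_fourier:
  fixes f g :: "real^'d \<Rightarrow> complex"
  assumes f: "integrable lborel f" and g: "integrable lborel g" "continuous_on UNIV g" "\<And>w. norm (g w) \<le> B"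
    and ig: "integrable lborel (inverse_fourier g)"
  shows "(\<integral>y. inverse_fourier f (x - y) * inverse_fourier g y \<partial>lborel) = inverse_fourier (\<lambda>w. f w * g w) x"
proof -
  have [measurable]: "f \<in> borel_measurable borel" "inverse_fourier g \<in> borel_measurable borel"
    using borel_measurable_integrable[OF f] borel_measurable_integrable[OF ig] by auto
  have i2: "integrable (lborel \<Otimes>\<^sub>M lborel) (\<lambda>(y, w). f w * cis (2 * pi * (w \<bullet> (x - y))) * inverse_fourier g y)"
  proof (rule Bochner_Integration.integrable_bound)
    show "integrable (lborel \<Otimes>\<^sub>M lborel) (\<lambda>(y, w). norm (inverse_fourier g y) * norm (f w))"
      by (intro lborel_pair.integrable_product_swap lborel_pair.Fubini_integrable)
         (use f ig in \<open>auto\<close>)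
  qed (auto simp: norm_mult split: prod.split)
  have "(\<integral>y. inverse_fourier f (x - y) * inverse_fourier g y \<partial>lborel) =
      (\<integral>y. (\<integral>w. f w * cis (2 * pi * (w \<bullet> (x - y))) * inverse_fourier g y \<partial>lborel) \<partial>lborel)"
    by (simp only: inverse_fourier_def[of f] integral_mult_left_zero)
  also have "\<dots> = (\<integral>w. (\<integral>y. f w * cis (2 * pi * (w \<bullet> (x - y))) * inverse_fourier g y \<partial>lborel) \<partial>lborel)"
    by (rule lborel_pair.Fubini_integral[symmetric]) (use i2 in simp)
  also have "\<dots> = (\<integral>w. f w * g w * cis (2 * pi * (w \<bullet> x)) \<partial>lborel)"
  proof (rule Bochner_Integration.integral_cong[OF refl])
    fix w :: "real^'d"
    have eq: "f w * cis (2 * pi * (w \<bullet> (x - y))) * inverse_fourier g y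
        = f w * cis (2 * pi * (w \<bullet> x)) * (inverse_fourier g y * cis (- 2 * pi * (w \<bullet> y)))" for y
    proof -
      have "cis (2 * pi * (w \<bullet> (x - y))) = cis (2 * pi * (w \<bullet> x)) * cis (- 2 * pi * (w \<bullet> y))"
        by (simp add: cis_mult inner_diff_right right_diff_distrib)
      then show ?thesis by (simp only: mult_ac)
    qed
    show "(\<integral>y. f w * cis (2 * pi * (w \<bullet> (x - y))) * inverse_fourier g y \<partial>lborel) = f w * g w * cis (2 * pi * (w \<bullet> x))"
      unfolding eq integral_mult_right_zero fourier_def[symmetric]
      by (subst fourier_inverse_fourier[OF g ig]) simp
  qed
  also have "\<dots> = inverse_fourier (\<lambda>w. f w * g w) x" by (simp add: inverse_fourier_def)
  finally show ?thesis .
qed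

locale dyadic_partition =
  fixes \<phi> :: "real^'d \<Rightarrow> complex"
  assumes generator: "dyadic_generator \<phi>"
begin

text \<open>A plateau: 1 for infnorm below 1/2 and 0 for infnorm above 1. Every dyadic symbol of
  index at least 0 is a difference of two of its dilates.\<close>

definition low_symbol :: "real^'d \<Rightarrow> complex" where
  "low_symbol = dyadic_symbol \<phi> (-1)"

definition low_pass :: "real^'d \<Rightarrow> complex" where
  "low_pass = inverse_fourier low_symbol"

lemma schwartz: "schwartz \<phi>"
  using generator by (simp add: dyadic_generator_def)

lemmas continuous_generator = schwartz_continuous[OF schwartz]
  and integrable_generator = schwartz_integrable[OF schwartz]

lemma measurable_generator [measurable]: "\<phi> \<in> borel_measurable borel"
  by (rule borel_measurable_continuous_onI[OF continuous_generator])

lemma generator_rapid_decay: "rapid_decay \<phi>"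
  using schwartz_rapid_decay[OF schwartz, of "[]"] by simp

lemma fourier_generator_eq_0:
  assumes "infnorm w < 1/2 \<or> 2 < infnorm w"
  shows "fourier \<phi> w = 0"
proof (rule ccontr)
  assume "fourier \<phi> w \<noteq> 0"
  then have "w \<in> closure {\<omega>. fourier \<phi> \<omega> \<noteq> 0}" using closure_subset by fastforce
  with generator assms show False by (auto simp: dyadic_generator_def)
qed

lemma powi_minus_int: "(2::real) powi (- int n) = (1/2) ^ n"
  by (simp add: power_int_minus power_one_over inverse_eq_divide)

lemma low_symbol_altdef: "low_symbol w = 1 - (\<Sum>n. fourier \<phi> ((1/2) ^ n *\<^sub>R w))"
  by (simp add: low_symbol_def dyadic_symbol_def powi_minus_int)

lemma fourier_generator_small:
  assumes "infnorm w < 2 ^ K / 2" "K \<le> n"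
  shows "fourier \<phi> ((1/2) ^ n *\<^sub>R w) = 0"
proof -
  have "infnorm ((1/2) ^ n *\<^sub>R w) = (1/2) ^ n * infnorm w" by (simp add: infnorm_mul)
  also have "\<dots> < (1/2) ^ n * (2 ^ K / 2)" using assms(1) by (intro mult_strict_left_mono) auto
  also have "\<dots> \<le> (1/2) ^ n * (2 ^ n / 2)" using assms(2) by (intro mult_left_mono divide_right_mono power_increasing) auto
  also have "\<dots> = 1 / 2" by (simp add: power_one_over)
  finally show ?thesis by (intro fourier_generator_eq_0) simp
qed

text \<open>The dyadic sum is locally finite; continuity, boundedness and the difference estimates
  of the symbol are read off from such finite sums.\<close>

lemma low_symbol_finite_sum:
  assumes "infnorm w < 2 ^ K / 2"
  shows "low_symbol w = 1 - (\<Sum>n<K. fourier \<phi> ((1/2) ^ n *\<^sub>R w))"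
  unfolding low_symbol_altdef
  by (subst suminf_finite[of "{..<K}"]) (auto intro: fourier_generator_small[OF assms])

lemma low_symbol_eq_1: "infnorm w < 1/2 \<Longrightarrow> low_symbol w = 1"
  using low_symbol_finite_sum[of w 0] by simp

text \<open>When infnorm w exceeds 1, the terms of negative index have arguments of infnorm above 2
  and vanish, so the terms with k \<ge> 0 already sum to 1.\<close>

lemma low_symbol_eq_0:
  assumes "1 < infnorm w"
  shows "low_symbol w = 0"
proof -
  have "w \<noteq> 0" using assms by (auto simp: infnorm_0)
  then have "((\<lambda>k::int. fourier \<phi> (2 powi (- k) *\<^sub>R w)) has_sum 1) UNIV"
    using generator by (simp add: dyadic_generator_def)
  also have "?this \<longleftrightarrow> ((\<lambda>k::int. fourier \<phi> (2 powi (- k) *\<^sub>R w)) has_sum 1) (range int)"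
  proof (rule has_sum_cong_neutral)
    fix k :: int assume "k \<in> UNIV - range int"
    then have "k < 0" by (metis DiffE nonneg_int_cases not_less rangeI)
    then have "(2::real) powi 1 \<le> 2 powi (- k)" by (intro power_int_increasing) auto
    then have "2 * 1 < 2 powi (- k) * infnorm w" using assms by (intro mult_le_less_imp_less) auto
    then show "fourier \<phi> (2 powi (- k) *\<^sub>R w) = 0"
      by (intro fourier_generator_eq_0) (simp add: infnorm_mul)
  qed auto
  also have "\<dots> \<longleftrightarrow> ((\<lambda>n. fourier \<phi> ((1/2) ^ n *\<^sub>R w)) has_sum 1) UNIV"
    by (subst has_sum_reindex) (auto simp: o_def powi_minus_int)
  finally have "(\<lambda>n. fourier \<phi> ((1/2) ^ n *\<^sub>R w)) sums 1" by (rule has_sum_imp_sums)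
  then show ?thesis unfolding low_symbol_altdef by (simp add: sums_iff)
qed

text \<open>Halving the frequency shifts the dyadic index by one. This two-scale relation gives both
  the telescoping of the blocks and the refinement of the kernel.\<close>

lemma low_symbol_half: "low_symbol ((1/2) *\<^sub>R w) = low_symbol w + fourier \<phi> w"
proof -
  obtain K where K: "infnorm w < 2 ^ K" using real_arch_pow[of 2 "infnorm w"] by auto
  have "low_symbol w = 1 - (\<Sum>n<Suc K. fourier \<phi> ((1/2) ^ n *\<^sub>R w))"
    by (rule low_symbol_finite_sum) (use K in simp)
  moreover have "low_symbol ((1/2) *\<^sub>R w) = 1 - (\<Sum>n<K. fourier \<phi> ((1/2) ^ n *\<^sub>R (1/2) *\<^sub>R w))"
    by (rule low_symbol_finite_sum) (use K in \<open>simp add: infnorm_mul\<close>)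
  ultimately show ?thesis
    by (simp add: sum.lessThan_Suc_shift mult.commute del: sum.lessThan_Suc)
qed

lemma continuous_low_symbol: "continuous_on UNIV low_symbol"
proof (rule continuous_at_imp_continuous_on, rule ballI)
  fix w :: "real^'d"
  obtain K where K: "2 * infnorm w < 2 ^ K" using real_arch_pow[of 2 "2 * infnorm w"] by auto
  let ?S = "{v::real^'d. infnorm v < 2 ^ K / 2}"
  have "open ?S"
    by (intro open_Collect_less continuous_intros) (auto simp: continuous_on_def intro: tendsto_infnorm)
  moreover have "continuous_on ?S low_symbol"
  proof -
    have "continuous_on ?S (\<lambda>w. 1 - (\<Sum>n<K. fourier \<phi> ((1/2) ^ n *\<^sub>R w)))"
      by (intro continuous_intros continuous_on_compose2[OF continuous_fourier[OF integrable_generator]]) auto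
    then show ?thesis
      by (rule continuous_on_eq) (auto simp: low_symbol_finite_sum)
  qed
  moreover have "w \<in> ?S" using K by simp
  ultimately show "isCont low_symbol w" by (meson continuous_on_eq_continuous_at)
qed

lemma measurable_low_symbol [measurable]: "low_symbol \<in> borel_measurable borel"
  by (rule borel_measurable_continuous_onI[OF continuous_low_symbol])

lemma low_symbol_bounded: obtains B where "\<And>w. norm (low_symbol w) \<le> B"
proof
  fix w :: "real^'d"
  let ?I = "\<integral>x. norm (\<phi> x) \<partial>lborel"
  show "norm (low_symbol w) \<le> 1 + 2 * ?I"
  proof (cases "infnorm w < 2")
    case True
    then have "low_symbol w = 1 - (\<Sum>n<2. fourier \<phi> ((1/2) ^ n *\<^sub>R w))"
      by (intro low_symbol_finite_sum) simp
    then have "norm (low_symbol w) \<le> norm (1::complex) + norm (\<Sum>n<2. fourier \<phi> ((1/2) ^ n *\<^sub>R w))"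
      by (metis norm_triangle_ineq4)
    also have "norm (\<Sum>n<2. fourier \<phi> ((1/2) ^ n *\<^sub>R w)) \<le> (\<Sum>n<2::nat. ?I)"
      by (intro sum_norm_le norm_fourier_le integrable_generator)
    finally show ?thesis by simp
  next
    case False
    then have "low_symbol w = 0" by (intro low_symbol_eq_0) simp
    then show ?thesis by simp
  qed
qed

lemma integrable_low_symbol: "integrable lborel low_symbol"
  using low_symbol_bounded low_symbol_eq_0 by (metis integrable_bounded_support(1) measurable_low_symbol)

lemma continuous_low_pass: "continuous_on UNIV low_pass"
  unfolding low_pass_def by (rule continuous_inverse_fourier[OF integrable_low_symbol])

lemma measurable_low_pass [measurable]: "low_pass \<in> borel_measurable borel"
  by (rule borel_measurable_continuous_onI[OF continuous_low_pass])

text \<open>On a bounded region only finitely many dilates of the transform of \<open>\<phi>\<close>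
  enter the symbol, and a difference of order M = Suc N of each is at most t^M times an M-th moment
  of \<open>\<phi>\<close>. Far out the whole stencil lies where the symbol vanishes, so the support
  of the differences does not depend on t.\<close>

lemma funpow_fdiff_low_symbol_bound:
  obtains C where "0 \<le> C"
    "\<And>t j w. 0 < t \<Longrightarrow> t \<le> 1 \<Longrightarrow> norm ((fdiff (t *\<^sub>R axis j 1) ^^ Suc N) low_symbol w) \<le> C * t ^ Suc N"
    "\<And>t j w. 0 < t \<Longrightarrow> t \<le> 1 \<Longrightarrow> 2 + real N < infnorm w \<Longrightarrow> (fdiff (t *\<^sub>R axis j 1) ^^ Suc N) low_symbol w = 0"
proof -
  define M where "M = Suc N"
  \<comment> \<open>For infnorm w at most 1 + M the stencil stays within infnorm 1 + 2 M, which is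
    below 2^K / 2; so K terms represent the symbol on all of it.\<close>
  define K where "K = 2 * M + 2"
  define I where "I = (\<integral>x. (2 * pi * norm x) ^ M * norm (\<phi> x) \<partial>lborel)"
  have iM: "integrable lborel (\<lambda>x. (2 * pi * norm x) ^ M * norm (\<phi> x))"
  proof (rule Bochner_Integration.integrable_bound)
    show "integrable lborel (\<lambda>x. (2 * pi) ^ M * ((1 + norm x) ^ M * norm (\<phi> x)))"
      by (intro integrable_mult_right integrable_rapid_decay generator_rapid_decay measurable_generator)
    show "AE x in lborel. norm ((2 * pi * norm x) ^ M * norm (\<phi> x)) \<le> norm ((2 * pi) ^ M * ((1 + norm x) ^ M * norm (\<phi> x)))"
      by (intro AE_I2) (auto simp: power_mult_distrib abs_mult power_abs mult.assoc intro!: mult_left_mono mult_right_mono power_mono)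
  qed measurable
  have I0: "0 \<le> I" unfolding I_def by (intro integral_nonneg_AE) auto
  have shift: "\<bar>infnorm (w + real i *\<^sub>R (t *\<^sub>R axis j 1)) - infnorm w\<bar> \<le> real i"
    if "0 < t" "t \<le> 1" for w :: "real^'d" and t i and j :: 'd
  proof -
    have "infnorm (real i *\<^sub>R (t *\<^sub>R axis j (1::real) :: real^'d)) = real i * infnorm (t *\<^sub>R axis j (1::real) :: real^'d)"
      by (simp add: infnorm_mul abs_mult)
    also have "\<dots> \<le> real i * 1"
      using infnorm_axis[of t j] that by (intro mult_left_mono) auto
    finally have "infnorm (real i *\<^sub>R (t *\<^sub>R axis j (1::real) :: real^'d)) \<le> real i" by simp
    moreover have "\<bar>infnorm (w + v) - infnorm w\<bar> \<le> infnorm v" for v :: "real^'d"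
      using infnorm_triangle[of w v] infnorm_triangle[of "w + v" "- v"] by (simp add: infnorm_neg)
    ultimately show ?thesis by (meson order_trans)
  qed
  have zero: "(fdiff (t *\<^sub>R axis j 1) ^^ M) low_symbol w = 0"
    if t: "0 < t" "t \<le> 1" and w: "1 + real M < infnorm w" for t j w
  proof -
    have "(fdiff (t *\<^sub>R axis j 1) ^^ M) low_symbol w = (fdiff (t *\<^sub>R axis j 1) ^^ M) (\<lambda>_. 0) w"
    proof (rule funpow_fdiff_cong)
      fix i assume "i \<le> M"
      with shift[OF t, of w i j] w have "1 < infnorm (w + real i *\<^sub>R (t *\<^sub>R axis j 1))" by linarith
      then show "low_symbol (w + real i *\<^sub>R t *\<^sub>R axis j 1) = 0" by (rule low_symbol_eq_0)
    qed
    then show ?thesis by simp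
  qed
  have bound: "norm ((fdiff (t *\<^sub>R axis j 1) ^^ M) low_symbol w) \<le> (real K * I) * t ^ M"
    if t: "0 < t" "t \<le> 1" for t j w
  proof (cases "1 + real M < infnorm w")
    case True
    then show ?thesis using zero[OF t] I0 t by simp
  next
    case False
    let ?v = "t *\<^sub>R axis j (1::real) :: real^'d"
    have "real (2 * M + 1) < 2 ^ (2 * M + 1)" by (rule of_nat_less_two_power)
    then have K: "1 + 2 * real M < 2 ^ K / 2" by (simp add: K_def)
    have "(fdiff ?v ^^ M) low_symbol w = (fdiff ?v ^^ M) (\<lambda>w. 1 - (\<Sum>n<K. fourier \<phi> ((1/2) ^ n *\<^sub>R w))) w"
    proof (intro funpow_fdiff_cong low_symbol_finite_sum)
      fix i assume "i \<le> M"
      with shift[OF t, of w i j] False K show "infnorm (w + real i *\<^sub>R ?v) < 2 ^ K / 2" by linarith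
    qed
    also have "\<dots> = - (\<Sum>n<K. (fdiff ((1/2) ^ n *\<^sub>R ?v) ^^ M) (fourier \<phi>) ((1/2) ^ n *\<^sub>R w))"
      unfolding M_def by (simp only: funpow_fdiff_const_minus_sum funpow_fdiff_scale)
    finally have "norm ((fdiff ?v ^^ M) low_symbol w)
        = norm (\<Sum>n<K. (fdiff ((1/2) ^ n *\<^sub>R ?v) ^^ M) (fourier \<phi>) ((1/2) ^ n *\<^sub>R w))" by simp
    also have "\<dots> \<le> (\<Sum>n<K. I * t ^ M)"
    proof (rule sum_norm_le)
      fix n
      let ?u = "(1/2) ^ n *\<^sub>R ?v"
      have nu: "norm ?u \<le> t" using t by (simp add: power_le_one mult_left_le_one_le)
      note ff = funpow_fdiff_fourier[OF integrable_generator, where v = ?u and N = M and w = "(1/2) ^ n *\<^sub>R w"]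
      have "norm ((fdiff ?u ^^ M) (fourier \<phi>) ((1/2) ^ n *\<^sub>R w))
          \<le> (\<integral>x. norm ((cis (- 2 * pi * (?u \<bullet> x)) - 1) ^ M * \<phi> x) \<partial>lborel)"
        unfolding conjunct1[OF ff] by (rule norm_fourier_le[OF conjunct2[OF ff]])
      also have "\<dots> \<le> (\<integral>x. t ^ M * ((2 * pi * norm x) ^ M * norm (\<phi> x)) \<partial>lborel)"
      proof (rule integral_mono)
        show "integrable lborel (\<lambda>x. norm ((cis (- 2 * pi * (?u \<bullet> x)) - 1) ^ M * \<phi> x))"
          using ff by (intro integrable_norm) blast
        show "integrable lborel (\<lambda>x. t ^ M * ((2 * pi * norm x) ^ M * norm (\<phi> x)))"
          by (intro integrable_mult_right iM)
        fix x :: "real^'d"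
        have "\<bar>?u \<bullet> x\<bar> \<le> norm ?u * norm x" by (rule Cauchy_Schwarz_ineq2)
        also have "\<dots> \<le> t * norm x" by (rule mult_right_mono[OF nu]) simp
        finally have inner: "\<bar>?u \<bullet> x\<bar> \<le> t * norm x" .
        have "norm (cis (- 2 * pi * (?u \<bullet> x)) - 1) \<le> 2 * pi * \<bar>?u \<bullet> x\<bar>"
          using norm_cis_minus_one_le[of "- 2 * pi * (?u \<bullet> x)"] by (simp add: abs_mult)
        also have "\<dots> \<le> 2 * pi * (t * norm x)"
          by (intro mult_left_mono inner) simp
        finally have "norm (cis (- 2 * pi * (?u \<bullet> x)) - 1) ^ M \<le> (t * (2 * pi * norm x)) ^ M"
          by (intro power_mono) (auto simp: mult_ac)
        then show "norm ((cis (- 2 * pi * (?u \<bullet> x)) - 1) ^ M * \<phi> x) \<le> t ^ M * ((2 * pi * norm x) ^ M * norm (\<phi> x))"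
          unfolding norm_mult norm_power mult.assoc[symmetric] power_mult_distrib[symmetric]
          by (intro mult_right_mono) (auto simp: mult_ac)
      qed
      also have "\<dots> = I * t ^ M" unfolding I_def by simp
      finally show "norm ((fdiff ?u ^^ M) (fourier \<phi>) ((1/2) ^ n *\<^sub>R w)) \<le> I * t ^ M" .
    qed
    finally show ?thesis by simp
  qed
  show ?thesis
    by (rule that[of "real K * I"]) (use zero bound I0 in \<open>auto simp: M_def simp del: funpow.simps\<close>)
qed

text \<open>Integration by parts is replaced by finite differences: a step \<open>t\<close> in direction \<open>j\<close> multiplies
  the inverse transform by \<open>cis (- 2 * pi * t * x $ j) - 1\<close>, which is \<open>-2\<close> for \<open>\<bar>t\<bar> = 1 / (2 * \<bar>x $ j\<bar>)\<close>.\<close>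

lemma low_pass_rapid_decay: "rapid_decay low_pass"
proof -
  \<comment> \<open>At least one difference is taken, since only then does the constant 1 in the
    symbol drop out; the remaining exponent follows by monotonicity.\<close>
  have "\<exists>C. \<forall>x. norm (low_pass x) * (1 + norm x) ^ Suc N \<le> C" for N
  proof -
    let ?M = "Suc N"
    obtain C where C: "0 \<le> C"
      and bound: "\<And>t j w. 0 < t \<Longrightarrow> t \<le> 1 \<Longrightarrow> norm ((fdiff (t *\<^sub>R axis j 1) ^^ ?M) low_symbol w) \<le> C * t ^ ?M"
      and zero: "\<And>t j w. 0 < t \<Longrightarrow> t \<le> 1 \<Longrightarrow> 2 + real N < infnorm w \<Longrightarrow> (fdiff (t *\<^sub>R axis j 1) ^^ ?M) low_symbol w = 0"
      by (rule funpow_fdiff_low_symbol_bound) blast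
    define V where "V = measure lborel (cball (0::real^'d) (sqrt (real CARD('d)) * (2 + real N)))"
    define B where "B = (\<integral>w. norm (low_symbol w) \<partial>lborel)"
    have V: "0 \<le> V" by (simp add: V_def)
    have B: "norm (low_pass x) \<le> B" for x
      unfolding low_pass_def B_def by (rule norm_inverse_fourier_le[OF integrable_low_symbol])
    then have B0: "0 \<le> B" using norm_ge_zero order_trans by blast
    have coord: "\<bar>x $ j\<bar> ^ ?M * norm (low_pass x) \<le> B + C * V" for x :: "real^'d" and j :: 'd
    \<comment> \<open>The step 1 / (2 |x_j|) is at most 1 only when |x_j| is at least 1/2; smaller
      coordinates need no decay.\<close>
    proof (cases "\<bar>x $ j\<bar> < 1/2")
      case True
      have "\<bar>x $ j\<bar> ^ ?M * norm (low_pass x) \<le> 1 * norm (low_pass x)"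
        using True by (intro mult_right_mono power_le_one) auto
      with B[of x] mult_nonneg_nonneg[OF C V] show ?thesis by linarith
    next
      case False
      define t where "t = 1 / (2 * \<bar>x $ j\<bar>)"
      have t: "0 < t" "t \<le> 1" using False by (auto simp: t_def field_simps)
      let ?v = "t *\<^sub>R axis j (1::real) :: real^'d"
      let ?G = "(fdiff ?v ^^ ?M) low_symbol"
      have G: "integrable lborel ?G" by (rule integrable_funpow_fdiff[OF integrable_low_symbol])
      have "?v \<bullet> x = t * x $ j" by (simp add: inner_axis' )
      also have "\<dots> = sgn (x $ j) / 2" using False by (simp add: t_def sgn_if)
      finally have "?v \<bullet> x = 1/2 \<or> ?v \<bullet> x = -1/2"
        using False by (auto simp: sgn_if)
      then have "cis (- 2 * pi * (?v \<bullet> x)) = -1"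
        by (elim disjE) (simp_all only: , simp_all add: cis.code complex_eq_iff)
      then have "norm (inverse_fourier ?G x) = 2 ^ ?M * norm (low_pass x)"
        unfolding inverse_fourier_funpow_fdiff[OF integrable_low_symbol] low_pass_def
        by (simp add: norm_mult norm_power del: funpow.simps)
      moreover have "norm (inverse_fourier ?G x) \<le> (C * t ^ ?M) * V"
        unfolding V_def
        by (rule order_trans[OF norm_inverse_fourier_le[OF G] integrable_bounded_support(2)])
           (use G bound[OF t] zero[OF t] in \<open>auto simp del: funpow.simps\<close>)
      moreover have "1 * norm (low_pass x) \<le> 2 ^ ?M * norm (low_pass x)"
        by (intro mult_right_mono one_le_power) auto
      ultimately have "norm (low_pass x) \<le> C * t ^ ?M * V" by linarith
      then have "\<bar>x $ j\<bar> ^ ?M * norm (low_pass x) \<le> \<bar>x $ j\<bar> ^ ?M * (C * t ^ ?M * V)"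
        by (intro mult_left_mono) auto
      also have "\<dots> = (\<bar>x $ j\<bar> * t) ^ ?M * (C * V)" by (simp only: power_mult_distrib mult_ac)
      also have "\<bar>x $ j\<bar> * t = 1/2" using False by (simp add: t_def)
      also have "(1/2) ^ ?M * (C * V) \<le> 1 * (C * V)" using C V by (intro mult_right_mono power_le_one) auto
      finally show ?thesis using B0 by linarith
    qed
    show ?thesis
      by (intro exI allI, rule decay_from_coordinates[OF norm_ge_zero _ coord])
         (use B C V in \<open>auto intro: order_trans add_increasing2\<close>)
  qed
  then have C: "\<exists>C. \<forall>x. norm (low_pass x) * (1 + norm x) ^ Suc N \<le> C" for N by blast
  show ?thesis
    unfolding rapid_decay_def
  proof
    fix N
    obtain C where C: "\<And>x. norm (low_pass x) * (1 + norm x) ^ Suc N \<le> C" using C by blast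
    have "norm (low_pass x) * (1 + norm x) ^ N \<le> norm (low_pass x) * (1 + norm x) ^ Suc N" for x
      by (intro mult_left_mono power_increasing) auto
    with C show "\<exists>C. \<forall>x. norm (low_pass x) * (1 + norm x) ^ N \<le> C" by (meson order_trans)
  qed
qed

lemma integrable_low_pass_moment: "integrable lborel (\<lambda>x. (1 + norm x) ^ m * norm (low_pass x))"
  by (rule integrable_rapid_decay[OF measurable_low_pass low_pass_rapid_decay])

lemma integrable_low_pass: "integrable lborel low_pass"
  using integrable_low_pass_moment[of 0] by (simp add: integrable_norm_iff)

lemma fourier_low_pass: "fourier low_pass w = low_symbol w"
proof -
  obtain B where "\<And>w. norm (low_symbol w) \<le> B" using low_symbol_bounded by blast
  from fourier_inverse_fourier[OF integrable_low_symbol continuous_low_symbol this] integrable_low_pass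
  show ?thesis by (simp add: low_pass_def)
qed

lemma integral_low_pass: "integral\<^sup>L lborel low_pass = 1"
  using fourier_low_pass[of 0] low_symbol_eq_1[of 0] by (simp add: fourier_def infnorm_0)

text \<open>The reproducing identity. Where the symbol at scale s is nonzero, infnorm w is at most
  s, hence below s' / 2, and there the symbol at scale s' is 1; the product of the two symbols is
  therefore the first one.\<close>

lemma convolution_low_pass:
  assumes s: "0 < s" "4 * s \<le> s'"
  shows "(\<integral>y. dilate s' low_pass (x - y) * dilate s low_pass y \<partial>lborel) = dilate s low_pass x"
proof -
  have s': "0 < s'" using s by linarith
  obtain B where B: "\<And>w. norm (low_symbol w) \<le> B" using low_symbol_bounded by blast
  have int: "integrable lborel (\<lambda>w. low_symbol ((1 / u) *\<^sub>R w))" if "0 < u" for u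
    using that by (intro integrable_lborel_scale integrable_low_symbol) auto
  have dil: "dilate u low_pass = inverse_fourier (\<lambda>w. low_symbol ((1 / u) *\<^sub>R w))" if "0 < u" for u
    unfolding low_pass_def by (rule inverse_fourier_scale[OF that integrable_low_symbol, symmetric])
  have prod: "low_symbol ((1 / s') *\<^sub>R w) * low_symbol ((1 / s) *\<^sub>R w) = low_symbol ((1 / s) *\<^sub>R w)" for w
  proof (cases "low_symbol ((1 / s) *\<^sub>R w) = 0")
    case False
    then have "infnorm ((1 / s) *\<^sub>R w) \<le> 1" using low_symbol_eq_0 by force
    then have "infnorm w \<le> s" using s by (simp add: infnorm_mul field_simps)
    with s s' have "infnorm w < s' / 2" by linarith
    then have "infnorm ((1 / s') *\<^sub>R w) < 1/2" using s' by (simp add: infnorm_mul field_simps)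
    then show ?thesis by (simp add: low_symbol_eq_1)
  qed simp
  have "(\<integral>y. dilate s' low_pass (x - y) * dilate s low_pass y \<partial>lborel)
      = inverse_fourier (\<lambda>w. low_symbol ((1 / s') *\<^sub>R w) * low_symbol ((1 / s) *\<^sub>R w)) x"
    unfolding dil[OF s'] dil[OF s(1)]
  proof (rule convolution_inverse_fourier)
    show "continuous_on UNIV (\<lambda>w. low_symbol ((1 / s) *\<^sub>R w))"
      by (rule continuous_on_compose2[OF continuous_low_symbol]) (auto intro!: continuous_intros)
    show "integrable lborel (inverse_fourier (\<lambda>w. low_symbol ((1 / s) *\<^sub>R w)))"
      using integrable_dilate[OF s(1) integrable_low_pass] dil[OF s(1)] by simp
  qed (use int s s' B in auto)
  then show ?thesis using dil[OF s(1)] prod by simp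
qed

lemma dyadic_function_low: "dyadic_function \<phi> (-1) = low_pass"
  by (simp add: dyadic_function_def low_pass_def low_symbol_def)

text \<open>The two-scale relation at frequency w / 2^n, transported to kernels. It makes the
  decomposition telescope and reduces every block to the low-pass kernel.\<close>

lemma dyadic_function_eq:
  "dyadic_function \<phi> (int n) = (\<lambda>x. dilate (2 ^ Suc n) low_pass x - dilate (2 ^ n) low_pass x)"
proof
  fix x
  have sc: "(1 / 2 ^ Suc n) *\<^sub>R w = (1/2) *\<^sub>R (1/2) ^ n *\<^sub>R w" "(1 / 2 ^ n) *\<^sub>R w = (1/2) ^ n *\<^sub>R w" for w :: "real^'d"
    by (simp_all add: power_one_over)
  have "dyadic_symbol \<phi> (int n) = (\<lambda>w. low_symbol ((1 / 2 ^ Suc n) *\<^sub>R w) - low_symbol ((1 / 2 ^ n) *\<^sub>R w))"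
    unfolding sc low_symbol_half by (simp add: fun_eq_iff dyadic_symbol_def powi_minus_int)
  moreover have "integrable lborel (\<lambda>w. low_symbol ((1 / 2 ^ n) *\<^sub>R w) * cis (2 * pi * (w \<bullet> x)))" for n
    by (intro integrable_mult_cis(2) integrable_lborel_scale integrable_low_symbol) auto
  note this[of n] this[of "Suc n"]
  ultimately have "dyadic_function \<phi> (int n) x =
      inverse_fourier (\<lambda>w. low_symbol ((1 / 2 ^ Suc n) *\<^sub>R w)) x - inverse_fourier (\<lambda>w. low_symbol ((1 / 2 ^ n) *\<^sub>R w)) x"
    unfolding dyadic_function_def inverse_fourier_def
    by (simp only: left_diff_distrib Bochner_Integration.integral_diff)
  then show "dyadic_function \<phi> (int n) x = dilate (2 ^ Suc n) low_pass x - dilate (2 ^ n) low_pass x"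
    using inverse_fourier_scale[OF _ integrable_low_symbol, of "2 ^ n"]
      inverse_fourier_scale[OF _ integrable_low_symbol, of "2 ^ Suc n"] by (simp add: low_pass_def)
qed

lemma integrable_fourier_generator: "integrable lborel (fourier \<phi>)"
proof (rule integrable_bounded_support(1)[of _ _ 2])
  show "fourier \<phi> \<in> borel_measurable borel"
    by (rule borel_measurable_continuous_onI[OF continuous_fourier[OF integrable_generator]])
qed (auto intro: norm_fourier_le[OF integrable_generator] fourier_generator_eq_0)

text \<open>The inversion theorem above undoes \<open>inverse_fourier\<close> by
  \<open>fourier\<close>; the opposite order follows by reflecting the frequency variable.\<close>

lemma inverse_fourier_fourier_generator: "inverse_fourier (fourier \<phi>) x = \<phi> x"
proof -
  note int = integrable_fourier_generator
  have eq: "inverse_fourier \<phi> = (\<lambda>w. fourier \<phi> (0 - w))"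
    by (simp add: fun_eq_iff fourier_eq_inverse_fourier)
  have int': "integrable lborel (inverse_fourier \<phi>)"
    unfolding eq by (rule integrable_lborel_reflect[OF int])
  obtain C where C: "\<And>x. norm (\<phi> x) \<le> C / (1 + norm x) ^ 0" by (rule rapid_decayE[OF generator_rapid_decay]) blast
  have "inverse_fourier (fourier \<phi>) x = (\<integral>w. fourier \<phi> (0 - w) * cis (2 * pi * ((0 - w) \<bullet> x)) \<partial>lborel)"
    unfolding inverse_fourier_def
    by (rule integral_lborel_reflect[symmetric, where f="\<lambda>w. fourier \<phi> w * cis (2 * pi * (w \<bullet> x))"])
       (rule integrable_mult_cis(2)[OF int])
  also have "\<dots> = fourier (inverse_fourier \<phi>) x"
    unfolding fourier_def[of "inverse_fourier \<phi>"] unfolding eq by (simp add: inner_commute)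
  also have "\<dots> = \<phi> x"
    by (rule fourier_inverse_fourier[OF integrable_generator continuous_generator _ int', of C]) (use C in simp)
  finally show ?thesis .
qed

text \<open>The two-scale relation at frequency 2 w, read on the kernel side: the kernel is a
  coarser copy of itself plus a Schwartz function.\<close>

lemma low_pass_refine: "low_pass x = dilate (1/2) low_pass x + dilate (1/2) \<phi> x"
proof -
  note int = integrable_fourier_generator
  have i: "integrable lborel (\<lambda>w. f ((1 / (1/2)) *\<^sub>R w) * cis (2 * pi * (w \<bullet> x)))" if "integrable lborel f" for f :: "real^'d \<Rightarrow> complex"
    by (intro integrable_mult_cis(2) integrable_lborel_scale that) auto
  have "low_symbol w = low_symbol ((1 / (1/2)) *\<^sub>R w) + fourier \<phi> ((1 / (1/2)) *\<^sub>R w)" for w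
    using low_symbol_half[of "2 *\<^sub>R w"] by simp
  then have "low_pass x = (\<integral>w. low_symbol ((1 / (1/2)) *\<^sub>R w) * cis (2 * pi * (w \<bullet> x))
      + fourier \<phi> ((1 / (1/2)) *\<^sub>R w) * cis (2 * pi * (w \<bullet> x)) \<partial>lborel)"
    unfolding low_pass_def inverse_fourier_def
    by (intro Bochner_Integration.integral_cong refl) (metis distrib_right)
  also have "\<dots> = inverse_fourier (\<lambda>w. low_symbol ((1 / (1/2)) *\<^sub>R w)) x + inverse_fourier (\<lambda>w. fourier \<phi> ((1 / (1/2)) *\<^sub>R w)) x"
    unfolding inverse_fourier_def
    by (rule Bochner_Integration.integral_add[OF i[OF integrable_low_symbol] i[OF int]])
  also have "\<dots> = dilate (1/2) low_pass x + dilate (1/2) \<phi> x"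
    using inverse_fourier_scale[OF _ integrable_low_symbol, of "1/2"] inverse_fourier_scale[OF _ int, of "1/2"]
    by (simp add: low_pass_def dilate_def inverse_fourier_fourier_generator)
  finally show ?thesis .
qed

end

section \<open>The L^1 modulus of continuity of kernels under translation\<close>

definition translation_error :: "(real^'d \<Rightarrow> complex) \<Rightarrow> real^'d \<Rightarrow> real" where
  "translation_error f u = (\<integral>x. norm (f (x + u) - f x) \<partial>lborel)"

lemma integrable_translation_error:
  fixes f :: "real^'d \<Rightarrow> complex"
  shows "integrable lborel f \<Longrightarrow> integrable lborel (\<lambda>x. norm (f (x + u) - f x))"
  by (intro integrable_norm Bochner_Integration.integrable_diff integrable_lborel_translate)

lemma translation_error_le:
  assumes f: "integrable lborel f"
  shows "translation_error f u \<le> 2 * (\<integral>x. norm (f x) \<partial>lborel)"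
proof -
  have "translation_error f u \<le> (\<integral>x. norm (f (x + u)) + norm (f x) \<partial>lborel)"
    unfolding translation_error_def
    by (intro integral_mono integrable_translation_error f Bochner_Integration.integrable_add
        integrable_norm integrable_lborel_translate norm_triangle_ineq4)
  also have "\<dots> = 2 * (\<integral>x. norm (f x) \<partial>lborel)"
    using f integral_lborel_translate[of "\<lambda>x. norm (f x)" u] integrable_lborel_translate[OF f, of u]
    by (subst Bochner_Integration.integral_add) auto
  finally show ?thesis .
qed

lemma translation_error_dilate:
  fixes f :: "real^'d \<Rightarrow> complex"
  assumes s: "0 < s" and f: "integrable lborel f"
  shows "translation_error (dilate s f) u = translation_error f (s *\<^sub>R u)"
proof -
  have "translation_error (dilate s f) u = s ^ CARD('d) * (\<integral>x. norm (f (s *\<^sub>R x + s *\<^sub>R u) - f (s *\<^sub>R x)) \<partial>lborel)"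
    using s unfolding translation_error_def dilate_def scaleR_add_right right_diff_distrib[symmetric] norm_mult
    by (simp add: norm_power)
  also have "\<dots> = translation_error f (s *\<^sub>R u)"
    using s integral_lborel_scale[OF integrable_translation_error[OF f, of "s *\<^sub>R u"], of s]
    by (simp add: translation_error_def)
  finally show ?thesis .
qed

lemma translation_error_tendsto:
  fixes f :: "real^'d \<Rightarrow> complex"
  assumes cont: "continuous_on UNIV f" and f: "rapid_decay f"
    and v: "v \<longlonglongrightarrow> 0" "\<And>n. norm (v n) \<le> 1"
  shows "(\<lambda>n. translation_error f (v n)) \<longlonglongrightarrow> 0"
proof -
  have [measurable]: "f \<in> borel_measurable borel" by (rule borel_measurable_continuous_onI[OF cont])
  define N where "N = 2 * CARD('d)"
  obtain C where C: "0 < C" "\<And>x. norm (f x) \<le> C / (1 + norm x) ^ N" by (rule rapid_decayE[OF f]) blast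
  have "(\<lambda>n. translation_error f (v n)) \<longlonglongrightarrow> (\<integral>(x::real^'d). 0 \<partial>lborel)"
    unfolding translation_error_def
  \<comment> \<open>Since norm (v n) is at most 1, 1 + norm x is at most 2 * (1 + norm (x + v n)).
    This puts all translates under one majorant and produces the factor 2^N.\<close>
  proof (rule integral_dominated_convergence[where w="\<lambda>x::real^'d. (C * 2 ^ N + C) * (1 / (1 + norm x) ^ N)"])
    show "integrable lborel (\<lambda>x::real^'d. (C * 2 ^ N + C) * (1 / (1 + norm x) ^ N))"
      by (intro integrable_mult_right integrable_inverse_norm_power) (simp add: N_def)
    show "AE x in lborel. (\<lambda>n. norm (f (x + v n) - f x)) \<longlonglongrightarrow> 0"
    proof (intro AE_I2)
      fix x :: "real^'d"
      have "isCont f (x + 0)" using cont by (simp add: continuous_on_eq_continuous_at)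
      then have "(\<lambda>n. f (x + v n)) \<longlonglongrightarrow> f (x + 0)"
        by (rule isCont_tendsto_compose) (intro tendsto_intros v)
      then show "(\<lambda>n. norm (f (x + v n) - f x)) \<longlonglongrightarrow> 0"
        by (auto intro!: tendsto_norm_zero simp: LIM_zero_iff)
    qed
    show "AE x in lborel. norm (norm (f (x + v n) - f x)) \<le> (C * 2 ^ N + C) * (1 / (1 + norm x) ^ N)" for n
    proof (intro AE_I2)
      fix x :: "real^'d"
      have pos: "0 < 1 + norm y" for y :: "real^'d" by (simp add: add_pos_nonneg)
      have "norm x \<le> norm (x + v n) + norm (v n)" by (metis add_diff_cancel_right' norm_triangle_ineq4)
      with v(2)[of n] norm_ge_zero[of "x + v n"] have "1 + norm x \<le> 2 * (1 + norm (x + v n))" by (smt (verit))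
      then have le: "(1 + norm x) ^ N \<le> 2 ^ N * (1 + norm (x + v n)) ^ N"
        by (metis norm_ge_zero add_nonneg_nonneg power_mono power_mult_distrib zero_le_one)
      have "norm (f (x + v n)) \<le> C / (1 + norm (x + v n)) ^ N" by (rule C)
      also have "\<dots> \<le> C * 2 ^ N / (1 + norm x) ^ N"
        using le C(1) zero_less_power[OF pos[of x], of N] zero_less_power[OF pos[of "x + v n"], of N]
        by (simp add: field_simps)
      finally have "norm (f (x + v n)) \<le> C * 2 ^ N / (1 + norm x) ^ N" .
      then have "norm (f (x + v n) - f x) \<le> C * 2 ^ N / (1 + norm x) ^ N + C / (1 + norm x) ^ N"
        using C(2)[of x] norm_triangle_ineq4[of "f (x + v n)" "f x"] by linarith
      then show "norm (norm (f (x + v n) - f x)) \<le> (C * 2 ^ N + C) * (1 / (1 + norm x) ^ N)"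
        by (simp add: add_divide_distrib)
    qed
  qed measurable
  then show ?thesis by simp
qed

text \<open>For norm u \<le> 1 the mean value inequality is applied on the unit ball around x, where
  1 + norm x is at most 2 * (1 + norm z); the gradient bound becomes an integrable function of x.
  For larger u the trivial bound by twice the L^1 norm is already linear in norm u.\<close>

lemma schwartz_translation_error:
  fixes f :: "real^'d \<Rightarrow> complex"
  assumes f: "schwartz f"
  obtains C where "\<And>u. translation_error f u \<le> C * norm u"
proof -
  define N where "N = 2 * CARD('d)"
  note diff = schwartz_differentiable[OF f] and int = schwartz_integrable[OF f]
  have "\<forall>j. \<exists>C. 0 < C \<and> (\<forall>x. norm (partial_deriv j f x) \<le> C / (1 + norm x) ^ N)"
  proof
    fix j
    have "rapid_decay (partial_deriv j f)" using schwartz_rapid_decay[OF f, of "[j]"] by simp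
    then show "\<exists>C. 0 < C \<and> (\<forall>x. norm (partial_deriv j f x) \<le> C / (1 + norm x) ^ N)"
      by (metis rapid_decayE)
  qed
  then obtain C where C: "\<And>j. 0 < C j" "\<And>j x. norm (partial_deriv j f x) \<le> C j / (1 + norm x) ^ N" by metis
  define D where "D = (\<Sum>j\<in>UNIV. C j) * 2 ^ N"
  have D0: "0 \<le> D" unfolding D_def by (intro mult_nonneg_nonneg sum_nonneg less_imp_le C(1)) auto
  have pt: "norm (f (x + u) - f x) \<le> D * (1 / (1 + norm x) ^ N) * norm u" if u: "norm u \<le> 1" for x u
  proof -
    have "norm (f (x + u) - f x) \<le> (D * (1 / (1 + norm x) ^ N)) * norm ((x + u) - x)"
    proof (rule differentiable_bound[of "cball x 1" f "\<lambda>z. frechet_derivative f (at z)"])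
      fix z assume z: "z \<in> cball x 1"
      have der: "(f has_derivative frechet_derivative f (at z)) (at z)"
        using diff frechet_derivative_works by blast
      then show "(f has_derivative frechet_derivative f (at z)) (at z within cball x 1)"
        by (rule has_derivative_at_withinI)
      interpret bl: bounded_linear "frechet_derivative f (at z)" by (rule has_derivative_bounded_linear[OF der])
      have pos: "0 < 1 + norm y" for y :: "real^'d" by (simp add: add_pos_nonneg)
      have "norm x \<le> norm z + norm (x - z)" by (metis add.commute diff_add_cancel norm_triangle_ineq)
      moreover have "norm (x - z) \<le> 1" using z by (simp add: dist_norm)
      ultimately have "1 + norm x \<le> 2 * (1 + norm z)" using norm_ge_zero[of z] by (smt (verit))
      then have le: "(1 + norm x) ^ N \<le> 2 ^ N * (1 + norm z) ^ N"
        by (metis norm_ge_zero add_nonneg_nonneg power_mono power_mult_distrib zero_le_one)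
      show "onorm (frechet_derivative f (at z)) \<le> D * (1 / (1 + norm x) ^ N)"
      proof (rule onorm_le)
        fix h :: "real^'d"
        have "frechet_derivative f (at z) h = frechet_derivative f (at z) (\<Sum>j\<in>UNIV. h $ j *\<^sub>R axis j 1)"
          using basis_expansion[of h] by (simp add: scalar_mult_eq_scaleR)
        also have "\<dots> = (\<Sum>j\<in>UNIV. h $ j *\<^sub>R partial_deriv j f z)"
          by (simp add: bl.sum bl.scaleR partial_deriv_def)
        also have "norm \<dots> \<le> (\<Sum>j\<in>UNIV. norm h * (C j * 2 ^ N / (1 + norm x) ^ N))"
        proof (rule sum_norm_le)
          fix j
          have "norm (partial_deriv j f z) \<le> C j / (1 + norm z) ^ N" by (rule C)
          also have "\<dots> \<le> C j * 2 ^ N / (1 + norm x) ^ N"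
            using le C(1)[of j] zero_less_power[OF pos[of x], of N] zero_less_power[OF pos[of z], of N]
            by (simp add: field_simps)
          finally show "norm (h $ j *\<^sub>R partial_deriv j f z) \<le> norm h * (C j * 2 ^ N / (1 + norm x) ^ N)"
            using component_le_norm_cart[of h j] by (simp add: mult_mono del: times_divide_eq_right)
        qed
        also have "\<dots> = D * (1 / (1 + norm x) ^ N) * norm h"
          by (simp add: D_def sum_distrib_left sum_distrib_right sum_divide_distrib mult_ac)
        finally show "norm (frechet_derivative f (at z) h) \<le> D * (1 / (1 + norm x) ^ N) * norm h" .
      qed
    qed (use u in \<open>auto simp: dist_norm\<close>)
    then show ?thesis by simp
  qed
  define E where "E = (\<integral>(x::real^'d). D * (1 / (1 + norm x) ^ N) \<partial>lborel)"
  define I where "I = (\<integral>x. norm (f x) \<partial>lborel)"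
  have iE: "integrable lborel (\<lambda>x::real^'d. D * (1 / (1 + norm x) ^ N))"
    by (intro integrable_mult_right integrable_inverse_norm_power) (simp add: N_def)
  have E0: "0 \<le> E" unfolding E_def by (intro integral_nonneg_AE AE_I2) (use D0 in auto)
  have I0: "0 \<le> I" unfolding I_def by (intro integral_nonneg_AE AE_I2) auto
  show ?thesis
  proof
    fix u :: "real^'d"
    show "translation_error f u \<le> (E + 2 * I) * norm u"
    proof (cases "norm u \<le> 1")
      case True
      have "translation_error f u \<le> (\<integral>(x::real^'d). D * (1 / (1 + norm x) ^ N) * norm u \<partial>lborel)"
        unfolding translation_error_def
        by (intro integral_mono integrable_translation_error int integrable_mult_left iE pt True)
      also have "\<dots> = E * norm u" unfolding E_def by (rule integral_mult_left_zero)
      also have "\<dots> \<le> (E + 2 * I) * norm u" using I0 by (intro mult_right_mono) auto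
      finally show ?thesis .
    next
      case False
      have "translation_error f u \<le> 2 * I * 1" using translation_error_le[OF int] by (simp add: I_def)
      also have "\<dots> \<le> (E + 2 * I) * norm u" using False I0 E0 by (intro mult_mono) auto
      finally show ?thesis .
    qed
  qed
qed

context dyadic_partition
begin

text \<open>Writing E for the translation error, refinement gives E(u) \<le> E(u / 2) + (C / 2) |u|.
  Iterated, the geometric series stays below C |u|, and the remainder E(u / 2^n) tends to 0 by
  dominated convergence.\<close>

lemma low_pass_translation_error:
  obtains C where "0 \<le> C" "\<And>u. translation_error low_pass u \<le> C * norm u"
proof -
  obtain A where A: "\<And>u. translation_error \<phi> u \<le> A * norm u"
    by (rule schwartz_translation_error[OF schwartz]) blast
  define C where "C = \<bar>A\<bar>"
  have C: "translation_error \<phi> u \<le> C * norm u" for u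
    using A[of u] mult_right_mono[OF abs_ge_self[of A] norm_ge_zero[of u]] by (simp add: C_def)
  have step: "translation_error low_pass u \<le> translation_error low_pass ((1/2) *\<^sub>R u) + C / 2 * norm u" for u
  proof -
    have i: "integrable lborel (dilate (1/2) low_pass)" "integrable lborel (dilate (1/2) \<phi>)"
      by (simp_all add: integrable_dilate integrable_low_pass integrable_generator)
    have "translation_error low_pass u \<le> (\<integral>x. norm (dilate (1/2) low_pass (x + u) - dilate (1/2) low_pass x)
        + norm (dilate (1/2) \<phi> (x + u) - dilate (1/2) \<phi> x) \<partial>lborel)"
      unfolding translation_error_def
    proof (intro integral_mono Bochner_Integration.integrable_add integrable_translation_error i integrable_low_pass)
      fix x
      show "norm (low_pass (x + u) - low_pass x) \<le> norm (dilate (1/2) low_pass (x + u) - dilate (1/2) low_pass x)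
        + norm (dilate (1/2) \<phi> (x + u) - dilate (1/2) \<phi> x)"
        unfolding low_pass_refine[of x] low_pass_refine[of "x + u"] add_diff_add by (rule norm_triangle_ineq)
    qed
    also have "\<dots> = translation_error (dilate (1/2) low_pass) u + translation_error (dilate (1/2) \<phi>) u"
      unfolding translation_error_def
      by (intro Bochner_Integration.integral_add integrable_translation_error i)
    also have "\<dots> = translation_error low_pass ((1/2) *\<^sub>R u) + translation_error \<phi> ((1/2) *\<^sub>R u)"
      by (simp add: translation_error_dilate integrable_low_pass integrable_generator)
    also have "\<dots> \<le> translation_error low_pass ((1/2) *\<^sub>R u) + C / 2 * norm u"
      using C[of "(1/2) *\<^sub>R u"] by simp
    finally show ?thesis .
  qed
  have iter: "translation_error low_pass u \<le> translation_error low_pass ((1/2) ^ n *\<^sub>R u) + C * (1 - (1/2) ^ n) * norm u" for u n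
  proof (induction n)
    case (Suc n)
    show ?case using Suc.IH step[of "(1/2) ^ n *\<^sub>R u"] by (simp add: algebra_simps)
  qed simp
  define I where "I = (\<integral>x. norm (low_pass x) \<partial>lborel)"
  have I0: "0 \<le> I" unfolding I_def by (intro integral_nonneg_AE AE_I2) auto
  have C0: "0 \<le> C" by (simp add: C_def)
  show ?thesis
  proof
    show "0 \<le> C + 2 * I" using C0 I0 by simp
    fix u :: "real^'d"
    show "translation_error low_pass u \<le> (C + 2 * I) * norm u"
    proof (cases "norm u \<le> 1")
      case True
      have "(\<lambda>n. (1/2) ^ n *\<^sub>R u) \<longlonglongrightarrow> 0 *\<^sub>R u"
        by (intro tendsto_intros LIMSEQ_realpow_zero) auto
      then have "(\<lambda>n. translation_error low_pass ((1/2) ^ n *\<^sub>R u)) \<longlonglongrightarrow> 0"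
        using True by (intro translation_error_tendsto continuous_low_pass low_pass_rapid_decay)
          (auto intro!: mult_le_one simp: power_le_one)
      then have lim: "(\<lambda>n. translation_error low_pass ((1/2) ^ n *\<^sub>R u) + C * norm u) \<longlonglongrightarrow> 0 + C * norm u"
        by (intro tendsto_intros)
      have "translation_error low_pass u \<le> 0 + C * norm u"
      proof (rule LIMSEQ_le_const[OF lim], intro exI allI impI)
        fix n :: nat
        have "C * (1 - (1/2) ^ n) * norm u \<le> C * 1 * norm u"
          using C0 by (intro mult_right_mono mult_left_mono) auto
        with iter[of u n] show "translation_error low_pass u \<le> translation_error low_pass ((1/2) ^ n *\<^sub>R u) + C * norm u"
          by simp
      qed
      also have "\<dots> \<le> (C + 2 * I) * norm u" using I0 by (simp add: distrib_right)
      finally show ?thesis .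
    next
      case False
      have "translation_error low_pass u \<le> 2 * I * 1" using translation_error_le[OF integrable_low_pass] by (simp add: I_def)
      also have "\<dots> \<le> (C + 2 * I) * norm u" using False I0 C0 by (intro mult_mono) auto
      finally show ?thesis .
    qed
  qed
qed

end

section \<open>Functionals and vector-valued integrals\<close>

definition sublinear :: "('a::real_normed_vector \<Rightarrow> real) \<Rightarrow> bool" where
  "sublinear p \<longleftrightarrow> (\<forall>x y. p (x + y) \<le> p x + p y) \<and> (\<forall>c>0. \<forall>x. p (c *\<^sub>R x) \<le> c * p x) \<and> (\<forall>x. p x \<le> norm x)"

lemma sublinearD:
  assumes "sublinear p"
  shows "p (x + y) \<le> p x + p y" "0 < c \<Longrightarrow> p (c *\<^sub>R x) \<le> c * p x" "p x \<le> norm x"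
  using assms by (auto simp: sublinear_def)

lemma sublinear_zero: "sublinear p \<Longrightarrow> p 0 = 0"
  using sublinearD(2)[of p 2 0] sublinearD(3)[of p 0] by simp

lemma sublinear_scale:
  assumes p: "sublinear p" and c: "0 \<le> c"
  shows "p (c *\<^sub>R x) = c * p x"
proof (cases "c = 0")
  case False
  with c have c: "0 < c" by simp
  have "p ((1 / c) *\<^sub>R c *\<^sub>R x) \<le> (1 / c) * p (c *\<^sub>R x)" using c by (intro sublinearD(2)[OF p]) simp
  then have "c * p x \<le> p (c *\<^sub>R x)" using c by (simp add: field_simps)
  with sublinearD(2)[OF p c, of x] show ?thesis by simp
qed (use sublinear_zero[OF p] in simp)

lemma sublinear_minus: "sublinear p \<Longrightarrow> - p (- x) \<le> p x"
  using sublinearD(1)[of p x "- x"] sublinear_zero[of p] by simp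

text \<open>Domination by the norm is thereby two-sided, which keeps the pointwise infima over
  chains finite.\<close>

lemma sublinear_lower: "sublinear p \<Longrightarrow> - norm x \<le> p x"
  using sublinear_minus[of p x] sublinearD(3)[of p "- x"] by simp

text \<open>Taking t = 1 at the point - y gives \<open>tilt p y (- y) \<le> - p y\<close>. A
  functional unchanged by every tilt is therefore odd.\<close>

definition tilt :: "('a::real_normed_vector \<Rightarrow> real) \<Rightarrow> 'a \<Rightarrow> 'a \<Rightarrow> real" where
  "tilt p y x = (INF t\<in>{0..}. p (x + t *\<^sub>R y) - t * p y)"

lemma tilt_lower:
  assumes p: "sublinear p" and "0 \<le> t"
  shows "- p (- x) \<le> p (x + t *\<^sub>R y) - t * p y"
  using sublinearD(1)[OF p, of "x + t *\<^sub>R y" "- x"] sublinear_scale[OF p, of t y] assms by simp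

lemma tilt_bdd: "sublinear p \<Longrightarrow> bdd_below ((\<lambda>t. p (x + t *\<^sub>R y) - t * p y) ` {0..})"
  by (rule bdd_belowI2[of _ "- p (- x)"]) (simp add: tilt_lower)

lemma tilt_le: "sublinear p \<Longrightarrow> 0 \<le> t \<Longrightarrow> tilt p y x \<le> p (x + t *\<^sub>R y) - t * p y"
  unfolding tilt_def by (rule cINF_lower[OF tilt_bdd]) auto

lemma tilt_greatest: "(\<And>t. 0 \<le> t \<Longrightarrow> z \<le> p (x + t *\<^sub>R y) - t * p y) \<Longrightarrow> z \<le> tilt p y x"
  unfolding tilt_def by (rule cINF_greatest) auto

lemma sublinear_tilt:
  assumes p: "sublinear p"
  shows "sublinear (tilt p y)" "tilt p y x \<le> p x"
proof -
  show le: "tilt p y x \<le> p x" for x using tilt_le[OF p, of 0 y x] by simp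
  have add: "tilt p y (a + b) \<le> tilt p y a + tilt p y b" for a b
  proof -
    have "tilt p y (a + b) - (p (b + t *\<^sub>R y) - t * p y) \<le> tilt p y a" if t: "0 \<le> t" for t
    proof (rule tilt_greatest)
      fix s :: real assume s: "0 \<le> s"
      have "tilt p y (a + b) \<le> p ((a + s *\<^sub>R y) + (b + t *\<^sub>R y)) - (s + t) * p y"
        using tilt_le[OF p, of "s + t" y "a + b"] s t by (simp add: scaleR_add_left add_ac)
      also have "\<dots> \<le> (p (a + s *\<^sub>R y) - s * p y) + (p (b + t *\<^sub>R y) - t * p y)"
        using sublinearD(1)[OF p] by (simp add: distrib_right)
      finally show "tilt p y (a + b) - (p (b + t *\<^sub>R y) - t * p y) \<le> p (a + s *\<^sub>R y) - s * p y" by simp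
    qed
    then have "tilt p y (a + b) - tilt p y a \<le> tilt p y b"
      by (intro tilt_greatest) (simp add: algebra_simps)
    then show ?thesis by simp
  qed
  have scale: "tilt p y (c *\<^sub>R a) \<le> c * tilt p y a" if c: "0 < c" for c a
  proof -
    have "tilt p y (c *\<^sub>R a) / c \<le> tilt p y a"
    proof (rule tilt_greatest)
      fix t :: real assume t: "0 \<le> t"
      have "tilt p y (c *\<^sub>R a) \<le> p (c *\<^sub>R (a + t *\<^sub>R y)) - c * t * p y"
        using tilt_le[OF p, of "c * t" y "c *\<^sub>R a"] c t by (simp add: scaleR_add_right)
      also have "\<dots> = c * (p (a + t *\<^sub>R y) - t * p y)"
        using sublinear_scale[OF p, of c] c by (simp add: right_diff_distrib)
      finally show "tilt p y (c *\<^sub>R a) / c \<le> p (a + t *\<^sub>R y) - t * p y" using c by (simp add: field_simps)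
    qed
    then show ?thesis using c by (simp add: field_simps)
  qed
  show "sublinear (tilt p y)"
    unfolding sublinear_def using add scale le sublinearD(3)[OF p] order_trans by blast
qed

text \<open>An infimum of sublinear functionals is not subadditive in general. Along a chain, two
  members \<open>p\<close> and \<open>q\<close> can be replaced by the smaller one, which bounds
  both summands at once.\<close>

lemma sublinear_INF_chain:
  assumes C: "C \<noteq> {}" "\<And>p. p \<in> C \<Longrightarrow> sublinear p" and chain: "\<And>p q. p \<in> C \<Longrightarrow> q \<in> C \<Longrightarrow> p \<le> q \<or> q \<le> p"
  shows "sublinear (\<lambda>x. INF p\<in>C. p x)" "q \<in> C \<Longrightarrow> (INF p\<in>C. p x) \<le> q x"
proof -
  let ?u = "\<lambda>x. INF p\<in>C. p x"
  have bdd: "bdd_below ((\<lambda>p. p x) ` C)" for x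
    by (rule bdd_belowI2[of _ "- norm x"]) (use C sublinear_lower in blast)
  have le: "?u x \<le> p x" if "p \<in> C" for p x by (rule cINF_lower[OF bdd that])
  then show "q \<in> C \<Longrightarrow> (INF p\<in>C. p x) \<le> q x" .
  have add: "?u (x + y) \<le> ?u x + ?u y" for x y
  proof -
    have "?u (x + y) - q y \<le> ?u x" if q: "q \<in> C" for q
    proof (rule cINF_greatest[OF C(1)])
      fix p assume p: "p \<in> C"
      obtain r where r: "r \<in> C" "r \<le> p" "r \<le> q" using chain[OF p q] p q by blast
      have "?u (x + y) \<le> r x + r y"
        using le[OF r(1), of "x + y"] sublinearD(1)[OF C(2)[OF r(1)], of x y] by linarith
      also have "\<dots> \<le> p x + q y" using r by (intro add_mono) (auto simp: le_fun_def)
      finally show "?u (x + y) - q y \<le> p x" by simp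
    qed
    then have "?u (x + y) - ?u x \<le> ?u y" by (intro cINF_greatest[OF C(1)]) (simp add: algebra_simps)
    then show ?thesis by simp
  qed
  have scale: "?u (c *\<^sub>R x) \<le> c * ?u x" if c: "0 < c" for c x
  proof -
    have "?u (c *\<^sub>R x) / c \<le> ?u x"
    proof (rule cINF_greatest[OF C(1)])
      fix p assume p: "p \<in> C"
      have "?u (c *\<^sub>R x) \<le> c * p x"
        using le[OF p, of "c *\<^sub>R x"] sublinearD(2)[OF C(2)[OF p] c, of x] by linarith
      then show "?u (c *\<^sub>R x) / c \<le> p x" using c by (simp add: field_simps)
    qed
    then show ?thesis using c by (simp add: field_simps)
  qed
  obtain p where p: "p \<in> C" using C(1) by blast
  have "?u x \<le> norm x" for x using le[OF p, of x] sublinearD(3)[OF C(2)[OF p], of x] by linarith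
  with add scale show "sublinear ?u" by (simp add: sublinear_def)
qed

text \<open>A minimal sublinear functional is linear, since tilting it in any direction cannot lower it;
  this is the Hahn-Banach theorem in the form of Zorn's lemma for sublinear functionals.\<close>

lemma norming_functional:
  fixes b :: "'a::real_normed_vector"
  obtains l :: "'a \<Rightarrow> real" where "bounded_linear l" "norm b \<le> l b"
proof -
  have norm: "sublinear (norm :: 'a \<Rightarrow> real)" by (simp add: sublinear_def norm_triangle_ineq)
  \<comment> \<open>Staying below \<open>tilt norm b\<close> forces l (- b) \<le> - norm b, which
    becomes norm b \<le> l b once l is known to be odd.\<close>
  define A where "A = {p. sublinear p \<and> p \<le> tilt norm b}"
  have tA: "tilt norm b \<in> A" by (simp add: A_def sublinear_tilt[OF norm])
  have "\<exists>m\<in>A. \<forall>a\<in>A. m \<ge> a \<longrightarrow> a = m"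
  proof (rule predicate_Zorn)
    show "partial_order_on A (relation_of (\<ge>) A)"
      by (rule partial_order_on_relation_ofI) auto
    fix C assume C: "C \<in> Chains (relation_of (\<ge>) A)"
    then have CA: "C \<subseteq> A" and chain: "\<And>p q. p \<in> C \<Longrightarrow> q \<in> C \<Longrightarrow> p \<le> q \<or> q \<le> p"
      unfolding Chains_def relation_of_def by auto
    show "\<exists>u\<in>A. \<forall>a\<in>C. u \<le> a"
    proof (cases "C = {}")
      case True
      then show ?thesis using tA by blast
    next
      case False
      have sub: "\<And>p. p \<in> C \<Longrightarrow> sublinear p" using CA by (auto simp: A_def)
      have u: "sublinear (\<lambda>x. INF p\<in>C. p x)" by (rule sublinear_INF_chain(1)) (use False sub chain in auto)
      have u': "(INF p\<in>C. p x) \<le> q x" if "q \<in> C" for q x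
        by (rule sublinear_INF_chain(2)) (use False sub chain that in auto)
      obtain q where q: "q \<in> C" using False by blast
      have "(\<lambda>x. INF p\<in>C. p x) \<le> q" using u'[OF q] by (auto simp: le_fun_def)
      also have "q \<le> tilt norm b" using q CA by (auto simp: A_def)
      finally have "(\<lambda>x. INF p\<in>C. p x) \<in> A" using u by (simp add: A_def)
      moreover have "(\<lambda>x. INF p\<in>C. p x) \<le> a" if "a \<in> C" for a using u'[OF that] by (auto simp: le_fun_def)
      ultimately show ?thesis by blast
    qed
  qed
  then obtain l where l: "sublinear l" "l \<le> tilt norm b" and min: "\<And>a. a \<in> A \<Longrightarrow> a \<le> l \<Longrightarrow> a = l"
    by (auto simp: A_def)
  have tilt: "tilt l y = l" for y
  proof (rule min)
    show "tilt l y \<le> l" using sublinear_tilt(2)[OF l(1)] by (auto simp: le_fun_def)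
    from order_trans[OF this l(2)] have "tilt l y \<le> tilt norm b" .
    then show "tilt l y \<in> A" using sublinear_tilt(1)[OF l(1)] by (simp add: A_def)
  qed
  have neg: "l (- y) = - l y" for y
    using tilt_le[OF l(1), of 1 y "- y"] sublinear_zero[OF l(1)] sublinear_minus[OF l(1), of y] tilt by simp
  have add: "l (x + y) = l x + l y" for x y
    using sublinearD(1)[OF l(1), of x y] sublinearD(1)[OF l(1), of "x + y" "- y"] neg[of y] by simp
  have scale: "l (c *\<^sub>R x) = c * l x" for c x
    using sublinear_scale[OF l(1), of c x] sublinear_scale[OF l(1), of "- c" x] neg[of "c *\<^sub>R x"]
    by (cases "0 \<le> c") auto
  have "bounded_linear l"
    by (rule bounded_linear_intro[of _ 1])
       (use add scale sublinearD(3)[OF l(1)] sublinear_lower[OF l(1)] in \<open>auto simp: abs_le_iff intro: minus_le_iff[THEN iffD1]\<close>)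
  moreover have "l (- b) \<le> tilt norm b (- b)" using l(2) by (auto simp: le_fun_def)
  then have "norm b \<le> l b" using tilt_le[OF norm, of 1 b "- b"] neg[of b] by simp
  ultimately show ?thesis by (rule that)
qed

section \<open>Complex functionals and integrals against scalar kernels\<close>

lemma bounded_bilinear_scaleC: "bounded_bilinear (scaleC :: complex \<Rightarrow> 'a::complex_banach_algebra \<Rightarrow> 'a)"
proof
  fix r c and a :: 'a
  show "(r *\<^sub>R c) *\<^sub>C a = r *\<^sub>R (c *\<^sub>C a)" for c
    unfolding scaleR_conv_of_real[where 'a=complex] by (simp only: scaleC_scaleC[symmetric] scaleC_of_real)
  show "c *\<^sub>C (r *\<^sub>R a) = r *\<^sub>R (c *\<^sub>C a)"
    by (simp add: scaleC_scaleC mult.commute flip: scaleC_of_real)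
  show "\<exists>K. \<forall>c (a::'a). norm (c *\<^sub>C a) \<le> norm c * norm a * K"
    by (rule exI[of _ 1]) (simp add: norm_scaleC)
qed (simp_all add: scaleC_add_left scaleC_add_right)

interpretation scaleC: bounded_bilinear "scaleC :: complex \<Rightarrow> 'a::complex_banach_algebra \<Rightarrow> 'a"
  by (rule bounded_bilinear_scaleC)

lemma scaleC_one [simp]: "1 *\<^sub>C a = a"
  using scaleC_of_real[of 1 a] by simp

definition complex_functional :: "('a::complex_banach_algebra \<Rightarrow> complex) \<Rightarrow> bool" where
  "complex_functional L \<longleftrightarrow> bounded_linear L \<and> (\<forall>c a. L (c *\<^sub>C a) = c * L a)"

text \<open>A real norming functional l is complexified as l a - i l (i a). Its real part is l, so
  it detects every nonzero difference.\<close>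

lemma complex_functionals_separate:
  fixes x y :: "'a::complex_banach_algebra"
  assumes "\<And>L. complex_functional L \<Longrightarrow> L x = L y"
  shows "x = y"
proof (rule ccontr)
  assume "x \<noteq> y"
  obtain l where l: "bounded_linear l" "norm (x - y) \<le> l (x - y)" by (rule norming_functional)
  interpret l: bounded_linear l by (rule l)
  define L where "L a = complex_of_real (l a) - \<i> * complex_of_real (l (\<i> *\<^sub>C a))" for a
  have "bounded_linear L"
    unfolding L_def
    by (intro bounded_linear_sub bounded_linear_const_mult bounded_linear_compose[OF bounded_linear_of_real]
        l(1) bounded_linear_compose[OF l(1)] scaleC.bounded_linear_right)
  moreover have "L (c *\<^sub>C a) = c * L a" for c a
  proof -
    have "c *\<^sub>C a = (of_real (Re c) + of_real (Im c) * \<i>) *\<^sub>C a" by (simp add: complex_eq[symmetric] mult.commute)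
    also have "\<dots> = Re c *\<^sub>R a + Im c *\<^sub>R (\<i> *\<^sub>C a)"
      by (simp add: scaleC_add_left flip: scaleC_of_real scaleC_scaleC)
    finally have 1: "c *\<^sub>C a = Re c *\<^sub>R a + Im c *\<^sub>R (\<i> *\<^sub>C a)" .
    have "\<i> *\<^sub>C \<i> *\<^sub>C a = - a"
      using scaleC_of_real[of "-1" a] by (simp add: scaleC_scaleC)
    then have 2: "\<i> *\<^sub>C (c *\<^sub>C a) = Re c *\<^sub>R (\<i> *\<^sub>C a) - Im c *\<^sub>R a"
      unfolding 1 by (simp add: scaleC.add_right scaleC.scaleR_right)
    then show ?thesis
      unfolding L_def 2 unfolding 1 by (simp add: l.add l.diff l.scaleR complex_eq_iff algebra_simps)
  qed
  ultimately have "L x = L y" by (intro assms) (simp add: complex_functional_def)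
  then have "l x = l y" by (simp add: L_def complex_eq_iff)
  with l(2) \<open>x \<noteq> y\<close> show False by (simp add: l.diff)
qed

text \<open>Continuity makes the vector-valued integrand continuous and hence integrable on boxes;
  integrability supplies the scalar majorant on the whole space.\<close>

definition kernel :: "(real^'d \<Rightarrow> complex) \<Rightarrow> bool" where
  "kernel f \<longleftrightarrow> continuous_on UNIV f \<and> integrable lborel f"

lemma kernel_measurable: "kernel f \<Longrightarrow> f \<in> borel_measurable borel"
  by (auto simp: kernel_def intro: borel_measurable_continuous_onI)

lemma kernel_integrable_on:
  fixes F :: "real^'d \<Rightarrow> 'a::complex_banach_algebra"
  assumes f: "kernel f" and F: "continuous_on UNIV F" "\<And>t. norm (F t) \<le> B"
  shows "(\<lambda>t. f t *\<^sub>C F t) integrable_on UNIV"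
proof (rule integrable_on_all_intervals_integrable_bound)
  have "continuous_on UNIV (\<lambda>t. f t *\<^sub>C F t)"
    using f F by (intro scaleC.continuous_on) (auto simp: kernel_def)
  then show "(\<lambda>t. if t \<in> UNIV then f t *\<^sub>C F t else 0) integrable_on cbox a b" for a b
    by (simp add: integrable_continuous continuous_on_subset[OF _ subset_UNIV])
  show "norm (f t *\<^sub>C F t) \<le> norm (f t) * B" for t
    by (simp add: norm_scaleC mult_left_mono F)
  show "(\<lambda>t. norm (f t) * B) integrable_on UNIV"
    using f by (intro integrable_on_lborel integrable_mult_left integrable_norm) (simp add: kernel_def)
qed

lemma norm_kernel_integral_le:
  fixes F :: "real^'d \<Rightarrow> 'a::complex_banach_algebra"
  assumes f: "kernel f" and F: "continuous_on UNIV F" "\<And>t. norm (F t) \<le> B"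
    and g: "integrable lborel g" "\<And>t. norm (f t) * norm (F t) \<le> g t"
  shows "norm (integral UNIV (\<lambda>t. f t *\<^sub>C F t)) \<le> integral\<^sup>L lborel g"
proof -
  have "norm (integral UNIV (\<lambda>t. f t *\<^sub>C F t)) \<le> integral UNIV g"
    by (rule Henstock_Kurzweil_Integration.integral_norm_bound_integral[OF kernel_integrable_on[OF f F]])
       (use g in \<open>auto simp: norm_scaleC intro: integrable_on_lborel\<close>)
  then show ?thesis using integral_lborel[OF g(1)] by simp
qed

lemma kernel_mult_integrable:
  fixes u :: "real^'d \<Rightarrow> complex"
  assumes f: "kernel f" and u: "continuous_on UNIV u" "\<And>t. norm (u t) \<le> B"
  shows "integrable lborel (\<lambda>t. f t * u t)"
proof (rule Bochner_Integration.integrable_bound)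
  have [measurable]: "f \<in> borel_measurable borel" "u \<in> borel_measurable borel"
    by (rule kernel_measurable[OF f], rule borel_measurable_continuous_onI[OF u(1)])
  show "(\<lambda>t. f t * u t) \<in> borel_measurable lborel" by measurable
  show "integrable lborel (\<lambda>t. norm (f t) * B)"
    using f by (auto simp: kernel_def)
  show "AE t in lborel. norm (f t * u t) \<le> norm (norm (f t) * B)"
  proof (intro AE_I2)
    fix t
    have "norm (u t) \<le> \<bar>B\<bar>" using u(2)[of t] by linarith
    then show "norm (f t * u t) \<le> norm (norm (f t) * B)" by (simp add: norm_mult abs_mult mult_left_mono)
  qed
qed

text \<open>Complex linearity lets \<open>L\<close> pass the kernel factor. The scalar integrand is
  absolutely integrable, so its gauge integral is a Lebesgue integral, to which Fubini and
  substitution apply.\<close>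

lemma functional_kernel_integral:
  fixes F :: "real^'d \<Rightarrow> 'a::complex_banach_algebra"
  assumes f: "kernel f" and F: "continuous_on UNIV F" "\<And>t. norm (F t) \<le> B" and L: "complex_functional L"
  shows "L (integral UNIV (\<lambda>t. f t *\<^sub>C F t)) = (\<integral>t. f t * L (F t) \<partial>lborel)"
proof -
  from L have bl: "bounded_linear L" and LC: "\<And>c a. L (c *\<^sub>C a) = c * L a" by (auto simp: complex_functional_def)
  obtain K where K: "\<And>a. norm (L a) \<le> norm a * K" using bounded_linear.bounded[OF bl] by blast
  have "continuous_on UNIV (\<lambda>t. L (F t))" by (intro bounded_linear.continuous_on[OF bl] F)
  moreover have "norm (L (F t)) \<le> B * \<bar>K\<bar>" for t
  proof -
    have "norm (L (F t)) \<le> norm (F t) * \<bar>K\<bar>" using K[of "F t"] by (smt (verit) mult_left_mono norm_ge_zero)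
    also have "\<dots> \<le> B * \<bar>K\<bar>" by (intro mult_right_mono F) auto
    finally show ?thesis .
  qed
  ultimately have int: "integrable lborel (\<lambda>t. f t * L (F t))" by (rule kernel_mult_integrable[OF f])
  have "L (integral UNIV (\<lambda>t. f t *\<^sub>C F t)) = integral UNIV (L \<circ> (\<lambda>t. f t *\<^sub>C F t))"
    by (rule integral_linear[OF kernel_integrable_on[OF f F] bl, symmetric])
  also have "L \<circ> (\<lambda>t. f t *\<^sub>C F t) = (\<lambda>t. f t * L (F t))"
    by (simp only: o_def LC)
  finally show ?thesis
    using integral_lborel[OF int] by simp
qed

section \<open>The action of integrable kernels\<close>

locale bounded_group =
  fixes \<psi> :: "real^'d \<Rightarrow> 'a::complex_banach_algebra \<Rightarrow> 'a"
  assumes group: "automorphism_group \<psi>"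
begin

lemma bounded_linear_psi: "bounded_linear (\<psi> t)"
  using group by (simp add: automorphism_group_def banach_algebra_automorphism_def)

lemma psi_scaleC: "\<psi> t (c *\<^sub>C a) = c *\<^sub>C \<psi> t a"
  using group by (simp add: automorphism_group_def banach_algebra_automorphism_def)

lemma psi_psi: "\<psi> s (\<psi> t a) = \<psi> (s + t) a"
  using group unfolding automorphism_group_def by (metis comp_apply)

text \<open>\<open>\<psi> 0\<close> is idempotent by the group law and injective as an
  automorphism.\<close>

lemma psi_0 [simp]: "\<psi> 0 a = a"
proof -
  have "bij (\<psi> 0)" using group by (simp add: automorphism_group_def banach_algebra_automorphism_def)
  then have "inj (\<psi> 0)" by (rule bij_is_inj)
  moreover have "\<psi> 0 (\<psi> 0 a) = \<psi> 0 a" by (simp add: psi_psi)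
  ultimately show ?thesis by (simp add: inj_eq)
qed

lemmas psi_add = linear_add[OF bounded_linear.linear[OF bounded_linear_psi]]
  and psi_diff = linear_diff[OF bounded_linear.linear[OF bounded_linear_psi]]
  and psi_zero [simp] = linear_0[OF bounded_linear.linear[OF bounded_linear_psi]]
  and psi_scaleR = linear_scale[OF bounded_linear.linear[OF bounded_linear_psi]]
  and psi_sum = linear_sum[OF bounded_linear.linear[OF bounded_linear_psi]]

text \<open>The maximum with 1 makes positivity immediate.\<close>

definition M :: real where
  "M = max 1 (SUP t. onorm (\<psi> t))"

lemma M_pos: "0 < M" and M_nonneg: "0 \<le> M"
  by (simp_all add: M_def)

lemma norm_psi_le: "norm (\<psi> t a) \<le> M * norm a"
proof -
  have "norm (\<psi> t a) \<le> onorm (\<psi> t) * norm a" by (rule onorm[OF bounded_linear_psi])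
  also have "onorm (\<psi> t) \<le> M"
    unfolding M_def using group
    by (intro max.coboundedI2 cSUP_upper) (auto simp: automorphism_group_def)
  finally show ?thesis by (simp add: mult_right_mono)
qed

text \<open>An increment of the orbit at s is \<open>\<psi> s\<close> applied to an increment at 0,
  and the group is uniformly bounded.\<close>

lemma orbit_continuous:
  assumes a: "a \<in> continuous_elements \<psi>"
  shows "continuous_on UNIV (\<lambda>t. \<psi> t a)"
proof (rule continuous_at_imp_continuous_on, rule ballI)
  fix s :: "real^'d"
  have "((\<lambda>t. norm (\<psi> (t - s) a - a)) \<longlongrightarrow> 0) (at s)"
    using a LIM_offset[of "\<lambda>t. norm (\<psi> t a - a)" 0 0 "- s"] by (simp add: continuous_elements_def)
  then have lim: "((\<lambda>t. M * norm (\<psi> (t - s) a - a)) \<longlongrightarrow> M * 0) (at s)"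
    by (intro tendsto_intros)
  have le: "norm (\<psi> t a - \<psi> s a) \<le> M * norm (\<psi> (t - s) a - a)" for t
    using norm_psi_le[of s "\<psi> (t - s) a - a"] by (simp add: psi_diff psi_psi)
  have "((\<lambda>t. norm (\<psi> t a - \<psi> s a)) \<longlongrightarrow> 0) (at s)"
    by (rule tendsto_sandwich[OF _ _ tendsto_const lim[simplified]]) (use le in auto)
  then show "isCont (\<lambda>t. \<psi> t a) s"
    unfolding isCont_def by (simp add: tendsto_norm_zero_iff LIM_zero_iff)
qed

lemma orbit_continuous':
  assumes "a \<in> continuous_elements \<psi>"
  shows "continuous_on UNIV (\<lambda>t. \<psi> (c *\<^sub>R t) a)" "continuous_on UNIV (\<lambda>t. \<psi> (- t) a)"
  by (rule continuous_on_compose2[OF orbit_continuous[OF assms]]; auto intro!: continuous_intros)+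

lemma continuous_elements_add:
  assumes "a \<in> continuous_elements \<psi>" "b \<in> continuous_elements \<psi>"
  shows "a + b \<in> continuous_elements \<psi>"
proof -
  have "((\<lambda>t. \<psi> t a - a) \<longlongrightarrow> 0) (at 0)" "((\<lambda>t. \<psi> t b - b) \<longlongrightarrow> 0) (at 0)"
    using assms by (auto simp: continuous_elements_def tendsto_norm_zero_iff)
  from tendsto_norm_zero[OF tendsto_add_zero[OF this]] show ?thesis
    by (simp add: continuous_elements_def psi_add algebra_simps)
qed

lemma continuous_elements_scaleC:
  assumes "a \<in> continuous_elements \<psi>"
  shows "c *\<^sub>C a \<in> continuous_elements \<psi>"
proof -
  have "((\<lambda>t. norm (\<psi> t a - a)) \<longlongrightarrow> 0) (at 0)" using assms by (simp add: continuous_elements_def)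
  from tendsto_mult_right_zero[OF this, of "norm c"] show ?thesis
    by (simp add: continuous_elements_def psi_scaleC norm_scaleC flip: scaleC.diff_right)
qed

lemma continuous_elements_scaleR:
  "a \<in> continuous_elements \<psi> \<Longrightarrow> c *\<^sub>R a \<in> continuous_elements \<psi>"
  using continuous_elements_scaleC[of a "of_real c"] by (simp add: scaleC_of_real)

lemma continuous_elements_diff:
  "a \<in> continuous_elements \<psi> \<Longrightarrow> b \<in> continuous_elements \<psi> \<Longrightarrow> a - b \<in> continuous_elements \<psi>"
  using continuous_elements_add[of a "(-1) *\<^sub>R b"] continuous_elements_scaleR[of b "-1"] by simp

lemma continuous_elements_zero: "0 \<in> continuous_elements \<psi>"
  by (simp add: continuous_elements_def)

lemma continuous_elements_sum:
  "(\<And>i. i \<in> I \<Longrightarrow> f i \<in> continuous_elements \<psi>) \<Longrightarrow> sum f I \<in> continuous_elements \<psi>"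
  by (induction I rule: infinite_finite_induct) (auto intro: continuous_elements_add continuous_elements_zero)

lemma continuous_elements_psi:
  assumes "a \<in> continuous_elements \<psi>"
  shows "\<psi> s a \<in> continuous_elements \<psi>"
proof -
  have lim: "((\<lambda>t. M * norm (\<psi> t a - a)) \<longlongrightarrow> M * 0) (at 0)"
    using assms by (intro tendsto_intros) (simp add: continuous_elements_def)
  have le: "norm (\<psi> t (\<psi> s a) - \<psi> s a) \<le> M * norm (\<psi> t a - a)" for t
    using norm_psi_le[of s "\<psi> t a - a"] by (simp add: psi_diff psi_psi add.commute)
  have "((\<lambda>t. norm (\<psi> t (\<psi> s a) - \<psi> s a)) \<longlongrightarrow> 0) (at 0)"
    by (rule tendsto_sandwich[OF _ _ tendsto_const lim[simplified]]) (use le in auto)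
  then show ?thesis by (simp add: continuous_elements_def)
qed

lemma action_integrable_on:
  assumes "kernel f" "a \<in> continuous_elements \<psi>"
  shows "(\<lambda>t. f t *\<^sub>C \<psi> (- t) a) integrable_on UNIV"
  by (rule kernel_integrable_on[OF assms(1) orbit_continuous'(2)[OF assms(2)] norm_psi_le])

lemma norm_action_le:
  assumes f: "kernel f" and a: "a \<in> continuous_elements \<psi>"
  shows "norm (action \<psi> f a) \<le> M * (\<integral>t. norm (f t) \<partial>lborel) * norm a"
proof -
  have "norm (action \<psi> f a) \<le> (\<integral>t. norm (f t) * (M * norm a) \<partial>lborel)"
    unfolding action_def
    by (rule norm_kernel_integral_le[OF f orbit_continuous'(2)[OF a] norm_psi_le])
       (use f in \<open>auto simp: kernel_def intro!: mult_left_mono norm_psi_le\<close>)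
  then show ?thesis by (simp add: mult_ac)
qed

lemma functional_action:
  assumes "kernel f" "a \<in> continuous_elements \<psi>" "complex_functional L"
  shows "L (action \<psi> f a) = (\<integral>t. f t * L (\<psi> (- t) a) \<partial>lborel)"
  unfolding action_def
  by (rule functional_kernel_integral[OF assms(1) orbit_continuous'(2)[OF assms(2)] norm_psi_le assms(3)])

lemma complex_functional_psi: "complex_functional L \<Longrightarrow> complex_functional (\<lambda>a. L (\<psi> t a))"
  by (auto simp: complex_functional_def psi_scaleC intro: bounded_linear_compose[OF _ bounded_linear_psi])

lemma functional_orbit:
  assumes L: "complex_functional L" and a: "a \<in> continuous_elements \<psi>"
  shows "continuous_on UNIV (\<lambda>t. L (\<psi> (- t) a))" "\<exists>B. \<forall>t. norm (L (\<psi> t a)) \<le> B"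
proof -
  from L have bl: "bounded_linear L" by (simp add: complex_functional_def)
  then show "continuous_on UNIV (\<lambda>t. L (\<psi> (- t) a))"
    by (intro bounded_linear.continuous_on[OF bl] orbit_continuous' a)
  obtain K where K: "0 \<le> K" "\<And>a. norm (L a) \<le> norm a * K" using bounded_linear.nonneg_bounded[OF bl] by blast
  have "norm (L (\<psi> t a)) \<le> M * norm a * K" for t
    using K norm_psi_le mult_right_mono order_trans by blast
  then show "\<exists>B. \<forall>t. norm (L (\<psi> t a)) \<le> B" by blast
qed

lemma action_add:
  "kernel f \<Longrightarrow> a \<in> continuous_elements \<psi> \<Longrightarrow> b \<in> continuous_elements \<psi> \<Longrightarrow>
    action \<psi> f (a + b) = action \<psi> f a + action \<psi> f b"
  unfolding action_def psi_add scaleC_add_right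
  by (rule Henstock_Kurzweil_Integration.integral_add) (simp_all add: action_integrable_on)

lemma action_scaleC:
  assumes "kernel f" "a \<in> continuous_elements \<psi>"
  shows "action \<psi> f (c *\<^sub>C a) = c *\<^sub>C action \<psi> f a"
  using integral_linear[OF action_integrable_on[OF assms] scaleC.bounded_linear_right[of c]]
  by (simp add: action_def o_def psi_scaleC scaleC_scaleC mult.commute)

lemma action_scaleR:
  "kernel f \<Longrightarrow> a \<in> continuous_elements \<psi> \<Longrightarrow> action \<psi> f (c *\<^sub>R a) = c *\<^sub>R action \<psi> f a"
  using action_scaleC[of f a "of_real c"] by (simp add: scaleC_of_real)

lemma action_diff:
  "kernel f \<Longrightarrow> a \<in> continuous_elements \<psi> \<Longrightarrow> b \<in> continuous_elements \<psi> \<Longrightarrow>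
    action \<psi> f (a - b) = action \<psi> f a - action \<psi> f b"
  unfolding action_def psi_diff scaleC.diff_right
  by (rule Henstock_Kurzweil_Integration.integral_diff) (simp_all add: action_integrable_on)

lemma action_zero [simp]: "action \<psi> f 0 = 0"
  by (simp add: action_def scaleC.zero_right)

lemma action_sum:
  assumes "kernel f" "\<And>i. i \<in> I \<Longrightarrow> a i \<in> continuous_elements \<psi>"
  shows "action \<psi> f (sum a I) = (\<Sum>i\<in>I. action \<psi> f (a i))"
  using assms(2)
  by (induction I rule: infinite_finite_induct) (auto simp: action_add assms(1) continuous_elements_sum)

lemma action_kernel_diff:
  "kernel f \<Longrightarrow> kernel g \<Longrightarrow> a \<in> continuous_elements \<psi> \<Longrightarrow>
    action \<psi> (\<lambda>t. f t - g t) a = action \<psi> f a - action \<psi> g a"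
  unfolding action_def scaleC.diff_left
  by (rule Henstock_Kurzweil_Integration.integral_diff) (simp_all add: action_integrable_on)

lemma psi_action:
  assumes "kernel f" "a \<in> continuous_elements \<psi>"
  shows "\<psi> s (action \<psi> f a) = action \<psi> f (\<psi> s a)"
  using integral_linear[OF action_integrable_on[OF assms] bounded_linear_psi[of s]]
  by (simp add: action_def o_def psi_scaleC psi_psi add.commute)

lemma kernel_translate: "kernel f \<Longrightarrow> kernel (\<lambda>t. f (t + s))"
  by (auto simp: kernel_def intro!: integrable_lborel_translate continuous_intros
      intro: continuous_on_compose2[where g=f and t=UNIV])

text \<open>Moves the group parameter from the element into the kernel, so that
  \<open>\<psi> t b - b\<close> becomes the action of a difference of translated kernels.\<close>

lemma action_psi_translate:
  assumes f: "kernel f" and a: "a \<in> continuous_elements \<psi>"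
  shows "action \<psi> f (\<psi> s a) = action \<psi> (\<lambda>t. f (t + s)) a"
proof (rule complex_functionals_separate)
  fix L :: "'a \<Rightarrow> complex" assume L: "complex_functional L"
  obtain B where B: "\<And>t. norm (L (\<psi> t (\<psi> s a))) \<le> B"
    using functional_orbit(2)[OF L continuous_elements_psi[OF a, of s]] by blast
  have int: "integrable lborel (\<lambda>t. f t * L (\<psi> (- t) (\<psi> s a)))"
    by (rule kernel_mult_integrable[OF f functional_orbit(1)[OF L continuous_elements_psi[OF a]] B])
  have "L (action \<psi> f (\<psi> s a)) = (\<integral>t. f t * L (\<psi> (- t) (\<psi> s a)) \<partial>lborel)"
    by (rule functional_action[OF f continuous_elements_psi[OF a] L])
  also have "\<dots> = (\<integral>t. f (t + s) * L (\<psi> (- (t + s)) (\<psi> s a)) \<partial>lborel)"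
    by (rule integral_lborel_translate[OF int, symmetric])
  also have "\<dots> = L (action \<psi> (\<lambda>t. f (t + s)) a)"
    by (subst functional_action[OF kernel_translate[OF f] a L]) (simp add: psi_psi)
  finally show "L (action \<psi> f (\<psi> s a)) = L (action \<psi> (\<lambda>t. f (t + s)) a)" .
qed

lemma continuous_elements_action:
  assumes f: "kernel f" and a: "a \<in> continuous_elements \<psi>"
  shows "action \<psi> f a \<in> continuous_elements \<psi>"
proof -
  define K where "K = M * (\<integral>t. norm (f t) \<partial>lborel)"
  have lim: "((\<lambda>t. K * norm (\<psi> t a - a)) \<longlongrightarrow> K * 0) (at 0)"
    using a by (intro tendsto_intros) (simp add: continuous_elements_def)
  have le: "norm (\<psi> t (action \<psi> f a) - action \<psi> f a) \<le> K * norm (\<psi> t a - a)" for t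
  proof -
    have "\<psi> t (action \<psi> f a) - action \<psi> f a = action \<psi> f (\<psi> t a - a)"
      by (simp add: psi_action[OF f a] action_diff[OF f continuous_elements_psi[OF a] a])
    then show ?thesis
      unfolding K_def using norm_action_le[OF f continuous_elements_diff[OF continuous_elements_psi[OF a, of t] a]] by simp
  qed
  have "((\<lambda>t. norm (\<psi> t (action \<psi> f a) - action \<psi> f a)) \<longlongrightarrow> 0) (at 0)"
    by (rule tendsto_sandwich[OF _ _ tendsto_const lim[simplified]]) (use le in auto)
  then show ?thesis by (simp add: continuous_elements_def)
qed

text \<open>Tested on a functional, this is Fubini before and after the substitution x = t + s. The
  convolution enters as a given kernel \<open>h\<close>; for the reproducing identity
  \<open>h\<close> is \<open>g\<close> itself.\<close>

lemma action_action:
  assumes f: "kernel f" and g: "kernel g" and h: "kernel h" and a: "a \<in> continuous_elements \<psi>"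
    and conv: "\<And>x. (\<integral>y. f (x - y) * g y \<partial>lborel) = h x"
  shows "action \<psi> f (action \<psi> g a) = action \<psi> h a"
proof (rule complex_functionals_separate)
  fix L :: "'a \<Rightarrow> complex" assume L: "complex_functional L"
  define u where "u t = L (\<psi> (- t) a)" for t
  have u: "continuous_on UNIV u" unfolding u_def by (rule functional_orbit(1)[OF L a])
  obtain B where B: "\<And>t. norm (L (\<psi> t a)) \<le> B" using functional_orbit(2)[OF L a] by blast
  have B': "norm (u t) \<le> B" for t unfolding u_def by (rule B)
  have B0: "0 \<le> B" using B[of 0] norm_ge_zero order_trans by blast
  have [measurable]: "f \<in> borel_measurable borel" "g \<in> borel_measurable borel" "u \<in> borel_measurable borel"
    by (rule kernel_measurable[OF f] kernel_measurable[OF g] borel_measurable_continuous_onI[OF u])+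
  have fi: "integrable lborel f" and gi: "integrable lborel g" using f g by (auto simp: kernel_def)
  have "L (action \<psi> f (action \<psi> g a)) = (\<integral>s. f s * L (\<psi> (- s) (action \<psi> g a)) \<partial>lborel)"
    by (rule functional_action[OF f continuous_elements_action[OF g a] L])
  also have "\<dots> = (\<integral>s. (\<integral>t. f s * (g t * u (t + s)) \<partial>lborel) \<partial>lborel)"
    by (subst functional_action[OF g a complex_functional_psi[OF L]]) (simp add: u_def psi_psi add.commute)
  also have "\<dots> = (\<integral>t. (\<integral>s. f s * (g t * u (t + s)) \<partial>lborel) \<partial>lborel)"
  proof (rule lborel_pair.Fubini_integral[symmetric], rule Bochner_Integration.integrable_bound)
    show "integrable (lborel \<Otimes>\<^sub>M lborel) (\<lambda>(s, t). norm (f s) * (norm (g t) * B))"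
      by (rule lborel_pair.Fubini_integrable) (use fi gi B0 in auto)
    show "AE x in lborel \<Otimes>\<^sub>M lborel. norm (case x of (s, t) \<Rightarrow> f s * (g t * u (t + s)))
        \<le> norm (case x of (s, t) \<Rightarrow> norm (f s) * (norm (g t) * B))"
      using B' B0 by (intro AE_I2) (auto simp: norm_mult intro!: mult_left_mono split: prod.split)
  qed measurable
  also have "\<dots> = (\<integral>t. (\<integral>x. f (x - t) * g t * u x \<partial>lborel) \<partial>lborel)"
  proof (rule Bochner_Integration.integral_cong[OF refl])
    fix t
    have "integrable lborel (\<lambda>x. f (x - t) * (g t * u x))"
    proof (rule kernel_mult_integrable)
      show "kernel (\<lambda>x. f (x - t))" using kernel_translate[OF f, of "- t"] by simp
      show "norm (g t * u x) \<le> norm (g t) * B" for x using B' by (simp add: norm_mult mult_left_mono)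
    qed (intro continuous_intros u)
    from integral_lborel_translate[OF this, of t]
    show "(\<integral>s. f s * (g t * u (t + s)) \<partial>lborel) = (\<integral>x. f (x - t) * g t * u x \<partial>lborel)"
      by (simp add: add.commute mult.assoc)
  qed
  also have "\<dots> = (\<integral>x. (\<integral>t. f (x - t) * g t * u x \<partial>lborel) \<partial>lborel)"
  proof (rule lborel_pair.Fubini_integral, rule Bochner_Integration.integrable_bound)
    have "integrable (lborel \<Otimes>\<^sub>M lborel) (\<lambda>(t, x). norm (g t) * norm (f (x - t)) * B)"
    proof (rule lborel_pair.Fubini_integrable)
      have tr: "integrable lborel (\<lambda>x. norm (f (x - t)))" "(\<integral>x. norm (f (x - t)) \<partial>lborel) = (\<integral>x. norm (f x) \<partial>lborel)" for t
        using integrable_lborel_translate[of "\<lambda>x. norm (f x)" "- t"] integral_lborel_translate[of "\<lambda>x. norm (f x)" "- t"] fi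
        by auto
      show "integrable lborel (\<lambda>t. \<integral>x. norm (case (t, x) of (t, x) \<Rightarrow> norm (g t) * norm (f (x - t)) * B) \<partial>lborel)"
        using gi B0 by (simp add: abs_mult tr)
      show "AE t in lborel. integrable lborel (\<lambda>x. case (t, x) of (t, x) \<Rightarrow> norm (g t) * norm (f (x - t)) * B)"
        using tr by auto
    qed measurable
    from lborel_pair.integrable_product_swap[OF this]
    show "integrable (lborel \<Otimes>\<^sub>M lborel) (\<lambda>(x, t). norm (g t) * norm (f (x - t)) * B)" by simp
    show "AE y in lborel \<Otimes>\<^sub>M lborel. norm (case y of (x, t) \<Rightarrow> f (x - t) * g t * u x)
        \<le> norm (case y of (x, t) \<Rightarrow> norm (g t) * norm (f (x - t)) * B)"
      using B' B0 by (intro AE_I2) (auto simp: norm_mult mult.commute[of B] mult.commute[of "norm (f _)"] intro!: mult_left_mono split: prod.split)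
  qed measurable
  also have "\<dots> = (\<integral>x. h x * u x \<partial>lborel)"
    by (simp only: integral_mult_left_zero conv)
  also have "\<dots> = L (action \<psi> h a)"
    unfolding u_def by (rule functional_action[OF h a L, symmetric])
  finally show "L (action \<psi> f (action \<psi> g a)) = L (action \<psi> h a)" .
qed

lemma kernel_dilate: "0 < s \<Longrightarrow> kernel f \<Longrightarrow> kernel (dilate s f)"
  unfolding kernel_def
  by (auto simp: dilate_def[abs_def] intro!: continuous_intros integrable_mult_right integrable_lborel_scale
      intro: continuous_on_compose2[where g=f and t=UNIV])

text \<open>Substitution of c t. Averaging along multiples of t thus acts at the lower scale s / c,
  which identifies the individual terms of an averaged difference.\<close>

lemma integral_dilate_orbit:
  assumes f: "kernel f" and a: "a \<in> continuous_elements \<psi>" and s: "0 < s" and c: "0 < c"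
  shows "integral UNIV (\<lambda>t. dilate s f t *\<^sub>C \<psi> (- c *\<^sub>R t) a) = action \<psi> (dilate (s / c) f) a"
proof (rule complex_functionals_separate)
  fix L :: "'a \<Rightarrow> complex" assume L: "complex_functional L"
  have k: "kernel (dilate s f)" "kernel (dilate (s / c) f)" using f s c by (simp_all add: kernel_dilate)
  obtain B where B: "\<And>t. norm (L (\<psi> t a)) \<le> B" using functional_orbit(2)[OF L a] by blast
  let ?g = "\<lambda>t. dilate (s / c) f t * L (\<psi> (- t) a)"
  have int: "integrable lborel ?g" by (rule kernel_mult_integrable[OF k(2) functional_orbit(1)[OF L a] B])
  have "L (integral UNIV (\<lambda>t. dilate s f t *\<^sub>C \<psi> (- c *\<^sub>R t) a)) = (\<integral>t. dilate s f t * L (\<psi> (- c *\<^sub>R t) a) \<partial>lborel)"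
    by (rule functional_kernel_integral[OF k(1) orbit_continuous'(1)[OF a] norm_psi_le L])
  also have "\<dots> = (\<integral>t. of_real (c ^ CARD('d)) * ?g (c *\<^sub>R t) \<partial>lborel)"
    using c by (simp add: dilate_def power_divide mult_ac)
  also have "\<dots> = integral\<^sup>L lborel ?g"
    unfolding integral_mult_right_zero
    using integral_lborel_scale[OF int, of c] c by (simp add: scaleR_conv_of_real[where 'a=complex])
  also have "\<dots> = L (action \<psi> (dilate (s / c) f) a)"
    by (rule functional_action[OF k(2) a L, symmetric])
  finally show "L (integral UNIV (\<lambda>t. dilate s f t *\<^sub>C \<psi> (- c *\<^sub>R t) a)) = L (action \<psi> (dilate (s / c) f) a)" .
qed

lemma integral_kernel_const:
  assumes "kernel f"
  shows "integral UNIV (\<lambda>t. f t *\<^sub>C (a :: 'a)) = (integral\<^sup>L lborel f) *\<^sub>C a"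
proof (rule complex_functionals_separate)
  fix L :: "'a \<Rightarrow> complex" assume L: "complex_functional L"
  have "L (integral UNIV (\<lambda>t. f t *\<^sub>C a)) = (\<integral>t. f t * L a \<partial>lborel)"
    by (rule functional_kernel_integral[OF assms _ _ L, of "\<lambda>_. a" "norm a"]) auto
  also have "\<dots> = L ((integral\<^sup>L lborel f) *\<^sub>C a)"
    using L by (simp add: complex_functional_def)
  finally show "L (integral UNIV (\<lambda>t. f t *\<^sub>C a)) = L ((integral\<^sup>L lborel f) *\<^sub>C a)" .
qed

lemma action_approximate_identity:
  assumes f: "kernel f" "integral\<^sup>L lborel f = 1" and a: "a \<in> continuous_elements \<psi>"
  shows "(\<lambda>n. action \<psi> (dilate (2 ^ n) f) a) \<longlonglongrightarrow> a"
proof -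
  \<comment> \<open>The error integrand after rescaling: the kernel is fixed and the group parameter
    shrinks with n. It is dominated by a multiple of norm (f t) and tends to 0 pointwise by
    continuity of the orbit.\<close>
  define w where "w n t = norm (f t) * norm (\<psi> ((- ((1/2) ^ n)) *\<^sub>R t) a - a)" for n t
  have [measurable]: "f \<in> borel_measurable borel" by (rule kernel_measurable[OF f(1)])
  have fi: "integrable lborel f" using f by (simp add: kernel_def)
  have cont: "continuous_on UNIV (\<lambda>t. norm (\<psi> (c *\<^sub>R t) a - a))" for c
    by (intro continuous_intros orbit_continuous' a)
  have bound: "norm (\<psi> t a - a) \<le> (M + 1) * norm a" for t
    using norm_triangle_ineq4[of "\<psi> t a" a] norm_psi_le[of t a] by (simp add: distrib_right)
  have wm [measurable]: "w n \<in> borel_measurable borel" for n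
  proof -
    have [measurable]: "(\<lambda>t. norm (\<psi> ((- ((1/2) ^ n)) *\<^sub>R t) a - a)) \<in> borel_measurable borel"
      by (rule borel_measurable_continuous_onI[OF cont])
    show ?thesis unfolding w_def by measurable
  qed
  have w_le: "norm (w n t) \<le> norm (f t) * ((M + 1) * norm a)" for n t
    unfolding w_def using bound by (simp add: mult_left_mono)
  have wi: "integrable lborel (w n)" for n
  proof (rule Bochner_Integration.integrable_bound)
    show "integrable lborel (\<lambda>t. norm (f t) * ((M + 1) * norm a))" using fi by auto
    show "AE t in lborel. norm (w n t) \<le> norm (norm (f t) * ((M + 1) * norm a))"
      by (intro AE_I2 order_trans[OF w_le]) simp
  qed measurable
  have le: "norm (action \<psi> (dilate (2 ^ n) f) a - a) \<le> integral\<^sup>L lborel (w n)" for n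
  proof -
    have k: "kernel (dilate (2 ^ n) f)" by (rule kernel_dilate[OF _ f(1)]) simp
    have "integral UNIV (\<lambda>t. dilate (2 ^ n) f t *\<^sub>C a) = a"
      using integral_kernel_const[OF k, of a] f integral_dilate[OF _ fi, of "2 ^ n"] by simp
    then have "action \<psi> (dilate (2 ^ n) f) a - a = integral UNIV (\<lambda>t. dilate (2 ^ n) f t *\<^sub>C (\<psi> (- t) a - a))"
      unfolding action_def scaleC.diff_right
      using action_integrable_on[OF k a] kernel_integrable_on[OF k, of "\<lambda>_. a" "norm a"]
      by (subst Henstock_Kurzweil_Integration.integral_diff) auto
    also have "norm \<dots> \<le> (\<integral>t. (2 ^ n) ^ CARD('d) * w n (2 ^ n *\<^sub>R t) \<partial>lborel)"
    proof (rule norm_kernel_integral_le[OF k _ bound])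
      show "continuous_on UNIV (\<lambda>t. \<psi> (- t) a - a)" by (intro continuous_intros orbit_continuous' a)
      show "integrable lborel (\<lambda>t. (2 ^ n) ^ CARD('d) * w n (2 ^ n *\<^sub>R t))"
        by (intro integrable_mult_right integrable_lborel_scale wi) simp
      show "norm (dilate (2 ^ n) f t) * norm (\<psi> (- t) a - a) \<le> (2 ^ n) ^ CARD('d) * w n (2 ^ n *\<^sub>R t)" for t
        by (simp add: dilate_def w_def norm_mult norm_power power_one_over)
    qed
    also have "\<dots> = integral\<^sup>L lborel (w n)"
      unfolding integral_mult_right_zero using integral_lborel_scale[OF wi[of n], of "2 ^ n"] by simp
    finally show ?thesis .
  qed
  have "(\<lambda>n. integral\<^sup>L lborel (w n)) \<longlonglongrightarrow> (\<integral>(t::real^'d). 0 \<partial>lborel)"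
  proof (rule integral_dominated_convergence[where w="\<lambda>t. norm (f t) * ((M + 1) * norm a)"])
    show "AE t in lborel. (\<lambda>n. w n t) \<longlonglongrightarrow> 0"
    proof (intro AE_I2)
      fix t :: "real^'d"
      have "isCont (\<lambda>t. \<psi> t a) (0 *\<^sub>R t)"
        using orbit_continuous[OF a] by (simp add: continuous_on_eq_continuous_at)
      moreover have "(\<lambda>n. (- ((1/2) ^ n)) *\<^sub>R t) \<longlonglongrightarrow> (- 0) *\<^sub>R t"
        by (intro tendsto_intros LIMSEQ_realpow_zero) auto
      ultimately have "(\<lambda>n. \<psi> ((- ((1/2) ^ n)) *\<^sub>R t) a) \<longlonglongrightarrow> \<psi> (0 *\<^sub>R t) a"
        by (intro isCont_tendsto_compose[of _ "\<lambda>t. \<psi> t a"]) simp_all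
      then have "(\<lambda>n. norm (\<psi> ((- ((1/2) ^ n)) *\<^sub>R t) a - a)) \<longlonglongrightarrow> 0"
        by (intro tendsto_norm_zero) (simp add: LIM_zero_iff)
      then show "(\<lambda>n. w n t) \<longlonglongrightarrow> 0"
        unfolding w_def by (rule tendsto_mult_right_zero)
    qed
  qed (use fi w_le in auto)
  then have "(\<lambda>n. integral\<^sup>L lborel (w n)) \<longlonglongrightarrow> 0" by simp
  then have "(\<lambda>n. norm (action \<psi> (dilate (2 ^ n) f) a - a)) \<longlonglongrightarrow> 0"
    by (rule tendsto_sandwich[OF _ _ tendsto_const, rotated 2]) (use le in auto)
  then show ?thesis by (simp add: tendsto_norm_zero_iff LIM_zero_iff)
qed

end

section \<open>Moduli of smoothness and dyadic blocks\<close>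

lemma l1norm_nonneg: "0 \<le> l1norm t"
  by (simp add: l1norm_def sum_nonneg)

lemma l1norm_scaleR: "l1norm (c *\<^sub>R t) = \<bar>c\<bar> * l1norm t"
  by (simp add: l1norm_def abs_mult sum_distrib_left)

lemma l1norm_minus [simp]: "l1norm (- t) = l1norm t"
  by (simp add: l1norm_def)

lemma l1norm_0 [simp]: "l1norm 0 = 0"
  by (simp add: l1norm_def)

lemma norm_le_l1norm: "norm t \<le> l1norm t"
  unfolding l1norm_def by (rule norm_le_l1_cart)

lemma l1norm_le_norm: "l1norm (t :: real^'d) \<le> real CARD('d) * norm t"
proof -
  have "l1norm t \<le> (\<Sum>j\<in>(UNIV::'d set). norm t)"
    unfolding l1norm_def by (intro sum_mono component_le_norm_cart)
  then show ?thesis by simp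
qed

section \<open>Differences, moduli and Marchaud's descent\<close>

context bounded_group
begin

lemma difference_0 [simp]: "difference \<psi> 0 t a = a"
  by (simp add: difference_def)

lemma difference_Suc: "difference \<psi> (Suc k) t a = \<psi> t (difference \<psi> k t a) - difference \<psi> k t a"
  by (simp add: difference_def)

lemma difference_Suc': "difference \<psi> (Suc k) t a = difference \<psi> k t (\<psi> t a - a)"
  by (simp add: difference_def funpow_Suc_right del: funpow.simps)

lemma psi_difference: "\<psi> s (difference \<psi> k t a) = difference \<psi> k t (\<psi> s a)"
  by (induction k) (simp_all add: difference_Suc psi_diff psi_psi add.commute, metis psi_psi add.commute)

lemma difference_add: "difference \<psi> k t (a + b) = difference \<psi> k t a + difference \<psi> k t b"
  by (induction k) (simp_all add: difference_Suc psi_add)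

lemma difference_zero [simp]: "difference \<psi> k t 0 = 0"
  by (induction k) (simp_all add: difference_Suc)

lemma difference_sum: "difference \<psi> k t (sum f I) = (\<Sum>i\<in>I. difference \<psi> k t (f i))"
  by (induction I rule: infinite_finite_induct) (simp_all add: difference_add)

lemma bounded_linear_difference: "bounded_linear (difference \<psi> k t)"
proof (induction k)
  case 0
  show ?case by (simp add: difference_0[abs_def] bounded_linear_ident)
next
  case (Suc k)
  show ?case unfolding difference_Suc[abs_def]
    by (intro bounded_linear_sub bounded_linear_compose[OF bounded_linear_psi] Suc)
qed

lemma norm_difference_le: "norm (difference \<psi> k t a) \<le> (M + 1) ^ k * norm a"
proof (induction k)
  case (Suc k)
  have "norm (difference \<psi> (Suc k) t a) \<le> M * norm (difference \<psi> k t a) + norm (difference \<psi> k t a)"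
    unfolding difference_Suc by (rule order_trans[OF norm_triangle_ineq4]) (simp add: norm_psi_le)
  also have "\<dots> = (M + 1) * norm (difference \<psi> k t a)" by (simp add: distrib_right)
  also have "\<dots> \<le> (M + 1) * ((M + 1) ^ k * norm a)" using M_pos by (intro mult_left_mono Suc) auto
  finally show ?case by (simp add: mult.assoc)
qed simp

text \<open>The size of \<open>c 0\<close> is recorded because the term j = 0 is the element itself,
  on which averaging over t has no effect.\<close>

lemma difference_expand:
  obtains c :: "nat \<Rightarrow> real" where "\<bar>c 0\<bar> = 1"
    "\<And>t a. difference \<psi> k t a = (\<Sum>j\<le>k. c j *\<^sub>R \<psi> (real j *\<^sub>R t) a)"
proof -
  have "\<exists>c. \<bar>c 0\<bar> = (1::real) \<and> (\<forall>t a. difference \<psi> k t a = (\<Sum>j\<le>k. c j *\<^sub>R \<psi> (real j *\<^sub>R t) a))"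
  proof (induction k)
    case 0
    show ?case by (rule exI[of _ "\<lambda>_. 1"]) simp
  next
    case (Suc k)
    then obtain c where c: "\<bar>c 0\<bar> = (1::real)" "\<And>t a. difference \<psi> k t a = (\<Sum>j\<le>k. c j *\<^sub>R \<psi> (real j *\<^sub>R t) a)" by blast
    \<comment> \<open>Pascal's rule: the shifted coefficients come from applying
      \<open>\<psi> t\<close>, the unshifted ones from the subtraction.\<close>
    define e where "e j = (case j of 0 \<Rightarrow> 0 | Suc i \<Rightarrow> c i) - (if j \<le> k then c j else 0)" for j
    show ?case
    proof (intro exI conjI allI)
      show "\<bar>e 0\<bar> = 1" using c(1) by (simp add: e_def)
      fix t a
      have "(\<Sum>j\<le>Suc k. e j *\<^sub>R \<psi> (real j *\<^sub>R t) a)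
          = (\<Sum>j\<le>Suc k. (case j of 0 \<Rightarrow> 0 | Suc i \<Rightarrow> c i) *\<^sub>R \<psi> (real j *\<^sub>R t) a)
          - (\<Sum>j\<le>Suc k. (if j \<le> k then c j else 0) *\<^sub>R \<psi> (real j *\<^sub>R t) a)"
        by (simp only: e_def scaleR_diff_left sum_subtractf)
      also have "(\<Sum>j\<le>Suc k. (case j of 0 \<Rightarrow> 0 | Suc i \<Rightarrow> c i) *\<^sub>R \<psi> (real j *\<^sub>R t) a)
          = (\<Sum>j\<le>k. c j *\<^sub>R \<psi> (real (Suc j) *\<^sub>R t) a)"
        by (subst sum.atMost_Suc_shift) simp
      also have "\<dots> = \<psi> t (difference \<psi> k t a)"
        by (simp add: c(2) psi_sum psi_scaleR psi_psi scaleR_add_left)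
      also have "(\<Sum>j\<le>Suc k. (if j \<le> k then c j else 0) *\<^sub>R \<psi> (real j *\<^sub>R t) a) = difference \<psi> k t a"
        by (simp add: c(2))
      finally show "difference \<psi> (Suc k) t a = (\<Sum>j\<le>Suc k. e j *\<^sub>R \<psi> (real j *\<^sub>R t) a)"
        by (simp add: difference_Suc)
    qed
  qed
  then show ?thesis using that by blast
qed

lemma modulus_bdd: "bdd_above ((\<lambda>t. norm (difference \<psi> k t a)) ` {t. l1norm t \<le> h})"
  by (rule bdd_aboveI2[of _ _ "(M + 1) ^ k * norm a"]) (rule norm_difference_le)

lemma norm_difference_le_modulus: "l1norm t \<le> h \<Longrightarrow> norm (difference \<psi> k t a) \<le> modulus \<psi> k h a"
  unfolding modulus_def by (rule cSUP_upper[OF _ modulus_bdd]) simp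

lemma modulus_le:
  assumes "0 \<le> h" "\<And>t. l1norm t \<le> h \<Longrightarrow> norm (difference \<psi> k t a) \<le> B"
  shows "modulus \<psi> k h a \<le> B"
  unfolding modulus_def
  by (rule cSUP_least) (use assms in \<open>auto intro!: exI[of _ 0]\<close>)

lemma modulus_nonneg: "0 \<le> h \<Longrightarrow> 0 \<le> modulus \<psi> k h a"
  by (rule order_trans[OF norm_ge_zero norm_difference_le_modulus[of 0]]) simp

lemma modulus_mono: "0 \<le> h \<Longrightarrow> h \<le> h' \<Longrightarrow> modulus \<psi> k h a \<le> modulus \<psi> k h' a"
  by (intro modulus_le norm_difference_le_modulus) auto

text \<open>With T = \<open>\<psi> t\<close>, T^n - 1 is T - 1 times the sum of T^i over i < n. Each
  order of the difference therefore costs a factor n * M.\<close>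

lemma norm_difference_multiple:
  "norm (difference \<psi> k (real n *\<^sub>R t) a) \<le> (real n * M) ^ k * norm (difference \<psi> k t a)"
proof (induction k arbitrary: a)
  case (Suc k)
  define S where "S b = (\<Sum>i<n. \<psi> (real i *\<^sub>R t) b)" for b
  define b where "b = \<psi> t a - a"
  have "S b = (\<Sum>i<n. \<psi> (real (Suc i) *\<^sub>R t) a - \<psi> (real i *\<^sub>R t) a)"
    by (simp add: S_def b_def psi_diff psi_psi scaleR_add_left add.commute)
  also have "\<dots> = \<psi> (real n *\<^sub>R t) a - a"
    by (subst sum_lessThan_telescope) simp
  finally have "difference \<psi> (Suc k) (real n *\<^sub>R t) a = difference \<psi> k (real n *\<^sub>R t) (S b)"
    by (simp add: difference_Suc')
  then have "norm (difference \<psi> (Suc k) (real n *\<^sub>R t) a) \<le> (real n * M) ^ k * norm (difference \<psi> k t (S b))"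
    using Suc.IH[of "S b"] by simp
  also have "difference \<psi> k t (S b) = S (difference \<psi> k t b)"
    by (simp add: S_def difference_sum psi_difference)
  also have "(real n * M) ^ k * norm (S (difference \<psi> k t b)) \<le> (real n * M) ^ k * (\<Sum>i<n. M * norm (difference \<psi> k t b))"
    unfolding S_def using M_pos by (intro mult_left_mono sum_norm_le norm_psi_le) auto
  also have "(\<Sum>i<n. M * norm (difference \<psi> k t b)) = real n * M * norm (difference \<psi> (Suc k) t a)"
    by (simp add: difference_Suc' b_def)
  finally show ?case by (simp add: mult_ac)
qed simp

text \<open>Relative to the modulus at h, differences grow only polynomially in t / h, which a
  rapidly decaying kernel can integrate. The vector t is cut into n equal pieces of length at most
  h, with n the first integer above the quotient.\<close>

lemma norm_difference_le_scaled_modulus: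
  assumes h: "0 < h"
  shows "norm (difference \<psi> k t a) \<le> (M * (1 + l1norm t / h)) ^ k * modulus \<psi> k h a"
proof -
  define n where "n = nat \<lfloor>l1norm t / h\<rfloor> + 1"
  have x0: "0 \<le> l1norm t / h" using l1norm_nonneg[of t] h by (intro divide_nonneg_pos)
  have n: "l1norm t / h < real n" "real n \<le> 1 + l1norm t / h" "0 < real n"
    using x0 by (auto simp: n_def) linarith+
  let ?u = "(1 / real n) *\<^sub>R t"
  have "l1norm ?u \<le> h" using n h by (simp add: l1norm_scaleR field_simps)
  then have u: "norm (difference \<psi> k ?u a) \<le> modulus \<psi> k h a" by (rule norm_difference_le_modulus)
  have "norm (difference \<psi> k t a) = norm (difference \<psi> k (real n *\<^sub>R ?u) a)" using n by simp
  also have "\<dots> \<le> (real n * M) ^ k * norm (difference \<psi> k ?u a)" by (rule norm_difference_multiple)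
  also have "\<dots> \<le> (M * (1 + l1norm t / h)) ^ k * modulus \<psi> k h a"
    using n M_pos u by (subst mult.commute[of "real n"], intro mult_mono power_mono) auto
  finally show ?thesis .
qed

text \<open>With \<open>T = \<psi> t\<close> one has \<open>(T\<^sup>2 - 1)\<^sup>k = (T + 1)\<^sup>k (T - 1)\<^sup>k\<close>, and \<open>(T + 1)\<^sup>k - 2\<^sup>k\<close> is divisible by
  \<open>T - 1\<close>. This is the step of Marchaud's inequality.\<close>

lemma modulus_doubling:
  obtains C where "0 \<le> C"
    "\<And>h a. 0 \<le> h \<Longrightarrow> 2 ^ k * modulus \<psi> k h a \<le> modulus \<psi> k (2 * h) a + C * modulus \<psi> (Suc k) h a"
proof -
  define P where "P t c = \<psi> t c + c" for t c
  have P_norm: "norm (P t c) \<le> (M + 1) * norm c" for t c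
    unfolding P_def using norm_triangle_ineq[of "\<psi> t c" c] norm_psi_le[of t c] by (simp add: distrib_right)
  have P_diff: "P t c - P t d = P t (c - d)" for t c d by (simp add: P_def psi_diff)
  have P_scale: "P t (x *\<^sub>R c) = x *\<^sub>R P t c" for t c x by (simp add: P_def psi_scaleR scaleR_add_right)
  have factor: "difference \<psi> j (2 *\<^sub>R t) a = (P t ^^ j) (difference \<psi> j t a)" for j t a
  proof (induction j arbitrary: a)
    case (Suc j)
    have comm: "difference \<psi> j t (P t b) = P t (difference \<psi> j t b)" for b
      by (simp add: P_def difference_add psi_difference)
    have "\<psi> (2 *\<^sub>R t) a - a = P t (\<psi> t a - a)"
      by (simp add: P_def psi_diff psi_psi scaleR_2)
    then have "difference \<psi> (Suc j) (2 *\<^sub>R t) a = (P t ^^ j) (difference \<psi> j t (P t (\<psi> t a - a)))"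
      by (simp add: difference_Suc' Suc.IH)
    also have "\<dots> = (P t ^^ Suc j) (difference \<psi> (Suc j) t a)"
      by (simp add: comm difference_Suc' funpow_Suc_right del: funpow.simps)
    finally show ?case .
  qed simp
  \<comment> \<open>Divisibility of (T + 1)^j - 2^j by T - 1, recorded as a norm estimate. The
    constant obeys the recursion C to (M + 1) * C + 2^j.\<close>
  have "\<exists>C\<ge>0. \<forall>t c. norm ((P t ^^ j) c - 2 ^ j *\<^sub>R c) \<le> C * norm (\<psi> t c - c)" for j
  proof (induction j)
    case 0
    show ?case by (rule exI[of _ 0]) simp
  next
    case (Suc j)
    then obtain C where C: "0 \<le> C" "\<And>t c. norm ((P t ^^ j) c - 2 ^ j *\<^sub>R c) \<le> C * norm (\<psi> t c - c)" by blast
    show ?case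
    proof (intro exI[of _ "(M + 1) * C + 2 ^ j"] conjI allI)
      show "0 \<le> (M + 1) * C + 2 ^ j" using C M_pos by simp
      fix t c
      have "(P t ^^ Suc j) c - 2 ^ Suc j *\<^sub>R c = P t ((P t ^^ j) c - 2 ^ j *\<^sub>R c) + 2 ^ j *\<^sub>R (\<psi> t c - c)"
        by (simp add: P_diff[symmetric] P_scale) (simp add: P_def algebra_simps scaleR_2 flip: scaleR_scaleR)
      also have "norm \<dots> \<le> (M + 1) * (C * norm (\<psi> t c - c)) + 2 ^ j * norm (\<psi> t c - c)"
        using M_pos
        by (intro order_trans[OF norm_triangle_ineq] add_mono order_trans[OF P_norm] mult_left_mono C) auto
      finally show "norm ((P t ^^ Suc j) c - 2 ^ Suc j *\<^sub>R c) \<le> ((M + 1) * C + 2 ^ j) * norm (\<psi> t c - c)"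
        by (simp add: algebra_simps)
    qed
  qed
  then obtain C where C: "0 \<le> C" "\<And>t c. norm ((P t ^^ k) c - 2 ^ k *\<^sub>R c) \<le> C * norm (\<psi> t c - c)" by blast
  show ?thesis
  proof (rule that[OF C(1)])
    fix h a assume h: "(0::real) \<le> h"
    have "modulus \<psi> k h a \<le> (modulus \<psi> k (2 * h) a + C * modulus \<psi> (Suc k) h a) / 2 ^ k"
    proof (rule modulus_le[OF h])
      fix t :: "real^'d" assume t: "l1norm t \<le> h"
      let ?c = "difference \<psi> k t a"
      have "2 ^ k * norm ?c \<le> norm ((P t ^^ k) ?c) + norm ((P t ^^ k) ?c - 2 ^ k *\<^sub>R ?c)"
        using norm_triangle_ineq4[of "(P t ^^ k) ?c" "(P t ^^ k) ?c - 2 ^ k *\<^sub>R ?c"] by simp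
      also have "\<dots> \<le> norm (difference \<psi> k (2 *\<^sub>R t) a) + C * norm (difference \<psi> (Suc k) t a)"
        using C(2)[of t ?c] by (simp add: factor difference_Suc)
      also have "\<dots> \<le> modulus \<psi> k (2 * h) a + C * modulus \<psi> (Suc k) h a"
        using t C(1) by (intro add_mono mult_left_mono norm_difference_le_modulus) (auto simp: l1norm_scaleR)
      finally show "norm ?c \<le> (modulus \<psi> k (2 * h) a + C * modulus \<psi> (Suc k) h a) / 2 ^ k"
        by (simp add: field_simps)
    qed
    then show "2 ^ k * modulus \<psi> k h a \<le> modulus \<psi> k (2 * h) a + C * modulus \<psi> (Suc k) h a"
      by (simp add: field_simps)
  qed
qed

text \<open>Let L be the infimum of the modulus of order k over h > 0. For small h the doubling
  inequality gives 2 L \<le> L + 2 d with arbitrary d > 0, hence L = 0; the factor 2 on the left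
  comes from k \<ge> 1.\<close>

lemma modulus_small_descend:
  assumes k: "1 \<le> k" and small: "\<And>e. 0 < e \<Longrightarrow> \<exists>h>0. modulus \<psi> (Suc k) h a \<le> e" and e: "0 < e"
  shows "\<exists>h>0. modulus \<psi> k h a \<le> e"
proof -
  obtain C where C: "0 \<le> C"
    "\<And>h a. 0 \<le> h \<Longrightarrow> 2 ^ k * modulus \<psi> k h a \<le> modulus \<psi> k (2 * h) a + C * modulus \<psi> (Suc k) h a"
    by (rule modulus_doubling) blast
  define L where "L = (INF h\<in>{0<..}. modulus \<psi> k h a)"
  have bdd: "bdd_below ((\<lambda>h. modulus \<psi> k h a) ` {0<..})"
    by (rule bdd_belowI2[of _ 0]) (simp add: modulus_nonneg)
  have L: "L \<le> modulus \<psi> k h a" if "0 < h" for h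
    unfolding L_def by (rule cINF_lower[OF bdd]) (use that in simp)
  have L0: "0 \<le> L" unfolding L_def by (rule cINF_greatest) (auto intro: modulus_nonneg)
  have "L \<le> 3 * d" if d: "0 < d" for d
  proof -
    have "\<exists>h\<in>{0<..}. modulus \<psi> k h a < L + d"
      using cINF_less_iff[of "{0<..}" "\<lambda>h. modulus \<psi> k h a" "L + d"] bdd d by (auto simp: L_def)
    then obtain h1 where h1: "0 < h1" "modulus \<psi> k h1 a < L + d" by auto
    obtain h2 where h2: "0 < h2" "modulus \<psi> (Suc k) h2 a \<le> d / (C + 1)"
      using small[of "d / (C + 1)"] C d by auto
    define h where "h = min (h1 / 2) h2"
    have h: "0 < h" using h1 h2 by (simp add: h_def)
    have "modulus \<psi> k (2 * h) a \<le> L + d"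
    proof -
      have "2 * h \<le> h1" by (simp add: h_def min_def)
      with modulus_mono[of "2 * h" h1 k a] h h1 show ?thesis by simp
    qed
    moreover have "C * modulus \<psi> (Suc k) h a \<le> d"
    proof -
      have "modulus \<psi> (Suc k) h a \<le> d / (C + 1)"
        using modulus_mono[of h h2 "Suc k" a] h h2 by (simp add: h_def)
      then have "C * modulus \<psi> (Suc k) h a \<le> C * (d / (C + 1))" using C by (intro mult_left_mono) auto
      also have "\<dots> \<le> d" using C d by (simp add: field_simps)
      finally show ?thesis .
    qed
    moreover have "2 * L \<le> 2 ^ k * modulus \<psi> k h a"
      using L[OF h] L0 k power_increasing[of 1 k "2::real"] by (intro mult_mono) auto
    ultimately have "2 * L \<le> L + d + d" using C(2)[of h a] h by linarith
    then show ?thesis using d by linarith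
  qed
  from this[of "e / 6"] have "L \<le> e / 2" using e by simp
  then have "L < e" using e by linarith
  then have "\<exists>h\<in>{0<..}. modulus \<psi> k h a < e"
    unfolding L_def using cINF_less_iff[of "{0<..}" "\<lambda>h. modulus \<psi> k h a" e] bdd by auto
  then show ?thesis by (meson greaterThan_iff less_imp_le)
qed

text \<open>Smallness descends to order 1, where it is continuity of the orbit at 0, since
  \<open>l1norm\<close> is bounded by a multiple of the Euclidean norm.\<close>

lemma continuous_elements_of_modulus:
  assumes "1 \<le> k" "\<And>e. 0 < e \<Longrightarrow> \<exists>h>0. modulus \<psi> k h a \<le> e"
  shows "a \<in> continuous_elements \<psi>"
  using assms
proof (induction k rule: dec_induct)
  case base
  show ?case
    unfolding continuous_elements_def mem_Collect_eq tendsto_iff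
  proof (intro allI impI)
    fix e :: real assume e: "0 < e"
    obtain h where h: "0 < h" "modulus \<psi> 1 h a \<le> e / 2" using base[of "e / 2"] e by auto
    have "norm (\<psi> t a - a) < e" if "dist t 0 < h / real CARD('d)" for t
    proof -
      have "l1norm t \<le> real CARD('d) * norm t" by (rule l1norm_le_norm)
      also have "\<dots> \<le> h" using that by (simp add: field_simps)
      finally have "norm (difference \<psi> 1 t a) \<le> modulus \<psi> 1 h a" by (rule norm_difference_le_modulus)
      then show ?thesis using h e by (simp add: difference_Suc)
    qed
    then show "\<forall>\<^sub>F t in at 0. dist (norm (\<psi> t a - a)) 0 < e"
      unfolding eventually_at using h by (intro exI[of _ "h / real CARD('d)"]) auto
  qed
next
  case (step k)
  show ?case
    by (rule step.IH) (rule modulus_small_descend[OF step.hyps(1) step.prems])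
qed

end

section \<open>Dyadic blocks: direct estimate and Bernstein's inequality\<close>

locale littlewood_paley = bounded_group \<psi> + dyadic_partition \<phi>
  for \<psi> :: "real^'d \<Rightarrow> 'a::complex_banach_algebra \<Rightarrow> 'a" and \<phi> :: "real^'d \<Rightarrow> complex"
begin

definition partial :: "nat \<Rightarrow> 'a \<Rightarrow> 'a" where
  "partial n = action \<psi> (dilate (2 ^ n) low_pass)"

text \<open>Block n has dyadic index n - 1, so that counting starts at 0 and the blocks up to n add
  up to \<open>partial n\<close>.\<close>

definition block :: "nat \<Rightarrow> 'a \<Rightarrow> 'a" where
  "block n = action \<psi> (dyadic_function \<phi> (int n - 1))"

definition mass :: real where
  "mass = (\<integral>x. norm (low_pass x) \<partial>lborel)"

lemma mass_nonneg: "0 \<le> mass"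
  unfolding mass_def by (intro integral_nonneg_AE AE_I2) auto

lemma kernel_low_pass: "kernel low_pass"
  by (simp add: kernel_def continuous_low_pass integrable_low_pass)

lemma kernel_dilate_low_pass: "0 < s \<Longrightarrow> kernel (dilate s low_pass)"
  by (rule kernel_dilate[OF _ kernel_low_pass])

lemma block_0: "block 0 = partial 0"
  by (simp add: block_def partial_def dyadic_function_low dilate_def[abs_def])

lemma block_Suc:
  assumes "a \<in> continuous_elements \<psi>"
  shows "block (Suc n) a = partial (Suc n) a - partial n a"
  unfolding block_def partial_def using assms
  by (simp add: dyadic_function_eq action_kernel_diff kernel_dilate_low_pass)

lemma sum_block: "a \<in> continuous_elements \<psi> \<Longrightarrow> (\<Sum>i<Suc n. block i a) = partial n a"
  by (induction n) (simp_all add: block_0 block_Suc)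

lemma block_sums:
  assumes a: "a \<in> continuous_elements \<psi>"
  shows "(\<lambda>n. block n a) sums a"
proof -
  have "(\<lambda>n. partial n a) \<longlonglongrightarrow> a"
    unfolding partial_def by (rule action_approximate_identity[OF kernel_low_pass integral_low_pass a])
  then have "(\<lambda>n. \<Sum>i<Suc n. block i a) \<longlonglongrightarrow> a" by (simp only: sum_block[OF a])
  then show ?thesis unfolding sums_def by (rule LIMSEQ_imp_Suc)
qed

lemma continuous_elements_partial: "a \<in> continuous_elements \<psi> \<Longrightarrow> partial n a \<in> continuous_elements \<psi>"
  unfolding partial_def by (rule continuous_elements_action) (simp_all add: kernel_dilate_low_pass)

lemma continuous_elements_block: "a \<in> continuous_elements \<psi> \<Longrightarrow> block n a \<in> continuous_elements \<psi>"
  by (cases n) (simp_all add: block_0 block_Suc continuous_elements_diff continuous_elements_partial)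

lemma norm_partial_le: "a \<in> continuous_elements \<psi> \<Longrightarrow> norm (partial n a) \<le> M * mass * norm a"
  unfolding partial_def mass_def
  using norm_action_le[OF kernel_dilate_low_pass, of "2 ^ n" a] integral_norm_dilate[OF _ integrable_low_pass, of "2 ^ n"]
  by simp

lemma block_add:
  "a \<in> continuous_elements \<psi> \<Longrightarrow> b \<in> continuous_elements \<psi> \<Longrightarrow> block n (a + b) = block n a + block n b"
  by (cases n) (simp_all add: block_0 block_Suc continuous_elements_add partial_def action_add kernel_dilate_low_pass)

lemma block_scaleC: "a \<in> continuous_elements \<psi> \<Longrightarrow> block n (c *\<^sub>C a) = c *\<^sub>C block n a"
  by (cases n) (simp_all add: block_0 block_Suc continuous_elements_scaleC partial_def action_scaleC
      kernel_dilate_low_pass scaleC.diff_right)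

lemma action_low_pass_absorb:
  assumes "a \<in> continuous_elements \<psi>" "0 < s" "4 * s \<le> s'"
  shows "action \<psi> (dilate s' low_pass) (action \<psi> (dilate s low_pass) a) = action \<psi> (dilate s low_pass) a"
  using assms
  by (intro action_action kernel_dilate_low_pass convolution_low_pass) auto

text \<open>Block n is built from kernels of scale at most 2^n, and 2^(n + 2) is four times that,
  the gap required by the reproducing identity.\<close>

lemma action_block:
  assumes "a \<in> continuous_elements \<psi>"
  shows "action \<psi> (dilate (2 ^ (n + 2)) low_pass) (block n a) = block n a"
proof (cases n)
  case 0
  then show ?thesis using assms by (simp add: block_0 partial_def action_low_pass_absorb)
next
  case (Suc m)
  have "kernel (dilate (2 ^ (n + 2)) low_pass)" by (simp add: kernel_dilate_low_pass)
  then show ?thesis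
    using assms
    by (simp add: Suc block_Suc action_diff continuous_elements_partial)
       (simp add: partial_def action_low_pass_absorb)
qed

text \<open>Averaging the differences \<open>difference \<psi> l (- t) a\<close> against the dilated low-pass kernel reproduces \<open>a\<close> up to
  sign and up to elements of frequency at most \<open>2 ^ m / 4\<close>, which the block at \<open>2 ^ m\<close> does not see.\<close>

lemma block_le_modulus:
  obtains C where "0 \<le> C"
    "\<And>a m. a \<in> continuous_elements \<psi> \<Longrightarrow> norm (block (Suc m) a) \<le> C * modulus \<psi> l ((1/2) ^ m) a"
proof -
  \<comment> \<open>With s = 2^m / 4 below, 2^m * l1norm t = 4 * s * l1norm t, and l1norm is at most
    the dimension times the Euclidean norm.\<close>
  define D where "D = 4 * real CARD('d) * M"
  define E where "E = (\<integral>x. (1 + norm x) ^ l * norm (low_pass x) \<partial>lborel)"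
  obtain c where c0: "\<bar>c 0\<bar> = 1"
    and c: "\<And>t a. difference \<psi> l t a = (\<Sum>j\<le>l. c j *\<^sub>R \<psi> (real j *\<^sub>R t) a)"
    by (rule difference_expand[of l]) blast
  have D0: "0 \<le> D" using M_pos by (simp add: D_def)
  have E0: "0 \<le> E" unfolding E_def by (intro integral_nonneg_AE AE_I2) auto
  show ?thesis
  proof
    show "0 \<le> 2 * M * mass * (D ^ l * E)" using M_pos mass_nonneg D0 E0 by simp
    fix a m assume a: "a \<in> continuous_elements \<psi>"
    \<comment> \<open>A quarter of 2^m, so that the low-pass averages at scales 2^m and 2^(m + 1)
      both reproduce whatever has scale at most s.\<close>
    define s :: real where "s = 2 ^ m / 4"
    have s: "0 < s" by (simp add: s_def)
    define w where "w = modulus \<psi> l ((1/2) ^ m) a"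
    have w0: "0 \<le> w" unfolding w_def by (rule modulus_nonneg) simp
    let ?k = "dilate s low_pass"
    have k: "kernel ?k" by (rule kernel_dilate_low_pass[OF s])
    define v where "v = integral UNIV (\<lambda>t. ?k t *\<^sub>C difference \<psi> l (- t) a)"
    have cont: "continuous_on UNIV (\<lambda>t. difference \<psi> l (- t) a)"
    proof -
      have "continuous_on UNIV (\<lambda>t. \<Sum>j\<le>l. c j *\<^sub>R \<psi> ((- real j) *\<^sub>R t) a)"
        by (intro continuous_intros orbit_continuous'(1) a)
      then show ?thesis by (simp add: c)
    qed
    \<comment> \<open>The polynomial growth of the differences is paid for by the l-th moment
      \<open>E\<close> of the kernel; rescaling by s removes the dependence on m from the
      constants.\<close>
    have v_norm: "norm v \<le> D ^ l * E * w"
    proof -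
      let ?G = "\<lambda>x. D ^ l * w * ((1 + norm x) ^ l * norm (low_pass x))"
      have G: "integrable lborel ?G" by (intro integrable_mult_right integrable_low_pass_moment)
      have "norm v \<le> (\<integral>t. s ^ CARD('d) * ?G (s *\<^sub>R t) \<partial>lborel)"
        unfolding v_def
      proof (rule norm_kernel_integral_le[OF k cont norm_difference_le])
        show "integrable lborel (\<lambda>t. s ^ CARD('d) * ?G (s *\<^sub>R t))"
          using s by (intro integrable_mult_right integrable_lborel_scale[OF G]) auto
        fix t :: "real^'d"
        have "norm (difference \<psi> l (- t) a) \<le> (M * (1 + l1norm t / (1/2) ^ m)) ^ l * w"
          using norm_difference_le_scaled_modulus[of "(1/2) ^ m" l "- t" a] by (simp add: w_def)
        also have "\<dots> \<le> (D * (1 + norm (s *\<^sub>R t))) ^ l * w"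
        proof (intro mult_right_mono power_mono w0)
          have "l1norm t / (1/2) ^ m = 4 * (s * l1norm t)" by (simp add: s_def power_one_over)
          also have "\<dots> \<le> 4 * (s * (real CARD('d) * norm t))"
            using s l1norm_le_norm[of t] by (intro mult_left_mono) auto
          also have "\<dots> = 4 * real CARD('d) * norm (s *\<^sub>R t)" using s by simp
          finally have "1 + l1norm t / (1/2) ^ m \<le> 4 * real CARD('d) * (1 + norm (s *\<^sub>R t))"
            using of_nat_0_less_iff[of "CARD('d)", where 'a=real] zero_less_card_finite[where 'a='d]
            by (simp only: distrib_left)
          then have "M * (1 + l1norm t / (1/2) ^ m) \<le> M * (4 * real CARD('d) * (1 + norm (s *\<^sub>R t)))"
            using M_pos by (intro mult_left_mono) auto
          then show "M * (1 + l1norm t / (1/2) ^ m) \<le> D * (1 + norm (s *\<^sub>R t))" by (simp add: D_def mult_ac)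
          show "0 \<le> M * (1 + l1norm t / (1/2) ^ m)" using M_nonneg l1norm_nonneg[of t]
            by (intro mult_nonneg_nonneg add_nonneg_nonneg divide_nonneg_nonneg) auto
        qed
        finally have "norm (?k t) * norm (difference \<psi> l (- t) a) \<le> norm (?k t) * ((D * (1 + norm (s *\<^sub>R t))) ^ l * w)"
          by (rule mult_left_mono) simp
        also have "\<dots> = s ^ CARD('d) * ?G (s *\<^sub>R t)"
          using s by (simp add: dilate_def norm_mult norm_power power_mult_distrib mult_ac)
        finally show "norm (?k t) * norm (difference \<psi> l (- t) a) \<le> s ^ CARD('d) * ?G (s *\<^sub>R t)" .
      qed
      also have "\<dots> = integral\<^sup>L lborel ?G"
        unfolding integral_mult_right_zero[of _ "s ^ CARD('d)"]
        using integral_lborel_scale[OF G, of s] s by simp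
      also have "\<dots> = D ^ l * E * w" by (simp add: E_def)
      finally show ?thesis .
    qed
    \<comment> \<open>The contribution of the j-th term of the difference, whose scale s / j does
      not exceed s.\<close>
    define u where "u j = action \<psi> (dilate (s / real j) low_pass) a" for j
    have u: "u j \<in> continuous_elements \<psi>" if "0 < j" for j
      unfolding u_def using that s by (intro continuous_elements_action kernel_dilate_low_pass a) simp
    have v_eq: "v = c 0 *\<^sub>R a + (\<Sum>j\<in>{1..l}. c j *\<^sub>R u j)"
    proof -
      have i: "(\<lambda>t. c j *\<^sub>R (?k t *\<^sub>C \<psi> (- real j *\<^sub>R t) a)) integrable_on UNIV" for j
        by (intro integrable_cmul kernel_integrable_on[OF k orbit_continuous'(1)[OF a] norm_psi_le])
      have "v = integral UNIV (\<lambda>t. \<Sum>j\<le>l. c j *\<^sub>R (?k t *\<^sub>C \<psi> (- real j *\<^sub>R t) a))"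
        unfolding v_def c by (simp add: scaleC.sum_right scaleC.scaleR_right)
      also have "\<dots> = (\<Sum>j\<le>l. integral UNIV (\<lambda>t. c j *\<^sub>R (?k t *\<^sub>C \<psi> (- real j *\<^sub>R t) a)))"
        by (rule Henstock_Kurzweil_Integration.integral_sum) (use i in auto)
      also have "\<dots> = (\<Sum>j\<le>l. c j *\<^sub>R integral UNIV (\<lambda>t. ?k t *\<^sub>C \<psi> (- real j *\<^sub>R t) a))"
        by (simp only: integral_cmul)
      also have "{..l} = insert 0 {1..l}" by auto
      also have "(\<Sum>j\<in>insert 0 {1..l}. c j *\<^sub>R integral UNIV (\<lambda>t. ?k t *\<^sub>C \<psi> (- real j *\<^sub>R t) a))
          = c 0 *\<^sub>R integral UNIV (\<lambda>t. ?k t *\<^sub>C a) + (\<Sum>j\<in>{1..l}. c j *\<^sub>R integral UNIV (\<lambda>t. ?k t *\<^sub>C \<psi> (- real j *\<^sub>R t) a))"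
        by simp
      also have "integral UNIV (\<lambda>t. ?k t *\<^sub>C a) = a"
        using integral_kernel_const[OF k, of a] integral_dilate[OF s integrable_low_pass] integral_low_pass by simp
      also have "(\<Sum>j\<in>{1..l}. c j *\<^sub>R integral UNIV (\<lambda>t. ?k t *\<^sub>C \<psi> (- real j *\<^sub>R t) a)) = (\<Sum>j\<in>{1..l}. c j *\<^sub>R u j)"
        unfolding u_def
        by (intro sum.cong refl arg_cong2[where f=scaleR] integral_dilate_orbit kernel_low_pass a s) simp
      finally show ?thesis .
    qed
    have vC: "v \<in> continuous_elements \<psi>"
      unfolding v_eq
      by (intro continuous_elements_add continuous_elements_scaleR continuous_elements_sum a u) auto
    have absorb: "partial (m + i) v = c 0 *\<^sub>R partial (m + i) a + (\<Sum>j\<in>{1..l}. c j *\<^sub>R u j)" for i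
    proof -
      let ?p = "dilate (2 ^ (m + i)) low_pass"
      have kp: "kernel ?p" by (rule kernel_dilate_low_pass) simp
      have fix_u: "action \<psi> ?p (u j) = u j" if "j \<in> {1..l}" for j
        unfolding u_def
      proof (rule action_low_pass_absorb[OF a])
        show "0 < s / real j" using s that by simp
        have "4 * (s / real j) \<le> 4 * s" using s that by (simp add: field_simps)
        also have "\<dots> \<le> 2 ^ (m + i)" by (simp add: s_def)
        finally show "4 * (s / real j) \<le> 2 ^ (m + i)" .
      qed
      have uC: "c j *\<^sub>R u j \<in> continuous_elements \<psi>" if "j \<in> {1..l}" for j
        using that by (intro continuous_elements_scaleR u) simp
      have "action \<psi> ?p (\<Sum>j\<in>{1..l}. c j *\<^sub>R u j) = (\<Sum>j\<in>{1..l}. action \<psi> ?p (c j *\<^sub>R u j))"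
        by (rule action_sum[OF kp uC])
      also have "\<dots> = (\<Sum>j\<in>{1..l}. c j *\<^sub>R u j)"
        by (intro sum.cong refl, subst action_scaleR[OF kp u]) (auto simp: fix_u)
      finally show ?thesis
        unfolding partial_def v_eq
        by (simp only: action_add[OF kp continuous_elements_scaleR[OF a] continuous_elements_sum[OF uC]] action_scaleR[OF kp a])
    qed
    \<comment> \<open>Both partial sums fix every \<open>u j\<close>, so these terms cancel in the
      difference that forms the block.\<close>
    have "c 0 *\<^sub>R block (Suc m) a = partial (Suc m) v - partial m v"
      using absorb[of 0] absorb[of 1] by (simp add: block_Suc a scaleR_diff_right)
    then have "norm (block (Suc m) a) = norm (partial (Suc m) v - partial m v)"
      using c0 by (metis mult_1 norm_scaleR)
    also have "\<dots> \<le> M * mass * norm v + M * mass * norm v"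
      by (intro order_trans[OF norm_triangle_ineq4] add_mono norm_partial_le vC)
    also have "\<dots> = 2 * M * mass * norm v" by simp
    also have "\<dots> \<le> 2 * M * mass * (D ^ l * E * w)"
      using M_pos mass_nonneg by (intro mult_left_mono v_norm) auto
    finally show "norm (block (Suc m) a) \<le> 2 * M * mass * (D ^ l * E) * modulus \<psi> l ((1/2) ^ m) a"
      by (simp add: w_def mult_ac)
  qed
qed

text \<open>A difference of a reproduced element is the action of a difference of translated
  kernels, whose L^1 size is the translation error. The result is reproduced by the same kernel, so
  the step can be iterated k times.\<close>

lemma difference_block_le:
  obtains C where "0 \<le> C"
    "\<And>a n k t. a \<in> continuous_elements \<psi> \<Longrightarrow>
      norm (difference \<psi> k t (block n a)) \<le> (C * (2 ^ n * l1norm t)) ^ k * norm (block n a)"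
proof -
  obtain A where A: "0 \<le> A" "\<And>u. translation_error low_pass u \<le> A * norm u"
    by (rule low_pass_translation_error) blast
  \<comment> \<open>The 4 is the ratio of the reproducing scale 2^(n + 2) to 2^n.\<close>
  define C where "C = 4 * M * A"
  show ?thesis
  proof (rule that)
    show "0 \<le> C" using A M_pos by (simp add: C_def)
    fix a n k and t :: "real^'d" assume a: "a \<in> continuous_elements \<psi>"
    define s :: real where "s = 2 ^ (n + 2)"
    have s: "0 < s" by (simp add: s_def)
    have K: "kernel (dilate s low_pass)" by (rule kernel_dilate_low_pass[OF s])
    have step: "norm (\<psi> t b - b) \<le> C * (2 ^ n * l1norm t) * norm b \<and> \<psi> t b - b \<in> continuous_elements \<psi>
      \<and> action \<psi> (dilate s low_pass) (\<psi> t b - b) = \<psi> t b - b"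
      if b: "b \<in> continuous_elements \<psi>" "action \<psi> (dilate s low_pass) b = b" for b
    proof (intro conjI)
      let ?f = "\<lambda>x. dilate s low_pass (x + t) - dilate s low_pass x"
      have Kt: "kernel (\<lambda>x. dilate s low_pass (x + t))" by (rule kernel_translate[OF K])
      have Kf: "kernel ?f" using K Kt by (auto simp: kernel_def intro!: continuous_intros)
      have "\<psi> t b - b = action \<psi> ?f b"
        using psi_action[OF K b(1), of t] action_psi_translate[OF K b(1), of t] action_kernel_diff[OF Kt K b(1)] b(2)
        by simp
      then have "norm (\<psi> t b - b) \<le> M * translation_error (dilate s low_pass) t * norm b"
        using norm_action_le[OF Kf b(1)] by (simp add: translation_error_def)
      also have "translation_error (dilate s low_pass) t = translation_error low_pass (s *\<^sub>R t)"
        by (rule translation_error_dilate[OF s integrable_low_pass])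
      also have "M * translation_error low_pass (s *\<^sub>R t) * norm b \<le> M * (A * (s * l1norm t)) * norm b"
      proof (intro mult_right_mono mult_left_mono M_nonneg norm_ge_zero)
        have "translation_error low_pass (s *\<^sub>R t) \<le> A * norm (s *\<^sub>R t)" by (rule A)
        also have "\<dots> \<le> A * (s * l1norm t)" using A s norm_le_l1norm[of t] by (intro mult_left_mono) (auto intro!: mult_left_mono)
        finally show "translation_error low_pass (s *\<^sub>R t) \<le> A * (s * l1norm t)" .
      qed
      also have "\<dots> = C * (2 ^ n * l1norm t) * norm b" by (simp add: C_def s_def)
      finally show "norm (\<psi> t b - b) \<le> C * (2 ^ n * l1norm t) * norm b" .
      show "\<psi> t b - b \<in> continuous_elements \<psi>" using b by (intro continuous_elements_diff continuous_elements_psi)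
      show "action \<psi> (dilate s low_pass) (\<psi> t b - b) = \<psi> t b - b"
        using b by (simp add: action_diff[OF K] continuous_elements_psi psi_action[OF K, symmetric])
    qed
    have "norm (difference \<psi> k t b) \<le> (C * (2 ^ n * l1norm t)) ^ k * norm b"
      if "b \<in> continuous_elements \<psi>" "action \<psi> (dilate s low_pass) b = b" for b
      using that
    proof (induction k arbitrary: b)
      case (Suc k)
      note st = step[OF Suc.prems]
      have "norm (difference \<psi> (Suc k) t b) \<le> (C * (2 ^ n * l1norm t)) ^ k * norm (\<psi> t b - b)"
        unfolding difference_Suc' using st by (intro Suc.IH) auto
      also have "\<dots> \<le> (C * (2 ^ n * l1norm t)) ^ k * (C * (2 ^ n * l1norm t) * norm b)"
        using st \<open>0 \<le> C\<close> l1norm_nonneg[of t] by (intro mult_left_mono) auto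
      finally show ?case by (simp add: mult_ac)
    qed simp
    from this[of "block n a"] show "norm (difference \<psi> k t (block n a)) \<le> (C * (2 ^ n * l1norm t)) ^ k * norm (block n a)"
      using continuous_elements_block[OF a] action_block[OF a] by (simp add: s_def)
  qed
qed

text \<open>Blocks with 2^n * h \<ge> 1 are estimated trivially, the others by Bernstein. The
  minimum of both is what keeps the sum over n under control at either end.\<close>

lemma modulus_block_le:
  obtains C where "0 < C"
    "\<And>a n h. a \<in> continuous_elements \<psi> \<Longrightarrow> 0 \<le> h \<Longrightarrow>
      modulus \<psi> l h (block n a) \<le> C * (min 1 ((2 ^ n * h) ^ l) * norm (block n a))"
proof -
  obtain C where C: "0 \<le> C"
    "\<And>a n k t. a \<in> continuous_elements \<psi> \<Longrightarrow>
      norm (difference \<psi> k t (block n a)) \<le> (C * (2 ^ n * l1norm t)) ^ k * norm (block n a)"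
    by (rule difference_block_le) blast
  define D where "D = (M + 1) ^ l + C ^ l"
  have D: "0 < (M + 1) ^ l" "0 \<le> C ^ l" using M_pos C by auto
  show ?thesis
  proof (rule that[of D])
    show "0 < D" using D by (simp add: D_def)
    fix a n and h :: real assume a: "a \<in> continuous_elements \<psi>" and h: "0 \<le> h"
    show "modulus \<psi> l h (block n a) \<le> D * (min 1 ((2 ^ n * h) ^ l) * norm (block n a))"
    proof (rule modulus_le[OF h])
      fix t :: "real^'d" assume t: "l1norm t \<le> h"
      have "norm (difference \<psi> l t (block n a)) \<le> D * (1 * norm (block n a))"
      proof -
        have "(M + 1) ^ l * norm (block n a) \<le> D * norm (block n a)" using D by (intro mult_right_mono) (auto simp: D_def)
        then show ?thesis using norm_difference_le[of l t "block n a"] by simp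
      qed
      moreover have "norm (difference \<psi> l t (block n a)) \<le> D * ((2 ^ n * h) ^ l * norm (block n a))"
      proof -
        have "norm (difference \<psi> l t (block n a)) \<le> (C * (2 ^ n * l1norm t)) ^ l * norm (block n a)" by (rule C(2)[OF a])
        also have "\<dots> \<le> (C * (2 ^ n * h)) ^ l * norm (block n a)"
          using t C(1) l1norm_nonneg[of t] by (intro mult_right_mono power_mono mult_left_mono) auto
        also have "\<dots> = C ^ l * ((2 ^ n * h) ^ l * norm (block n a))" by (simp add: power_mult_distrib)
        also have "\<dots> \<le> D * ((2 ^ n * h) ^ l * norm (block n a))"
          using D h by (intro mult_right_mono) (auto simp: D_def)
        finally show ?thesis .
      qed
      ultimately show "norm (difference \<psi> l t (block n a)) \<le> D * (min 1 ((2 ^ n * h) ^ l) * norm (block n a))"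
        by (simp add: min_def)
    qed
  qed
qed

lemma norm_le_suminf_block:
  assumes a: "a \<in> continuous_elements \<psi>" and s: "summable (\<lambda>n. norm (block n a))"
  shows "norm a \<le> (\<Sum>n. norm (block n a))"
  using summable_norm[OF s] block_sums[OF a] by (simp add: sums_iff)

lemma modulus_le_suminf_block:
  assumes a: "a \<in> continuous_elements \<psi>" and h: "0 \<le> h"
    and s: "summable (\<lambda>n. modulus \<psi> l h (block n a))"
  shows "modulus \<psi> l h a \<le> (\<Sum>n. modulus \<psi> l h (block n a))"
proof (rule modulus_le[OF h])
  fix t :: "real^'d" assume t: "l1norm t \<le> h"
  have le: "norm (difference \<psi> l t (block n a)) \<le> modulus \<psi> l h (block n a)" for n
    by (rule norm_difference_le_modulus[OF t])
  have s': "summable (\<lambda>n. norm (difference \<psi> l t (block n a)))"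
    by (rule summable_comparison_test'[OF s, of 0]) (simp add: le)
  have "(\<lambda>n. difference \<psi> l t (block n a)) sums difference \<psi> l t a"
    by (rule bounded_linear.sums[OF bounded_linear_difference block_sums[OF a]])
  then have "norm (difference \<psi> l t a) \<le> (\<Sum>n. norm (difference \<psi> l t (block n a)))"
    using summable_norm[OF s'] by (simp add: sums_iff)
  also have "\<dots> \<le> (\<Sum>n. modulus \<psi> l h (block n a))" by (rule suminf_le[OF le s' s])
  finally show "norm (difference \<psi> l t a) \<le> (\<Sum>n. modulus \<psi> l h (block n a))" .
qed

end

section \<open>Weighted sequence norms\<close>

lemma enn_powr_ennreal: "0 \<le> x \<Longrightarrow> enn_powr (ennreal x) q = ennreal (x powr q)"
  by (simp add: enn_powr_def)

lemma enn_powr_inverse_le_iff: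
  assumes q: "0 < q" and A: "0 \<le> A"
  shows "enn_powr x (1 / q) \<le> ennreal A \<longleftrightarrow> x \<le> ennreal (A powr q)"
proof (cases x)
  case (real y)
  have "y powr (1 / q) \<le> A \<longleftrightarrow> y \<le> A powr q"
  proof
    assume "y powr (1 / q) \<le> A"
    then have "(y powr (1 / q)) powr q \<le> A powr q" using q by (intro powr_mono2) auto
    then show "y \<le> A powr q" using q real by (simp add: powr_powr)
  next
    assume "y \<le> A powr q"
    then have "y powr (1 / q) \<le> (A powr q) powr (1 / q)" using q real by (intro powr_mono2) auto
    then show "y powr (1 / q) \<le> A" using q A by (simp add: powr_powr)
  qed
  then show ?thesis using real A by (simp add: enn_powr_ennreal ennreal_le_iff)
qed (simp add: enn_powr_def top_unique)

text \<open>An infinite right-hand side is trivial since K > 0; the norm inequalities can therefore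
  be proved for finite real bounds A.\<close>

lemma ennreal_le_multI:
  fixes x y :: ennreal
  assumes K: "0 < K" and le: "\<And>A. 0 \<le> A \<Longrightarrow> y \<le> ennreal A \<Longrightarrow> x \<le> ennreal (K * A)"
  shows "x \<le> ennreal K * y"
proof (cases y)
  case (real A)
  then have "x \<le> ennreal (K * A)" by (intro le) auto
  then show ?thesis using real K by (simp add: ennreal_mult)
next
  case top
  then show ?thesis using K by (simp add: ennreal_mult_top)
qed

lemma exponent_ge_1:
  assumes "1 \<le> p" "p \<noteq> \<infinity>"
  shows "1 \<le> enn2real p"
  using assms by (cases p) (auto simp flip: ennreal_1)

section \<open>Sequence norms and the inequalities of Minkowski and Jensen\<close>

definition seq_norm :: "ennreal \<Rightarrow> (nat \<Rightarrow> real) \<Rightarrow> ennreal" where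
  "seq_norm p b = (if p = \<infinity> then (SUP n. ennreal (b n))
     else enn_powr (\<Sum>n. ennreal (b n powr enn2real p)) (1 / enn2real p))"

lemma seq_norm_le_iff:
  assumes p: "1 \<le> p" and b: "\<And>n. 0 \<le> b n" and A: "0 \<le> A"
  shows "seq_norm p b \<le> ennreal A \<longleftrightarrow>
    (if p = \<infinity> then \<forall>n. b n \<le> A else (\<Sum>n. ennreal (b n powr enn2real p)) \<le> ennreal (A powr enn2real p))"
proof (cases "p = \<infinity>")
  case True
  then show ?thesis using A b by (auto simp: seq_norm_def SUP_le_iff ennreal_le_iff)
next
  case False
  then have "0 < enn2real p" using exponent_ge_1[OF p] by simp
  then show ?thesis using False A by (simp add: seq_norm_def enn_powr_inverse_le_iff)
qed

lemma seq_norm_ge: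
  assumes p: "1 \<le> p" and b: "\<And>n. 0 \<le> b n"
  shows "ennreal (b n) \<le> seq_norm p b"
proof (cases "seq_norm p b")
  case (real A)
  then have "(if p = \<infinity> then \<forall>n. b n \<le> A else (\<Sum>n. ennreal (b n powr enn2real p)) \<le> ennreal (A powr enn2real p))"
    using seq_norm_le_iff[of p b A, OF p b] by simp
  moreover have "b n \<le> A" if fin: "p \<noteq> \<infinity>" and sum: "(\<Sum>n. ennreal (b n powr enn2real p)) \<le> ennreal (A powr enn2real p)"
  proof -
    have q: "1 \<le> enn2real p" using exponent_ge_1[OF p fin] .
    have "(\<Sum>i\<in>{n}. ennreal (b i powr enn2real p)) \<le> (\<Sum>n. ennreal (b n powr enn2real p))"
      by (rule sum_le_suminf) auto
    also note sum
    finally have "b n powr enn2real p \<le> A powr enn2real p" by (simp add: ennreal_le_iff)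
    then show "b n \<le> A" using q real powr_less_mono2[of "enn2real p" A "b n"] by fastforce
  qed
  ultimately show ?thesis using real by (auto split: if_splits simp: ennreal_le_iff)
qed (simp)

text \<open>The common source of the Minkowski and Jensen inequalities below. The point b = 0 lies
  outside the open half-line of the tangent argument and is checked directly, where the claim comes
  down to 1 - q \<le> 0.\<close>

lemma powr_tangent:
  fixes z b q :: real
  assumes z: "0 < z" and b: "0 \<le> b" and q: "1 \<le> q"
  shows "z powr q + q * z powr (q - 1) * (b - z) \<le> b powr q"
proof (cases "b = 0")
  case True
  have "z powr (q - 1) * z = z powr q" using z by (simp add: powr_diff)
  then have "z powr q + q * z powr (q - 1) * (0 - z) = (1 - q) * z powr q" by (simp add: algebra_simps)
  also have "\<dots> \<le> 0" using q by (intro mult_nonpos_nonneg) auto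
  finally show ?thesis using True by simp
next
  case False
  have "q * z powr (q - 1) * (b - z) \<le> b powr q - z powr q"
  proof (rule convex_on_imp_above_tangent[OF powr_convex[OF q]])
    show "((\<lambda>x. x powr q) has_field_derivative q * z powr (q - 1)) (at z within {0<..})"
      using z by (auto intro!: derivative_eq_intros)
  qed (use z b False in \<open>auto simp: interior_open\<close>)
  then show ?thesis by simp
qed

text \<open>Convexity of the q-th power at the points x / A and y / B with weights A and B. If the
  q-th powers of x and y sum to at most A^q and B^q, summation yields exactly (A + B)^q.\<close>

lemma powr_convex_comb:
  fixes x y q :: real
  assumes q: "1 \<le> q" and xy: "0 \<le> x" "0 \<le> y" and AB: "0 < A" "0 < B"
  shows "(x + y) powr q \<le> (A + B) powr (q - 1) * (A powr (1 - q) * x powr q + B powr (1 - q) * y powr q)"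
proof (cases "x + y = 0")
  case False
  define z where "z = (x + y) / (A + B)"
  have z: "0 < z" using False xy AB by (simp add: z_def)
  have scale: "C * (w / C) powr q = C powr (1 - q) * w powr q" if "0 < C" "0 \<le> w" for C w :: real
    using that by (simp add: powr_divide powr_diff)
  have "A * (z powr q + q * z powr (q - 1) * (x / A - z)) + B * (z powr q + q * z powr (q - 1) * (y / B - z))
      \<le> A * (x / A) powr q + B * (y / B) powr q"
    using xy AB by (intro add_mono mult_left_mono powr_tangent z q) auto
  also have "A * (z powr q + q * z powr (q - 1) * (x / A - z)) + B * (z powr q + q * z powr (q - 1) * (y / B - z))
      = (A + B) * z powr q + q * z powr (q - 1) * ((x + y) - (A + B) * z)"
    using AB by (simp add: algebra_simps)
  also have "(A + B) * z = x + y" using AB by (simp add: z_def)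
  finally have "(A + B) * z powr q \<le> A powr (1 - q) * x powr q + B powr (1 - q) * y powr q"
    using scale[of A x] scale[of B y] AB xy by simp
  also have "(A + B) * z powr q = (A + B) powr (1 - q) * (x + y) powr q"
    unfolding z_def by (rule scale) (use AB xy in auto)
  finally have "(A + B) powr (q - 1) * ((A + B) powr (1 - q) * (x + y) powr q)
      \<le> (A + B) powr (q - 1) * (A powr (1 - q) * x powr q + B powr (1 - q) * y powr q)"
    by (intro mult_left_mono) auto
  then show ?thesis using AB by (simp add: mult.assoc[symmetric] powr_add[symmetric])
qed simp

text \<open>Minkowski's inequality, from convexity with weights close to the two norms. The
  one-sided hypothesis on \<open>d\<close> suits block norms, which are only subadditive.\<close>

lemma seq_norm_triangle:
  assumes p: "1 \<le> p" and b: "\<And>n. 0 \<le> b n" and c: "\<And>n. 0 \<le> c n" and d: "\<And>n. 0 \<le> d n" "\<And>n. d n \<le> b n + c n"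
  shows "seq_norm p d \<le> seq_norm p b + seq_norm p c"
proof (cases "seq_norm p b = \<infinity> \<or> seq_norm p c = \<infinity>")
  case False
  then obtain \<alpha> \<beta> where \<alpha>: "0 \<le> \<alpha>" "seq_norm p b = ennreal \<alpha>" and \<beta>: "0 \<le> \<beta>" "seq_norm p c = ennreal \<beta>"
    by (metis ennreal_cases infinity_ennreal_def)
  show ?thesis
  proof (rule ennreal_le_epsilon)
    fix e :: real assume e: "0 < e"
    \<comment> \<open>The added e / 2 keeps both weights positive even when one of the norms is
      0.\<close>
    define A where "A = \<alpha> + e / 2"
    define B where "B = \<beta> + e / 2"
    have AB: "0 < A" "0 < B" using \<alpha> \<beta> e by (auto simp: A_def B_def)
    have bA: "seq_norm p b \<le> ennreal A" and cB: "seq_norm p c \<le> ennreal B"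
      using \<alpha> \<beta> e by (auto simp: A_def B_def intro!: ennreal_leI)
    have "seq_norm p d \<le> ennreal (A + B)"
    proof (cases "p = \<infinity>")
      case True
      have "\<forall>n. b n \<le> A" "\<forall>n. c n \<le> B"
        using bA cB AB seq_norm_le_iff[of p b A, OF p b] seq_norm_le_iff[of p c B, OF p c] True by simp_all
      then have "\<forall>n. d n \<le> A + B" using d(2) by (meson add_mono order_trans)
      then show ?thesis using seq_norm_le_iff[of p d "A + B", OF p d(1)] AB True by simp
    next
      case fin: False
      define q where "q = enn2real p"
      have q: "1 \<le> q" unfolding q_def by (rule exponent_ge_1[OF p fin])
      have b': "(\<Sum>n. ennreal (b n powr q)) \<le> ennreal (A powr q)" and c': "(\<Sum>n. ennreal (c n powr q)) \<le> ennreal (B powr q)"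
        using bA cB AB seq_norm_le_iff[of p b A, OF p b] seq_norm_le_iff[of p c B, OF p c] fin by (simp_all add: q_def)
      define k where "k = (A + B) powr (q - 1)"
      have k0: "0 \<le> k" by (simp add: k_def)
      have "(\<Sum>n. ennreal (d n powr q))
          \<le> (\<Sum>n. ennreal (k * A powr (1 - q)) * ennreal (b n powr q) + ennreal (k * B powr (1 - q)) * ennreal (c n powr q))"
      proof (rule suminf_le)
        fix n
        have "d n powr q \<le> (b n + c n) powr q" using d q by (intro powr_mono2) auto
        also have "\<dots> \<le> k * (A powr (1 - q) * b n powr q + B powr (1 - q) * c n powr q)"
          unfolding k_def by (rule powr_convex_comb[OF q b c AB])
        finally have "ennreal (d n powr q) \<le> ennreal (k * A powr (1 - q) * b n powr q + k * B powr (1 - q) * c n powr q)"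
          by (intro ennreal_leI) (simp add: algebra_simps)
        then show "ennreal (d n powr q) \<le> ennreal (k * A powr (1 - q)) * ennreal (b n powr q) + ennreal (k * B powr (1 - q)) * ennreal (c n powr q)"
          using k0 by (simp add: ennreal_mult[symmetric] ennreal_plus[symmetric] del: ennreal_plus)
      qed auto
      also have "\<dots> = ennreal (k * A powr (1 - q)) * (\<Sum>n. ennreal (b n powr q)) + ennreal (k * B powr (1 - q)) * (\<Sum>n. ennreal (c n powr q))"
        by (subst suminf_add[symmetric]) auto
      also have "\<dots> \<le> ennreal (k * A powr (1 - q)) * ennreal (A powr q) + ennreal (k * B powr (1 - q)) * ennreal (B powr q)"
        by (intro add_mono mult_left_mono b' c') auto
      also have "\<dots> = ennreal (k * A powr (1 - q) * A powr q + k * B powr (1 - q) * B powr q)"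
        using k0 by (simp add: ennreal_mult[symmetric] ennreal_plus[symmetric] del: ennreal_plus)
      also have "k * A powr (1 - q) * A powr q + k * B powr (1 - q) * B powr q = (A + B) powr q"
      proof -
        have "k * A powr (1 - q) * A powr q + k * B powr (1 - q) * B powr q = k * (A + B)"
          using AB by (simp add: mult.assoc distrib_left flip: powr_add)
        also have "\<dots> = (A + B) powr q" using AB by (simp add: k_def powr_diff)
        finally show ?thesis .
      qed
      finally show ?thesis
        using seq_norm_le_iff[of p d "A + B", OF p d(1)] AB fin by (simp add: q_def)
    qed
    also have "ennreal (A + B) = seq_norm p b + seq_norm p c + ennreal e"
      using \<alpha> \<beta> e by (simp add: A_def B_def ennreal_plus[symmetric] del: ennreal_plus)
    finally show "seq_norm p d \<le> seq_norm p b + seq_norm p c + ennreal e" .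
  qed
qed auto

lemma seq_norm_scale_le:
  assumes p: "1 \<le> p" and b: "\<And>n. 0 \<le> b n" and c: "0 \<le> c" and A: "0 \<le> A" and le: "seq_norm p b \<le> ennreal A"
  shows "seq_norm p (\<lambda>n. c * b n) \<le> ennreal (c * A)"
proof -
  have cb: "0 \<le> c * b n" for n using b c by simp
  show ?thesis
  proof (cases "p = \<infinity>")
    case True
    then have "\<forall>n. b n \<le> A" using le seq_norm_le_iff[of p b A, OF p b A] by simp
    then have "\<forall>n. c * b n \<le> c * A" using c by (auto intro: mult_left_mono)
    then show ?thesis using seq_norm_le_iff[of p "\<lambda>n. c * b n" "c * A", OF p cb] c A True by simp
  next
    case False
    have "(\<Sum>n. ennreal ((c * b n) powr enn2real p)) = ennreal (c powr enn2real p) * (\<Sum>n. ennreal (b n powr enn2real p))"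
      using b c by (simp add: powr_mult ennreal_mult)
    also have "\<dots> \<le> ennreal (c powr enn2real p) * ennreal (A powr enn2real p)"
      using le seq_norm_le_iff[of p b A, OF p b A] False by (intro mult_left_mono) auto
    also have "\<dots> = ennreal ((c * A) powr enn2real p)"
      using c A by (simp add: powr_mult ennreal_mult)
    finally show ?thesis using seq_norm_le_iff[of p "\<lambda>n. c * b n" "c * A", OF p cb] c A False by simp
  qed
qed

text \<open>The reverse inequality is the upper bound applied to the factor 1 / c.\<close>

lemma seq_norm_scale:
  assumes p: "1 \<le> p" and b: "\<And>n. 0 \<le> b n" and c: "0 \<le> c" and fin: "seq_norm p b < \<infinity>"
  shows "seq_norm p (\<lambda>n. c * b n) = ennreal c * seq_norm p b"
proof (cases "c = 0")
  case True
  have "seq_norm p (\<lambda>n. 0 * b n) \<le> ennreal (0 * 0)"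
    using seq_norm_le_iff[of p "\<lambda>n. 0" 0, OF p] by simp
  then show ?thesis using True by simp
next
  case False
  with c have c: "0 < c" by simp
  obtain A where A: "0 \<le> A" "seq_norm p b = ennreal A" using fin by (cases "seq_norm p b") auto
  have le: "seq_norm p (\<lambda>n. c * b n) \<le> ennreal (c * A)"
    by (rule seq_norm_scale_le) (use p b c A in auto)
  then obtain D where D: "0 \<le> D" "seq_norm p (\<lambda>n. c * b n) = ennreal D"
    by (cases "seq_norm p (\<lambda>n. c * b n)") (auto simp: top_unique)
  have "seq_norm p (\<lambda>n. (1 / c) * (c * b n)) \<le> ennreal ((1 / c) * D)"
    by (rule seq_norm_scale_le) (use p b c D in auto)
  then have "A \<le> (1 / c) * D" using A c D by (simp add: ennreal_le_iff)
  then have "c * A \<le> D" using c by (simp add: field_simps)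
  moreover have "D \<le> c * A" using le D A c by (simp add: ennreal_le_iff)
  ultimately have "D = c * A" by simp
  then show ?thesis using D A c by (simp add: ennreal_mult)
qed

text \<open>The total weight is only bounded by W, so the tangent is taken at z = S / W. There the
  weight sum has the nonpositive coefficient (1 - q) * z^q, and replacing the sum by W can only
  lower the left-hand side.\<close>

lemma powr_jensen:
  fixes v b :: "nat \<Rightarrow> real"
  assumes q: "1 \<le> q" and v: "\<And>n. 0 \<le> v n" and b: "\<And>n. 0 \<le> b n" and W: "0 < W"
    and sv: "summable v" "suminf v \<le> W" and svb: "summable (\<lambda>n. v n * b n)" "summable (\<lambda>n. v n * b n powr q)"
  shows "(\<Sum>n. v n * b n) powr q \<le> W powr (q - 1) * (\<Sum>n. v n * b n powr q)"
proof -
  define S where "S = (\<Sum>n. v n * b n)"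
  have S0: "0 \<le> S" unfolding S_def using svb v b by (intro suminf_nonneg) auto
  show ?thesis
  proof (cases "S = 0")
    case True
    have "0 \<le> (\<Sum>n. v n * b n powr q)" using svb v by (intro suminf_nonneg) auto
    then show ?thesis using True unfolding S_def[symmetric] by simp
  next
    case False
    define z where "z = S / W"
    have z: "0 < z" using False S0 W by (simp add: z_def)
    have S: "S = z * W" using W by (simp add: z_def)
    have zq: "z powr (q - 1) * z = z powr q" using z by (simp add: powr_diff)
    have "(1 - q) * z powr q * suminf v + q * z powr (q - 1) * S
        = (\<Sum>n. (1 - q) * z powr q * v n + q * z powr (q - 1) * (v n * b n))"
      unfolding S_def using sv svb by (subst suminf_add[symmetric]) (auto simp: suminf_mult intro: summable_mult)
    also have "\<dots> \<le> (\<Sum>n. v n * b n powr q)"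
    proof (rule suminf_le)
      fix n
      have "v n * (z powr q + q * z powr (q - 1) * (b n - z)) \<le> v n * b n powr q"
        by (intro mult_left_mono powr_tangent z b q v)
      moreover have "v n * (z powr q + q * z powr (q - 1) * (b n - z))
          = (1 - q) * z powr q * v n + q * z powr (q - 1) * (v n * b n)"
        using zq by (simp add: algebra_simps)
      ultimately show "(1 - q) * z powr q * v n + q * z powr (q - 1) * (v n * b n) \<le> v n * b n powr q" by simp
      show "summable (\<lambda>n. (1 - q) * z powr q * v n + q * z powr (q - 1) * (v n * b n))"
        using sv svb by (intro summable_add summable_mult)
    qed (use svb in auto)
    finally have 1: "(1 - q) * z powr q * suminf v + q * z powr (q - 1) * S \<le> (\<Sum>n. v n * b n powr q)" .
    have "(1 - q) * z powr q * W \<le> (1 - q) * z powr q * suminf v"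
      using q by (intro mult_left_mono_neg sv mult_nonpos_nonneg) auto
    moreover have "q * z powr (q - 1) * S = q * z powr q * W"
      unfolding S using zq by (metis mult.assoc)
    ultimately have "(1 - q) * z powr q * W + q * z powr q * W \<le> (\<Sum>n. v n * b n powr q)" using 1 by linarith
    then have "z powr q * W \<le> (\<Sum>n. v n * b n powr q)" by (simp add: left_diff_distrib)
    then have "W powr (q - 1) * (z powr q * W) \<le> W powr (q - 1) * (\<Sum>n. v n * b n powr q)"
      by (intro mult_left_mono) auto
    moreover have "W powr (q - 1) * (z powr q * W) = S powr q"
      using W z unfolding S by (simp add: powr_mult powr_diff)
    ultimately show ?thesis by (simp add: S_def)
  qed
qed

text \<open>A smooth majorant of \<open>min (u powr s) (u powr - s)\<close> whose dyadic sums telescope and whose integral against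
  \<open>du / u\<close> is explicit.\<close>

definition weight :: "real \<Rightarrow> real \<Rightarrow> real" where
  "weight s u = 4 * u powr s / (1 + u powr s)\<^sup>2"

lemma weight_nonneg: "0 \<le> weight s u"
  by (simp add: weight_def)

lemma measurable_weight [measurable]: "weight s \<in> borel_measurable borel"
  unfolding weight_def by measurable

text \<open>For u \<le> 1 this rests on u^(l - r) \<le> u^s, for u > 1 on u^(-r) \<le> u^(-s). The
  numerator 4 of \<open>weight\<close> makes the constant 1: with y = u^s, (1 + y)^2 is at most 4 in
  the first case and at most 4 y^2 in the second.\<close>

lemma min_le_weight:
  assumes u: "0 < u" and s: "0 < s" "s \<le> r" "s \<le> real l - r"
  shows "min 1 (u ^ l) \<le> weight s u * u powr r"
proof -
  let ?y = "u powr s"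
  have y: "0 < ?y" using u by simp
  have sq: "0 < (1 + ?y)\<^sup>2" using y by (intro zero_less_power add_pos_pos) auto
  show ?thesis
  proof (cases "u \<le> 1")
    case True
    have y1: "?y \<le> 1" using True u s by (intro powr_le1) auto
    have "(1 + ?y)\<^sup>2 \<le> 2\<^sup>2" using y y1 by (intro power_mono) auto
    then have "?y * (1 + ?y)\<^sup>2 \<le> 4 * ?y" using y by (simp add: mult.commute)
    then have yw: "?y \<le> weight s u" using sq by (simp add: weight_def pos_le_divide_eq)
    have "min 1 (u ^ l) \<le> u powr (real l - r) * u powr r"
      using u by (simp add: powr_realpow flip: powr_add)
    also have "\<dots> \<le> ?y * u powr r"
      using True u s by (intro mult_right_mono powr_mono') auto
    also have "\<dots> \<le> weight s u * u powr r" by (intro mult_right_mono yw) auto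
    finally show ?thesis .
  next
    case False
    have y1: "1 \<le> ?y" using False s by (intro ge_one_powr_ge_zero) auto
    have "(1 + ?y)\<^sup>2 \<le> (2 * ?y)\<^sup>2" using y1 by (intro power_mono) auto
    then have "(1 + ?y)\<^sup>2 \<le> 4 * ?y * ?y" by (simp add: power2_eq_square)
    then have "1 \<le> (4 * ?y * ?y) / (1 + ?y)\<^sup>2" using sq by (simp add: pos_le_divide_eq)
    then have "1 \<le> weight s u * ?y" by (simp add: weight_def)
    then have yw: "1 / ?y \<le> weight s u" using y by (simp add: pos_divide_le_eq)
    have "min 1 (u ^ l) \<le> u powr (- r) * u powr r" using u by (simp flip: powr_add)
    also have "\<dots> \<le> u powr (- s) * u powr r"
      using False s by (intro mult_right_mono powr_mono) auto
    also have "\<dots> = 1 / ?y * u powr r" by (simp add: powr_minus divide_inverse)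
    also have "\<dots> \<le> weight s u * u powr r" by (intro mult_right_mono yw) auto
    finally show ?thesis .
  qed
qed

text \<open>With g u = - 1 / (1 + u^s), the weight at u is at most W * (g (2 u) - g u). The dyadic
  sum telescopes, and since g stays in [-1, 0] it remains below W for every h.\<close>

lemma weight_sum:
  assumes h: "0 < h" and s: "0 < s"
  shows "summable (\<lambda>n. weight s (2 ^ n * h))"
    and "(\<Sum>n. weight s (2 ^ n * h)) \<le> 4 * 2 powr s / (2 powr s - 1)"
proof -
  define c where "c = (2::real) powr s"
  define W where "W = 4 * c / (c - 1)"
  define g where "g u = - (1 / (1 + u powr s))" for u :: real
  have c: "1 < c" using s powr_less_mono[of 0 s 2] by (simp add: c_def)
  have step: "weight s u \<le> W * (g (2 * u) - g u)" if u: "0 < u" for u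
  proof -
    let ?y = "u powr s"
    have y: "0 < ?y" using u by simp
    have cy: "(2 * u) powr s = c * ?y" using u by (simp add: powr_mult c_def)
    have pos: "0 < 1 + ?y" "0 < 1 + c * ?y" using y c by (auto intro: add_pos_pos)
    have "g (2 * u) - g u = (c - 1) * ?y / ((1 + ?y) * (1 + c * ?y))"
      unfolding g_def cy using pos by (simp add: field_simps)
    then have "W * (g (2 * u) - g u) = 4 * c * ?y / ((1 + ?y) * (1 + c * ?y))"
      using c by (simp add: W_def)
    moreover have "weight s u \<le> 4 * c * ?y / ((1 + ?y) * (1 + c * ?y))"
    proof -
      have "weight s u = (4 * ?y * (1 + c * ?y)) / ((1 + ?y)\<^sup>2 * (1 + c * ?y))"
        using pos by (simp add: weight_def)
      also have "\<dots> \<le> (4 * ?y * (c * (1 + ?y))) / ((1 + ?y)\<^sup>2 * (1 + c * ?y))"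
        using pos y c by (intro divide_right_mono mult_left_mono) (auto simp: algebra_simps)
      also have "\<dots> = 4 * c * ?y / ((1 + ?y) * (1 + c * ?y))"
        using pos by (simp add: power2_eq_square)
      finally show ?thesis .
    qed
    ultimately show ?thesis by simp
  qed
  have part: "(\<Sum>n<N. weight s (2 ^ n * h)) \<le> W" for N
  proof -
    have "(\<Sum>n<N. weight s (2 ^ n * h)) \<le> (\<Sum>n<N. W * (g (2 ^ Suc n * h) - g (2 ^ n * h)))"
      using step h by (intro sum_mono) (simp add: mult.assoc)
    also have "\<dots> = W * (g (2 ^ N * h) - g h)"
      unfolding sum_distrib_left[symmetric] by (subst sum_lessThan_telescope) simp
    also have "\<dots> \<le> W * 1"
    proof (rule mult_left_mono)
      have "g (2 ^ N * h) \<le> 0" by (simp add: g_def)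
      moreover have "- g h \<le> 1" using add_pos_nonneg[of 1 "h powr s"] by (simp add: g_def divide_le_eq_1)
      ultimately show "g (2 ^ N * h) - g h \<le> 1" by linarith
    qed (use c in \<open>simp add: W_def\<close>)
    finally show ?thesis by simp
  qed
  show sm: "summable (\<lambda>n. weight s (2 ^ n * h))"
    by (rule summableI_nonneg_bounded[OF weight_nonneg part])
  show "(\<Sum>n. weight s (2 ^ n * h)) \<le> 4 * 2 powr s / (2 powr s - 1)"
    using suminf_le_const[OF sm part] by (simp add: W_def c_def)
qed

text \<open>The measure dh / h is invariant under dilation, hence c is absent from the value. The
  antiderivative \<open>F\<close> rises from - 4 / s at 0 to 0 at infinity.\<close>

lemma weight_integral:
  assumes c: "0 < c" and s: "0 < s"
  shows "(\<integral>\<^sup>+h\<in>{0<..}. ennreal (weight s (c * h) / h) \<partial>lborel) = ennreal (4 / s)"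
proof -
  define F where "F h = - (4 / s) * (1 / (1 + (c * h) powr s))" for h
  let ?f = "\<lambda>h. weight s (c * h) / h"
  have y: "0 < 1 + (c * h) powr s" for h by (simp add: add_pos_nonneg)
  have deriv: "(F has_real_derivative ?f h) (at h)" if h: "0 < h" for h
  proof -
    have "((\<lambda>h. (c * h) powr s) has_real_derivative (s * (c * h) powr (s - 1) * c)) (at h)"
      using h c by (auto intro!: derivative_eq_intros)
    moreover have "s * (c * h) powr (s - 1) * c = s * (c * h) powr s / h"
      using h c by (simp add: powr_diff)
    ultimately have "((\<lambda>h. (c * h) powr s) has_real_derivative (s * (c * h) powr s / h)) (at h)" by simp
    note D = this
    have "(F has_real_derivative (4 / s) * (s * (c * h) powr s / h) / (1 + (c * h) powr s)\<^sup>2) (at h)"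
      unfolding F_def by (rule derivative_eq_intros D refl | use y[of h] in \<open>simp add: power2_eq_square\<close>)+
    then show ?thesis using s by (simp add: weight_def mult.commute)
  qed
  have lim0: "((F \<circ> real_of_ereal) \<longlongrightarrow> - (4 / s) * (1 / (1 + 0))) (at_right 0)"
  proof -
    have "((\<lambda>h. (c * h) powr s) \<longlongrightarrow> (c * 0) powr s) (at_right 0)"
    proof (intro tendsto_powr' tendsto_intros)
      show "c * 0 \<noteq> 0 \<or> 0 < s \<and> (\<forall>\<^sub>F h in at_right 0. 0 \<le> c * h)"
        using s c by (auto simp: eventually_at_right_field intro!: exI[of _ 1])
    qed
    then have "(F \<longlongrightarrow> - (4 / s) * (1 / (1 + 0))) (at_right 0)"
      unfolding F_def using s by (intro tendsto_intros) auto
    then show ?thesis unfolding zero_ereal_def by (subst ereal_tendsto_simps) simp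
  qed
  have limT: "((F \<circ> real_of_ereal) \<longlongrightarrow> - (4 / s) * 0) (at_left \<infinity>)"
  proof -
    have "filterlim (\<lambda>h. c * h) at_top at_top" using c by (intro filterlim_tendsto_pos_mult_at_top[OF tendsto_const] filterlim_ident)
    then have lim: "((\<lambda>h. (c * h) powr (- s)) \<longlongrightarrow> 0) at_top"
      using s by (intro tendsto_neg_powr) auto
    have "((\<lambda>h. 1 / (1 + (c * h) powr s)) \<longlongrightarrow> 0) at_top"
    proof (rule tendsto_sandwich[OF _ _ tendsto_const lim])
      show "\<forall>\<^sub>F h in at_top. 1 / (1 + (c * h) powr s) \<le> (c * h) powr (- s)"
        using eventually_gt_at_top[of 0]
      proof eventually_elim
        case (elim h)
        then have "0 < (c * h) powr s" using c by simp
        then show ?case by (simp add: powr_minus inverse_eq_divide frac_le)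
      qed
    qed (simp add: add_nonneg_nonneg)
    then have "(F \<longlongrightarrow> - (4 / s) * 0) at_top" unfolding F_def by (intro tendsto_intros)
    then show ?thesis by (subst ereal_tendsto_simps) simp
  qed
  have cont: "isCont ?f h" if "0 < h" for h
    unfolding weight_def using that c y[of h] by (intro continuous_intros) auto
  have e: "einterval 0 \<infinity> = {0<..}" by (auto simp: einterval_def)
  note ftc = interval_integral_FTC_nonneg[where F=F and f="?f" and a=0 and b="\<infinity>" and A="- (4 / s) * (1 / (1 + 0))" and B="- (4 / s) * 0"]
  have int: "set_integrable lborel {0<..} ?f"
    unfolding e[symmetric]
    by (rule ftc(1)) (use deriv cont lim0 limT in \<open>auto simp: weight_nonneg intro!: AE_I2\<close>)
  have val: "(LBINT x=0..\<infinity>. ?f x) = 4 / s"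
    by (subst ftc(2)) (use deriv cont lim0 limT in \<open>auto simp: weight_nonneg intro!: AE_I2\<close>)
  have "(\<integral>\<^sup>+h\<in>{0<..}. ennreal (?f h) \<partial>lborel) = (\<integral>\<^sup>+h. ennreal (indicator {0<..} h *\<^sub>R ?f h) \<partial>lborel)"
    by (intro nn_integral_cong) (auto simp: indicator_def)
  also have "\<dots> = ennreal (\<integral>h. indicator {0<..} h *\<^sub>R ?f h \<partial>lborel)"
    using int unfolding set_integrable_def
    by (rule nn_integral_eq_integral) (auto simp: indicator_def weight_nonneg)
  also have "(\<integral>h. indicator {0<..} h *\<^sub>R ?f h \<partial>lborel) = 4 / s"
    using val unfolding interval_lebesgue_integral_def set_lebesgue_integral_def e by simp
  finally show ?thesis .
qed

section \<open>Equivalence of the norms\<close>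

lemma half_power_powr: "((1/2) ^ m :: real) powr (- r) = 2 powr (r * real m)"
proof -
  have "((1/2) ^ m :: real) = 2 powr (- real m)"
    by (simp add: powr_minus powr_realpow power_one_over inverse_eq_divide)
  then show ?thesis by (simp add: powr_powr mult.commute)
qed

section \<open>Dyadic discretisation of the Besov seminorm\<close>

context bounded_group
begin

text \<open>The order l is left free, so that the two directions can state separately what they
  require of it.\<close>

definition besov_seminorm :: "ennreal \<Rightarrow> real \<Rightarrow> nat \<Rightarrow> 'a \<Rightarrow> ennreal" where
  "besov_seminorm p r l a =
     (if p = \<infinity> then (SUP h\<in>{0<..}. ennreal (h powr (- r) * modulus \<psi> l h a))
      else enn_powr (\<integral>\<^sup>+h\<in>{0<..}. ennreal ((h powr (- r) * modulus \<psi> l h a) powr enn2real p / h) \<partial>lborel)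
             (1 / enn2real p))"

lemma besov_norm_eq:
  "besov_norm \<psi> p r a = ennreal (norm a) + besov_seminorm p r (nat \<lfloor>r\<rfloor> + 1) a"
  by (simp add: besov_norm_def besov_seminorm_def Let_def)

lemma besov_seminorm_le_iff:
  assumes p: "1 \<le> p" and A: "0 \<le> A"
  shows "besov_seminorm p r l a \<le> ennreal A \<longleftrightarrow>
    (if p = \<infinity> then \<forall>h>0. h powr (- r) * modulus \<psi> l h a \<le> A
     else (\<integral>\<^sup>+h\<in>{0<..}. ennreal ((h powr (- r) * modulus \<psi> l h a) powr enn2real p / h) \<partial>lborel)
       \<le> ennreal (A powr enn2real p))"
proof (cases "p = \<infinity>")
  case True
  then show ?thesis using A by (auto simp: besov_seminorm_def SUP_le_iff ennreal_le_iff)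
next
  case False
  then have "0 < enn2real p" using exponent_ge_1[OF p] by simp
  then show ?thesis using False A by (simp add: besov_seminorm_def enn_powr_inverse_le_iff)
qed

definition dyadic_modulus :: "real \<Rightarrow> nat \<Rightarrow> 'a \<Rightarrow> nat \<Rightarrow> real" where
  "dyadic_modulus r l a m = 2 powr (r * real m) * modulus \<psi> l ((1/2) ^ m) a"

lemma dyadic_modulus_nonneg: "0 \<le> dyadic_modulus r l a m"
  by (simp add: dyadic_modulus_def modulus_nonneg)

text \<open>On the m-th dyadic interval h^(-r) is at least 2^(-r) times its value at 2^(-m), the
  modulus is monotone, and 1 / h is at least 2^m / 2. These losses make up the denominator.\<close>

lemma dyadic_modulus_powr_le:
  assumes q: "1 \<le> q" and r: "0 < r" and h: "h \<in> {(1/2) ^ m<..2 * (1/2) ^ m}"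
  shows "2 ^ m * (dyadic_modulus r l a m powr q / (2 * 2 powr (r * q)))
    \<le> (h powr (- r) * modulus \<psi> l h a) powr q / h"
proof -
  let ?d = "(1/2) ^ m :: real"
  have d: "0 < ?d" "?d < h" "h \<le> 2 * ?d" using h by auto
  have h0: "0 < h" using d by linarith
  have two: "?d powr (- r) = 2 powr (r * real m)"
    by (rule half_power_powr)
  have "2 powr (- r) * dyadic_modulus r l a m \<le> h powr (- r) * modulus \<psi> l h a"
  proof -
    have "(2 * ?d) powr (- r) \<le> h powr (- r)" using d h0 r by (intro powr_mono2') auto
    then have "2 powr (- r) * 2 powr (r * real m) \<le> h powr (- r)" using d by (simp add: powr_mult two)
    then have "2 powr (- r) * 2 powr (r * real m) * modulus \<psi> l ?d a \<le> h powr (- r) * modulus \<psi> l h a"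
      using d by (intro mult_mono modulus_mono modulus_nonneg) auto
    then show ?thesis by (simp add: dyadic_modulus_def mult.assoc)
  qed
  then have "(2 powr (- r) * dyadic_modulus r l a m) powr q \<le> (h powr (- r) * modulus \<psi> l h a) powr q"
    using q dyadic_modulus_nonneg by (intro powr_mono2) auto
  then have 1: "dyadic_modulus r l a m powr q / 2 powr (r * q) \<le> (h powr (- r) * modulus \<psi> l h a) powr q"
    by (simp add: powr_mult powr_powr dyadic_modulus_nonneg) (simp add: powr_minus divide_inverse mult.commute)
  have 2: "2 ^ m / 2 \<le> 1 / h"
    using d h0 by (simp add: field_simps power_one_over)
  have "(dyadic_modulus r l a m powr q / 2 powr (r * q)) * (2 ^ m / 2) \<le> (h powr (- r) * modulus \<psi> l h a) powr q * (1 / h)"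
    using 1 2 by (intro mult_mono) auto
  then show ?thesis by (simp add: mult_ac)
qed

lemma seq_norm_dyadic_modulus_le:
  assumes p: "1 \<le> p" and r: "0 < r"
  obtains K where "0 < K"
    "\<And>a A. 0 \<le> A \<Longrightarrow> besov_seminorm p r l a \<le> ennreal A \<Longrightarrow> seq_norm p (dyadic_modulus r l a) \<le> ennreal (K * A)"
proof (cases "p = \<infinity>")
  case True
  show ?thesis
  proof (rule that[of 1])
    fix a A assume A: "(0::real) \<le> A" "besov_seminorm p r l a \<le> ennreal A"
    have "dyadic_modulus r l a m \<le> A" for m
    proof -
      have "((1/2) ^ m) powr (- r) * modulus \<psi> l ((1/2) ^ m) a \<le> A"
        using A besov_seminorm_le_iff[OF p A(1)] True by simp
      moreover have "((1/2) ^ m :: real) powr (- r) = 2 powr (r * real m)"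
        by (rule half_power_powr)
      ultimately show ?thesis by (simp add: dyadic_modulus_def)
    qed
    then show "seq_norm p (dyadic_modulus r l a) \<le> ennreal (1 * A)"
      using seq_norm_le_iff[OF p dyadic_modulus_nonneg A(1)] True by simp
  qed simp
next
  case False
  define q where "q = enn2real p"
  have q: "1 \<le> q" unfolding q_def by (rule exponent_ge_1[OF p False])
  define c where "c = 2 * 2 powr (r * q)"
  have c: "0 < c" by (simp add: c_def)
  show ?thesis
  proof (rule that[of "c powr (1 / q)"])
    show "0 < c powr (1 / q)" using c by simp
    fix a A assume A: "(0::real) \<le> A" "besov_seminorm p r l a \<le> ennreal A"
    \<comment> \<open>Truncation at 0 makes the modulus monotone on the whole line, hence Borel
      measurable; for h > 0 it changes nothing.\<close>
    define F where "F h = ennreal ((h powr (- r) * modulus \<psi> l (max 0 h) a) powr q / h)" for h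
    have "mono (\<lambda>h. modulus \<psi> l (max 0 h) a)" by (intro monoI modulus_mono) auto
    then have [measurable]: "(\<lambda>h. modulus \<psi> l (max 0 h) a) \<in> borel_measurable borel"
      by (rule borel_measurable_mono)
    have [measurable]: "F \<in> borel_measurable borel" unfolding F_def by measurable
    define I where "I m = {(1/2) ^ m<..2 * (1/2) ^ m :: real}" for m :: nat
    have disj: "disjoint_family I"
    proof -
      have "I m \<inter> I n = {}" if "m < n" for m n
      proof -
        have "(1/2) ^ n \<le> ((1/2) ^ Suc m :: real)" using that by (intro power_decreasing) auto
        then show ?thesis by (auto simp: I_def)
      qed
      then show ?thesis unfolding disjoint_family_on_def by (metis Int_commute linorder_neqE_nat)
    qed
    have lower: "ennreal (dyadic_modulus r l a m powr q / c) \<le> (\<integral>\<^sup>+h\<in>I m. F h \<partial>lborel)" for m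
    proof -
      \<comment> \<open>The length 2^(-m) of the interval cancels the factor 2^m, so each interval
        contributes one term of the sequence.\<close>
      let ?k = "2 ^ m * (dyadic_modulus r l a m powr q / c)"
      have "ennreal (dyadic_modulus r l a m powr q / c) = ennreal ?k * emeasure lborel (I m)"
      proof -
        have "emeasure lborel (I m) = ennreal ((1/2) ^ m)"
          unfolding I_def by (subst emeasure_lborel_Ioc) auto
        then show ?thesis using c by (simp add: ennreal_mult[symmetric] power_one_over)
      qed
      also have "\<dots> = (\<integral>\<^sup>+h\<in>I m. ennreal ?k \<partial>lborel)"
        by (subst nn_integral_cmult_indicator) (auto simp: I_def)
      also have "\<dots> \<le> (\<integral>\<^sup>+h\<in>I m. F h \<partial>lborel)"
      proof (intro nn_integral_mono)
        fix h
        show "ennreal ?k * indicator (I m) h \<le> F h * indicator (I m) h"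
        proof (cases "h \<in> I m")
          case True
          then have "0 < h" unfolding I_def by (auto intro: less_trans[rotated])
          then show ?thesis
            using dyadic_modulus_powr_le[OF q r, of h m l a] True
            by (auto simp: F_def I_def c_def intro!: ennreal_leI)
        qed simp
      qed
      finally show ?thesis .
    qed
    have "(\<Sum>m. ennreal (dyadic_modulus r l a m powr q / c)) \<le> (\<Sum>m. \<integral>\<^sup>+h\<in>I m. F h \<partial>lborel)"
      by (rule suminf_le[OF lower]) auto
    also have "\<dots> = (\<Sum>m. emeasure (density lborel F) (I m))"
      by (subst emeasure_density) (auto simp: I_def)
    also have "\<dots> = emeasure (density lborel F) (\<Union>m. I m)"
      by (rule suminf_emeasure[OF _ disj]) (auto simp: I_def)
    also have "\<dots> \<le> emeasure (density lborel F) {0<..}"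
    proof (rule emeasure_mono)
      show "(\<Union>m. I m) \<subseteq> {0<..}" unfolding I_def by (auto intro: less_trans[rotated])
    qed simp
    also have "\<dots> = (\<integral>\<^sup>+h\<in>{0<..}. ennreal ((h powr (- r) * modulus \<psi> l h a) powr q / h) \<partial>lborel)"
      by (subst emeasure_density) (auto simp: F_def indicator_def intro!: nn_integral_cong)
    also have "\<dots> \<le> ennreal (A powr q)"
      using A besov_seminorm_le_iff[OF p A(1)] False by (simp add: q_def)
    finally have sum: "(\<Sum>m. ennreal (dyadic_modulus r l a m powr q / c)) \<le> ennreal (A powr q)" .
    have "(\<Sum>m. ennreal (dyadic_modulus r l a m powr q)) = (\<Sum>m. ennreal c * ennreal (dyadic_modulus r l a m powr q / c))"
      using c by (simp add: ennreal_mult[symmetric])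
    also have "\<dots> = ennreal c * (\<Sum>m. ennreal (dyadic_modulus r l a m powr q / c))"
      by (rule ennreal_suminf_cmult)
    also have "\<dots> \<le> ennreal c * ennreal (A powr q)" by (intro mult_left_mono sum) simp
    also have "\<dots> = ennreal ((c powr (1 / q) * A) powr q)"
      using c A q by (simp add: powr_mult powr_powr ennreal_mult)
    finally show "seq_norm p (dyadic_modulus r l a) \<le> ennreal (c powr (1 / q) * A)"
      using seq_norm_le_iff[OF p dyadic_modulus_nonneg, of "c powr (1 / q) * A"] A c False by (simp add: q_def)
  qed
qed

text \<open>Each entry of the dyadic sequence is at most its norm, so the modulus at 2^(-m) is of
  order 2^(- r m); Marchaud's descent does the rest.\<close>

lemma continuous_elements_of_seminorm:
  assumes p: "1 \<le> p" and r: "0 < r" and l: "1 \<le> l" and fin: "besov_seminorm p r l a < \<infinity>"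
  shows "a \<in> continuous_elements \<psi>"
proof (rule continuous_elements_of_modulus[OF l])
  fix e :: real assume e: "0 < e"
  obtain A where A: "0 \<le> A" "besov_seminorm p r l a = ennreal A"
    using fin by (cases "besov_seminorm p r l a") auto
  obtain K where K: "0 < K"
    "\<And>a A. 0 \<le> A \<Longrightarrow> besov_seminorm p r l a \<le> ennreal A \<Longrightarrow> seq_norm p (dyadic_modulus r l a) \<le> ennreal (K * A)"
    by (rule seq_norm_dyadic_modulus_le[OF p r]) blast
  have b: "dyadic_modulus r l a m \<le> K * A" for m
  proof -
    have "ennreal (dyadic_modulus r l a m) \<le> ennreal (K * A)"
      using seq_norm_ge[of p "dyadic_modulus r l a" m] p dyadic_modulus_nonneg K(2)[of A a] A by (auto intro: order_trans)
    then show ?thesis using K A by (simp add: ennreal_le_iff)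
  qed
  have "2 powr r > 1" using r powr_less_mono[of 0 r 2] by simp
  then obtain m where m: "K * A / e < (2 powr r) ^ m" using real_arch_pow by blast
  then have "K * A < 2 powr (r * real m) * e" using e by (simp add: powr_powr powr_realpow[symmetric] field_simps)
  then have "2 powr (r * real m) * modulus \<psi> l ((1/2) ^ m) a \<le> 2 powr (r * real m) * e"
    using b[of m] unfolding dyadic_modulus_def by linarith
  then have "modulus \<psi> l ((1/2) ^ m) a \<le> e" by simp
  then show "\<exists>h>0. modulus \<psi> l h a \<le> e" by (intro exI[of _ "(1/2) ^ m"]) simp
qed

end

section \<open>Comparison of the Besov and Littlewood-Paley norms\<close>

context littlewood_paley
begin

definition coeff :: "real \<Rightarrow> 'a \<Rightarrow> nat \<Rightarrow> real" where
  "coeff r a n = 2 powr (r * (real n - 1)) * norm (block n a)"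

lemma coeff_nonneg: "0 \<le> coeff r a n"
  by (simp add: coeff_def)

lemma littlewood_paley_norm_eq: "littlewood_paley_norm \<psi> \<phi> p r a = seq_norm p (coeff r a)"
proof -
  have "2 powr (r * (real n - 1) * q) * norm (block n a) powr q = coeff r a n powr q" for n q
    by (simp add: coeff_def powr_mult powr_powr)
  then show ?thesis
    by (simp add: littlewood_paley_norm_def seq_norm_def Let_def block_def[symmetric])
       (simp add: coeff_def)
qed

text \<open>Isolates the geometric decay of the blocks; the factor 2^r stems from the shift between
  n and the dyadic index n - 1.\<close>

lemma norm_block_eq: "norm (block n a) = 2 powr r * (2 powr (- r)) ^ n * coeff r a n"
proof -
  have "2 powr r * (2 powr (- r)) ^ n * 2 powr (r * (real n - 1)) = (2 powr (r + (- r) * real n + r * (real n - 1)) :: real)"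
    by (simp only: powr_add powr_powr[symmetric] powr_realpow) (simp add: powr_realpow)
  also have "r + (- r) * real n + r * (real n - 1) = 0" by (simp add: algebra_simps)
  finally show ?thesis by (simp add: coeff_def mult.assoc[symmetric])
qed

text \<open>Block 0 is bounded through the norm of \<open>a\<close>, every later block through a
  dyadic modulus. The coefficients are accordingly dominated by a sequence \<open>x\<close> living
  at 0 plus a shifted sequence \<open>y\<close>, and Minkowski's inequality adds the two
  bounds.\<close>

lemma seq_norm_coeff_le:
  assumes p: "1 \<le> p" and r: "0 < r"
  obtains K where "0 < K"
    "\<And>a. a \<in> continuous_elements \<psi> \<Longrightarrow> seq_norm p (coeff r a) \<le> ennreal K * (ennreal (norm a) + besov_seminorm p r l a)"
proof -
  obtain C where C: "0 \<le> C"
    "\<And>a m. a \<in> continuous_elements \<psi> \<Longrightarrow> norm (block (Suc m) a) \<le> C * modulus \<psi> l ((1/2) ^ m) a"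
    by (rule block_le_modulus[of l]) blast
  obtain D where D: "0 < D"
    "\<And>a A. 0 \<le> A \<Longrightarrow> besov_seminorm p r l a \<le> ennreal A \<Longrightarrow> seq_norm p (dyadic_modulus r l a) \<le> ennreal (D * A)"
    by (rule seq_norm_dyadic_modulus_le[OF p r, of l]) blast
  define K where "K = M * mass + C * D + 1"
  have K: "0 < K" using M_nonneg mass_nonneg C D by (simp add: K_def add_nonneg_pos)
  show ?thesis
  proof (rule that[OF K], rule ennreal_le_multI[OF K])
    fix a A assume a: "a \<in> continuous_elements \<psi>" and A: "(0::real) \<le> A"
      and le: "ennreal (norm a) + besov_seminorm p r l a \<le> ennreal A"
    have nA: "norm a \<le> A"
    proof -
      have "ennreal (norm a) \<le> ennreal (norm a) + besov_seminorm p r l a" by simp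
      also note le
      finally show ?thesis using A by (simp add: ennreal_le_iff)
    qed
    have "besov_seminorm p r l a \<le> ennreal (norm a) + besov_seminorm p r l a" by simp
    also note le
    finally have dy: "seq_norm p (dyadic_modulus r l a) \<le> ennreal (D * A)" by (rule D(2)[OF A])
    define x where "x n = (if n = 0 then M * mass * A else 0)" for n :: nat
    define y where "y n = (case n of 0 \<Rightarrow> 0 | Suc m \<Rightarrow> C * dyadic_modulus r l a m)" for n
    have x0: "0 \<le> x n" for n using M_nonneg mass_nonneg A by (simp add: x_def)
    have y0: "0 \<le> y n" for n using C dyadic_modulus_nonneg by (simp add: y_def split: nat.split)
    have "coeff r a n \<le> x n + y n" for n
    proof (cases n)
      case 0
      have "2 powr (r * (- 1)) * norm (block 0 a) \<le> 1 * norm (block 0 a)"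
        using r powr_mono[of "- r" 0 2] by (intro mult_right_mono) auto
      also have "\<dots> \<le> M * mass * norm a" by (simp add: block_0 norm_partial_le a)
      also have "\<dots> \<le> M * mass * A" using nA M_nonneg mass_nonneg by (intro mult_left_mono) auto
      finally show ?thesis using 0 by (simp add: coeff_def x_def y_def)
    next
      case (Suc m)
      have "2 powr (r * real m) * norm (block (Suc m) a) \<le> 2 powr (r * real m) * (C * modulus \<psi> l ((1/2) ^ m) a)"
        by (intro mult_left_mono C(2)[OF a]) simp
      then show ?thesis using Suc by (simp add: coeff_def x_def y_def dyadic_modulus_def mult_ac)
    qed
    then have "seq_norm p (coeff r a) \<le> seq_norm p x + seq_norm p y"
      by (intro seq_norm_triangle p x0 y0 coeff_nonneg)
    also have "seq_norm p x \<le> ennreal (M * mass * A)"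
    proof -
      have B: "0 \<le> M * mass * A" using M_nonneg mass_nonneg A by simp
      have "(\<Sum>n. ennreal (x n powr enn2real p)) = (\<Sum>n\<in>{0}. ennreal (x n powr enn2real p))"
        by (rule suminf_finite) (auto simp: x_def)
      then show ?thesis unfolding seq_norm_le_iff[OF p x0 B] using B by (auto simp: x_def)
    qed
    also have "seq_norm p y \<le> ennreal (C * (D * A))"
    proof -
      have Cd: "0 \<le> C * dyadic_modulus r l a n" for n using C dyadic_modulus_nonneg by simp
      have B: "0 \<le> C * (D * A)" using C D A by simp
      have "seq_norm p (\<lambda>m. C * dyadic_modulus r l a m) \<le> ennreal (C * (D * A))"
        by (rule seq_norm_scale_le) (use p dyadic_modulus_nonneg C D A dy in auto)
      moreover have "(\<Sum>n. ennreal (y n powr enn2real p)) = (\<Sum>m. ennreal ((C * dyadic_modulus r l a m) powr enn2real p))"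
        by (subst suminf_offset[of _ 1]) (auto simp: y_def)
      ultimately show ?thesis
        unfolding seq_norm_le_iff[OF p y0 B] seq_norm_le_iff[OF p Cd B]
        using B by (auto simp: y_def split: nat.split if_splits)
    qed
    also have "ennreal (M * mass * A) + ennreal (C * (D * A)) \<le> ennreal (K * A)"
      using M_nonneg mass_nonneg A C D by (simp add: ennreal_plus[symmetric] K_def algebra_simps ennreal_le_iff del: ennreal_plus)
    finally show "seq_norm p (coeff r a) \<le> ennreal (K * A)" by (simp add: add_mono)
  qed
qed

text \<open>For every p each coefficient is at most the sequence norm, so the blocks of
  \<open>a\<close> are dominated by a geometric series, convergent because r > 0.\<close>

lemma norm_le_seq_norm_coeff:
  assumes p: "1 \<le> p" and r: "0 < r"
  obtains K where "0 < K"
    "\<And>a. a \<in> continuous_elements \<psi> \<Longrightarrow> ennreal (norm a) \<le> ennreal K * seq_norm p (coeff r a)"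
proof -
  define x where "x = (2::real) powr (- r)"
  have x: "0 < x" "x < 1" using r powr_less_mono[of "- r" 0 2] by (auto simp: x_def)
  define K where "K = 2 powr r * (1 / (1 - x))"
  have K: "0 < K" using x by (simp add: K_def)
  show ?thesis
  proof (rule that[OF K], rule ennreal_le_multI[OF K])
    fix a A assume a: "a \<in> continuous_elements \<psi>" and A: "(0::real) \<le> A" and le: "seq_norm p (coeff r a) \<le> ennreal A"
    have cA: "coeff r a n \<le> A" for n
      using order_trans[OF seq_norm_ge[of p "coeff r a" n] le] p coeff_nonneg A by (simp add: ennreal_le_iff)
    have bl: "norm (block n a) \<le> 2 powr r * A * x ^ n" for n
      using mult_left_mono[OF cA[of n], of "2 powr r * x ^ n"] x
      by (simp add: norm_block_eq[of n a r] x_def mult_ac)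
    have g: "(\<lambda>n. 2 powr r * A * x ^ n) sums (2 powr r * A * (1 / (1 - x)))"
      using x by (intro sums_mult geometric_sums) simp
    have s: "summable (\<lambda>n. norm (block n a))"
      by (rule summable_comparison_test'[OF sums_summable[OF g], of 0]) (simp add: bl)
    have "norm a \<le> (\<Sum>n. norm (block n a))" by (rule norm_le_suminf_block[OF a s])
    also have "\<dots> \<le> (\<Sum>n. 2 powr r * A * x ^ n)" by (rule suminf_le[OF bl s sums_summable[OF g]])
    also have "\<dots> = K * A" using sums_unique[OF g] by (simp add: K_def)
    finally show "ennreal (norm a) \<le> ennreal (K * A)" by (rule ennreal_leI)
  qed
qed

text \<open>At fixed h the normalised modulus is dominated by the coefficients averaged with dyadic
  weights. For p = infinity the bound on the sum of weights is enough; for finite p it enters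
  Jensen's inequality, and the integral of each weight against dh / h completes the
  estimate.\<close>

lemma besov_seminorm_le_seq_norm_coeff:
  assumes p: "1 \<le> p" and r: "0 < r" "r < real l"
  obtains K where "0 < K"
    "\<And>a. a \<in> continuous_elements \<psi> \<Longrightarrow> besov_seminorm p r l a \<le> ennreal K * seq_norm p (coeff r a)"
proof -
  \<comment> \<open>The largest decay rate available at both ends: r for high frequencies, l - r for
    low ones.\<close>
  define s where "s = min r (real l - r)"
  have s: "0 < s" "s \<le> r" "s \<le> real l - r" using r by (auto simp: s_def)
  define W where "W = 4 * 2 powr s / (2 powr s - 1)"
  have "1 < 2 powr s" using s powr_less_mono[of 0 s 2] by simp
  then have W: "0 < W" by (simp add: W_def)
  obtain C where C: "0 < C"
    "\<And>a n h. a \<in> continuous_elements \<psi> \<Longrightarrow> 0 \<le> h \<Longrightarrow>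
      modulus \<psi> l h (block n a) \<le> C * (min 1 ((2 ^ n * h) ^ l) * norm (block n a))"
    by (rule modulus_block_le[of l]) blast
  define D where "D = C * 2 powr r"
  have D: "0 < D" using C by (simp add: D_def)
  define v where "v h n = weight s (2 ^ n * h)" for h n
  have v0: "0 \<le> v h n" for h n by (simp add: v_def weight_nonneg)
  have v: "summable (v h)" "suminf (v h) \<le> W" if "0 < h" for h
    using weight_sum[OF that s(1)] by (simp_all add: v_def[abs_def] W_def)
  \<comment> \<open>Bounded coefficients secure summability. Of (2^n * h)^r the factor h^r is moved
    to the left-hand side, while 2^(r n) cancels the decay hidden in the block norm.\<close>
  have main: "summable (\<lambda>n. v h n * coeff r a n) \<and>
      h powr (- r) * modulus \<psi> l h a \<le> D * (\<Sum>n. v h n * coeff r a n)"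
    if a: "a \<in> continuous_elements \<psi>" and bdd: "\<And>n. coeff r a n \<le> A" and h: "0 < h" for a A h
  proof
    show sm: "summable (\<lambda>n. v h n * coeff r a n)"
    proof (rule summable_comparison_test'[of "\<lambda>n. v h n * A" 0])
      show "summable (\<lambda>n. v h n * A)" by (intro summable_mult2 v h)
      show "norm (v h n * coeff r a n) \<le> v h n * A" for n
        using v0 coeff_nonneg bdd by (simp add: mult_left_mono)
    qed
    have le: "modulus \<psi> l h (block n a) \<le> D * h powr r * (v h n * coeff r a n)" for n
    proof -
      let ?u = "2 ^ n * h"
      have u: "0 < ?u" using h by simp
      have "modulus \<psi> l h (block n a) \<le> C * (min 1 (?u ^ l) * norm (block n a))" using C(2)[OF a] h by simp
      also have "\<dots> \<le> C * ((v h n * ?u powr r) * norm (block n a))"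
        unfolding v_def using C min_le_weight[OF u s] by (intro mult_left_mono mult_right_mono) auto
      also have "?u powr r = (2 powr r) ^ n * h powr r"
        using h by (simp add: powr_mult powr_powr powr_realpow[symmetric] mult.commute)
      also have "C * ((v h n * ((2 powr r) ^ n * h powr r)) * norm (block n a)) = D * h powr r * (v h n * coeff r a n)"
        unfolding norm_block_eq[of n a r] D_def by (simp add: powr_minus power_inverse field_simps)
      finally show ?thesis .
    qed
    have sm': "summable (\<lambda>n. D * h powr r * (v h n * coeff r a n))" by (intro summable_mult sm)
    have sm'': "summable (\<lambda>n. modulus \<psi> l h (block n a))"
      by (rule summable_comparison_test'[OF sm', of 0]) (use le modulus_nonneg h in auto)
    have "modulus \<psi> l h a \<le> (\<Sum>n. modulus \<psi> l h (block n a))"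
      using h by (intro modulus_le_suminf_block a sm'') auto
    also have "\<dots> \<le> (\<Sum>n. D * h powr r * (v h n * coeff r a n))" by (rule suminf_le[OF le sm'' sm'])
    also have "\<dots> = D * h powr r * (\<Sum>n. v h n * coeff r a n)" by (rule suminf_mult[OF sm])
    finally have "h powr (- r) * modulus \<psi> l h a \<le> h powr (- r) * (D * h powr r * (\<Sum>n. v h n * coeff r a n))"
      by (intro mult_left_mono) auto
    also have "\<dots> = D * (\<Sum>n. v h n * coeff r a n)"
      using h by (simp add: powr_minus)
    finally show "h powr (- r) * modulus \<psi> l h a \<le> D * (\<Sum>n. v h n * coeff r a n)" .
  qed
  show ?thesis
  proof (cases "p = \<infinity>")
    case True
    have K: "0 < D * W" using D W by simp
    show ?thesis
    proof (rule that[OF K], rule ennreal_le_multI[OF K])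
      fix a A assume a: "a \<in> continuous_elements \<psi>" and A: "(0::real) \<le> A" and le: "seq_norm p (coeff r a) \<le> ennreal A"
      have cA: "coeff r a n \<le> A" for n
        using order_trans[OF seq_norm_ge[of p "coeff r a" n] le] p coeff_nonneg A by (simp add: ennreal_le_iff)
      have "h powr (- r) * modulus \<psi> l h a \<le> D * W * A" if h: "0 < h" for h
      proof -
        note m = main[OF a cA h]
        have "(\<Sum>n. v h n * coeff r a n) \<le> (\<Sum>n. v h n * A)"
          using m v(1)[OF h] v0 cA by (intro suminf_le summable_mult2 mult_left_mono) auto
        also have "\<dots> = suminf (v h) * A" by (rule suminf_mult2[symmetric, OF v(1)[OF h]])
        also have "\<dots> \<le> W * A" by (intro mult_right_mono v h A)
        finally have "D * (\<Sum>n. v h n * coeff r a n) \<le> D * (W * A)" using D by (intro mult_left_mono) auto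
        with m show ?thesis by (simp add: mult.assoc)
      qed
      then show "besov_seminorm p r l a \<le> ennreal (D * W * A)"
        using besov_seminorm_le_iff[OF p, of "D * W * A" r l a] True A D W by simp
    qed
  next
    case False
    define q where "q = enn2real p"
    have q: "1 \<le> q" unfolding q_def by (rule exponent_ge_1[OF p False])
    \<comment> \<open>The constant left by Jensen's inequality: D^q from the pointwise bound and
      W^(q - 1) from the total weight.\<close>
    define E where "E = D powr q * W powr (q - 1)"
    have E: "0 < E" using D W by (simp add: E_def)
    have K: "0 < (E * (4 / s)) powr (1 / q)" using E s by simp
    show ?thesis
    proof (rule that[OF K], rule ennreal_le_multI[OF K])
      fix a A assume a: "a \<in> continuous_elements \<psi>" and A: "(0::real) \<le> A" and le: "seq_norm p (coeff r a) \<le> ennreal A"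
      have cA: "coeff r a n \<le> A" for n
        using order_trans[OF seq_norm_ge[of p "coeff r a" n] le] p coeff_nonneg A by (simp add: ennreal_le_iff)
      have pt: "ennreal ((h powr (- r) * modulus \<psi> l h a) powr q / h)
          \<le> (\<Sum>n. ennreal (E * coeff r a n powr q) * ennreal (v h n / h))" if h: "0 < h" for h
      proof -
        note m = main[OF a cA h]
        have sq: "summable (\<lambda>n. v h n * coeff r a n powr q)"
        proof (rule summable_comparison_test'[of "\<lambda>n. v h n * A powr q" 0])
          show "summable (\<lambda>n. v h n * A powr q)" by (intro summable_mult2 v h)
          show "norm (v h n * coeff r a n powr q) \<le> v h n * A powr q" for n
            using v0 coeff_nonneg cA q by (simp add: mult_left_mono powr_mono2)
        qed
        have S0: "0 \<le> (\<Sum>n. v h n * coeff r a n)"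
          using m v0 coeff_nonneg by (intro suminf_nonneg) auto
        have "(h powr (- r) * modulus \<psi> l h a) powr q \<le> (D * (\<Sum>n. v h n * coeff r a n)) powr q"
          using h q by (intro powr_mono2 conjunct2[OF m] mult_nonneg_nonneg modulus_nonneg) auto
        also have "\<dots> = D powr q * (\<Sum>n. v h n * coeff r a n) powr q" using D S0 by (simp add: powr_mult)
        also have "\<dots> \<le> D powr q * (W powr (q - 1) * (\<Sum>n. v h n * coeff r a n powr q))"
          using m v[OF h] sq q W v0 coeff_nonneg by (intro mult_left_mono powr_jensen) auto
        also have "\<dots> = (\<Sum>n. E * (v h n * coeff r a n powr q))"
          by (subst suminf_mult[OF sq]) (simp add: E_def mult.assoc)
        finally have "(h powr (- r) * modulus \<psi> l h a) powr q / h \<le> (\<Sum>n. E * (v h n * coeff r a n powr q)) / h"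
          using h by (intro divide_right_mono) auto
        also have "\<dots> = (\<Sum>n. (E * coeff r a n powr q) * (v h n / h))"
          by (subst suminf_divide[symmetric]) (auto intro: summable_mult sq simp: mult_ac)
        finally have "ennreal ((h powr (- r) * modulus \<psi> l h a) powr q / h)
            \<le> ennreal (\<Sum>n. (E * coeff r a n powr q) * (v h n / h))" by (rule ennreal_leI)
        also have "\<dots> = (\<Sum>n. ennreal ((E * coeff r a n powr q) * (v h n / h)))"
        proof (rule suminf_ennreal2[symmetric])
          show "0 \<le> (E * coeff r a n powr q) * (v h n / h)" for n using E v0 h by simp
          show "summable (\<lambda>n. (E * coeff r a n powr q) * (v h n / h))"
            using summable_divide[OF summable_mult[OF sq, of E], of h] by (simp add: mult_ac)
        qed
        also have "\<dots> = (\<Sum>n. ennreal (E * coeff r a n powr q) * ennreal (v h n / h))"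
          using E v0 h by (intro suminf_cong ennreal_mult) auto
        finally show ?thesis .
      qed
      have "(\<integral>\<^sup>+h\<in>{0<..}. ennreal ((h powr (- r) * modulus \<psi> l h a) powr q / h) \<partial>lborel)
          \<le> (\<integral>\<^sup>+h. (\<Sum>n. ennreal (E * coeff r a n powr q) * (ennreal (v h n / h) * indicator {0<..} h)) \<partial>lborel)"
        using pt by (intro nn_integral_mono) (auto simp: indicator_def)
      also have "\<dots> = (\<Sum>n. ennreal (E * coeff r a n powr q) * (\<integral>\<^sup>+h\<in>{0<..}. ennreal (v h n / h) \<partial>lborel))"
        unfolding v_def by (subst nn_integral_suminf) (auto simp: nn_integral_cmult)
      \<comment> \<open>The integral of each weight is 4 / s for every n, so it factors out and only
        the q-th powers of the coefficients remain.\<close>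
      also have "\<dots> = (\<Sum>n. ennreal (E * coeff r a n powr q) * ennreal (4 / s))"
        unfolding v_def using weight_integral[OF _ s(1)] by simp
      also have "\<dots> = ennreal (E * (4 / s)) * (\<Sum>n. ennreal (coeff r a n powr q))"
        using E s by (subst ennreal_suminf_cmult[symmetric]) (simp add: ennreal_mult[symmetric] mult_ac del: ennreal_suminf_cmult)
      also have "\<dots> \<le> ennreal (E * (4 / s)) * ennreal (A powr q)"
        using le seq_norm_le_iff[OF p coeff_nonneg A] False by (intro mult_left_mono) (auto simp: q_def)
      also have "\<dots> = ennreal (((E * (4 / s)) powr (1 / q) * A) powr q)"
        using E s A q by (simp add: powr_mult powr_powr ennreal_mult[symmetric] del: ennreal_mult)
      finally show "besov_seminorm p r l a \<le> ennreal ((E * (4 / s)) powr (1 / q) * A)"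
        using besov_seminorm_le_iff[OF p, of "(E * (4 / s)) powr (1 / q) * A" r l a] False A K by (simp add: q_def)
    qed
  qed
qed

end

theorem proposition3p12:
  fixes \<psi> :: "real^'d \<Rightarrow> 'a::complex_banach_algebra \<Rightarrow> 'a"
    and \<phi> :: "real^'d \<Rightarrow> complex"
    and p :: ennreal and r :: real
  assumes "automorphism_group \<psi>"
    and "dyadic_generator \<phi>"
    and "1 \<le> p"
    and "0 < r"
  shows "(\<forall>a \<in> continuous_elements \<psi>.
            a \<in> besov_space \<psi> p r \<longleftrightarrow> littlewood_paley_norm \<psi> \<phi> p r a < \<infinity>) \<and>
         norm_on (besov_space \<psi> p r) (littlewood_paley_norm \<psi> \<phi> p r) \<and>
         equivalent_on (besov_space \<psi> p r) (besov_norm \<psi> p r) (littlewood_paley_norm \<psi> \<phi> p r) \<and>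
         (\<forall>a \<in> besov_space \<psi> p r.
            (\<lambda>n. action \<psi> (dyadic_function \<phi> (int n - 1)) a) sums a)"
proof -
  interpret littlewood_paley \<psi> \<phi> by unfold_locales (fact assms)+
  note p = assms(3) and r = assms(4)
  define l where "l = nat \<lfloor>r\<rfloor> + 1"
  \<comment> \<open>\<open>r < real l\<close> serves the bound of the moduli by the blocks,
    \<open>1 \<le> l\<close> the Marchaud descent.\<close>
  have l: "r < real l" "1 \<le> l" using r by (auto simp: l_def) linarith
  let ?B = "besov_norm \<psi> p r" and ?N = "littlewood_paley_norm \<psi> \<phi> p r" and ?V = "besov_space \<psi> p r"
  have B: "?B a = ennreal (norm a) + besov_seminorm p r l a" for a by (simp add: besov_norm_eq l_def)
  obtain K1 where K1: "0 < K1" "\<And>a. a \<in> continuous_elements \<psi> \<Longrightarrow> ?N a \<le> ennreal K1 * ?B a"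
    unfolding B littlewood_paley_norm_eq by (rule seq_norm_coeff_le[OF p r]) blast
  obtain K2 where K2: "0 < K2" "\<And>a. a \<in> continuous_elements \<psi> \<Longrightarrow> ennreal (norm a) \<le> ennreal K2 * ?N a"
    unfolding littlewood_paley_norm_eq by (rule norm_le_seq_norm_coeff[OF p r]) blast
  obtain K3 where K3: "0 < K3" "\<And>a. a \<in> continuous_elements \<psi> \<Longrightarrow> besov_seminorm p r l a \<le> ennreal K3 * ?N a"
    unfolding littlewood_paley_norm_eq by (rule besov_seminorm_le_seq_norm_coeff[OF p r l(1)]) blast
  have K23: "?B a \<le> ennreal (K2 + K3) * ?N a" if "a \<in> continuous_elements \<psi>" for a
    using add_mono[OF K2(2)[OF that] K3(2)[OF that]] K2(1) K3(1) by (simp add: B distrib_right)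
  \<comment> \<open>The comparison estimates are restricted to continuous elements; this inclusion
    makes them available on the whole Besov space.\<close>
  have sub: "a \<in> continuous_elements \<psi>" if "a \<in> ?V" for a
    using that by (intro continuous_elements_of_seminorm[OF p r l(2)]) (simp add: besov_space_def B)
  have iff: "a \<in> ?V \<longleftrightarrow> ?N a < \<infinity>" if a: "a \<in> continuous_elements \<psi>" for a
  proof
    assume "a \<in> ?V"
    then have "ennreal K1 * ?B a < \<infinity>" by (simp add: besov_space_def ennreal_mult_less_top)
    then show "?N a < \<infinity>" using K1(2)[OF a] by (rule le_less_trans[rotated])
  next
    assume "?N a < \<infinity>"
    then have "ennreal (K2 + K3) * ?N a < \<infinity>" by (simp add: ennreal_mult_less_top)
    then have "?B a < \<infinity>" using K23[OF a] by (rule le_less_trans[rotated])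
    then show "a \<in> ?V" by (simp add: besov_space_def)
  qed
  have tri: "?N (a + b) \<le> ?N a + ?N b" if "a \<in> continuous_elements \<psi>" "b \<in> continuous_elements \<psi>" for a b
    unfolding littlewood_paley_norm_eq
  proof (rule seq_norm_triangle[OF p])
    show "coeff r (a + b) n \<le> coeff r a n + coeff r b n" for n
      using that by (simp add: coeff_def block_add distrib_left[symmetric] norm_triangle_ineq)
  qed (rule coeff_nonneg)+
  have scale: "?N (c *\<^sub>C a) = ennreal (cmod c) * ?N a" if "a \<in> continuous_elements \<psi>" "?N a < \<infinity>" for c a
  proof -
    have "coeff r (c *\<^sub>C a) = (\<lambda>n. cmod c * coeff r a n)"
      using that by (simp add: fun_eq_iff coeff_def block_scaleC norm_scaleC mult_ac)
    then show ?thesis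
      using that unfolding littlewood_paley_norm_eq by (simp add: seq_norm_scale[OF p coeff_nonneg])
  qed
  have "norm_on ?V ?N"
    unfolding norm_on_def
  proof (intro conjI ballI allI)
    have "?N 0 = 0"
    proof -
      have "coeff r 0 = (\<lambda>n. 0)" by (simp add: fun_eq_iff coeff_def block_def)
      then show ?thesis
        unfolding littlewood_paley_norm_eq using seq_norm_le_iff[of p "\<lambda>_. 0" 0, OF p] by simp
    qed
    then show "0 \<in> ?V" using iff[OF continuous_elements_zero] by simp
    fix a assume a: "a \<in> ?V"
    note aC = sub[OF a]
    have aN: "?N a < \<infinity>" using iff[OF aC] a by simp
    show "?N a < \<infinity>" by (rule aN)
    show "?N a = 0 \<longleftrightarrow> a = 0"
    proof
      assume "?N a = 0"
      then show "a = 0" using K2(2)[OF aC] by simp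
    qed (use \<open>?N 0 = 0\<close> in simp)
    show "c *\<^sub>C a \<in> ?V" for c
      using iff[OF continuous_elements_scaleC[OF aC]] scale[OF aC aN, of c] aN by (simp add: ennreal_mult_less_top)
    show "?N (c *\<^sub>C a) = ennreal (cmod c) * ?N a" for c by (rule scale[OF aC aN])
    fix b assume b: "b \<in> ?V"
    note bC = sub[OF b]
    have bN: "?N b < \<infinity>" using iff[OF bC] b by simp
    show "?N (a + b) \<le> ?N a + ?N b" by (rule tri[OF aC bC])
    have "?N a + ?N b < \<infinity>" using aN bN by simp
    then show "a + b \<in> ?V"
      using iff[OF continuous_elements_add[OF aC bC]] tri[OF aC bC] by (meson le_less_trans)
  qed
  moreover have "equivalent_on ?V ?B ?N"
    unfolding equivalent_on_def
  \<comment> \<open>A single constant must serve both directions, and this sum exceeds both K1 and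
    K2 + K3.\<close>
  proof (intro exI[of _ "K1 + (K2 + K3)"] conjI ballI)
    show "0 < K1 + (K2 + K3)" using K1(1) K2(1) K3(1) by simp
    fix a assume a: "a \<in> ?V"
    show "?B a \<le> ennreal (K1 + (K2 + K3)) * ?N a"
      by (rule order_trans[OF K23[OF sub[OF a]]]) (use K1 K2 K3 in \<open>intro mult_right_mono ennreal_leI, auto\<close>)
    show "?N a \<le> ennreal (K1 + (K2 + K3)) * ?B a"
      by (rule order_trans[OF K1(2)[OF sub[OF a]]]) (use K1 K2 K3 in \<open>intro mult_right_mono ennreal_leI, auto\<close>)
  qed
  moreover have "(\<lambda>n. action \<psi> (dyadic_function \<phi> (int n - 1)) a) sums a" if "a \<in> ?V" for a
    using block_sums[OF sub[OF that]] by (simp add: block_def)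
  ultimately show ?thesis using iff by blast
qed

end
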